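(* Let $X_N\in\mathbb C^{N_A}\otimes\mathbb C^N\otimes\mathbb C^N\otimes\mathbb C^{N_D}$ be a sequence of random tensors with i.i.d. standard complex Gaussian entries, where $N_A,N_D$ are arbitrary (positive integer valued) functions of $N$ satisfying $N_D\sim cN_A$ as $N\to\infty$, for some constant $c\in(0,\infty)$. Then the normalized marginals $(N_A^{-1}N^{-1}W_{AB}^{(N)},\,N_A^{-1}N^{-1}W_{AC}^{(N)})$ converge in distribution, as $N\to\infty$, to a pair of identically distributed and free elements $(x_{AB},x_{AC})$, where $x_{AB}$ and $x_{AC}$ have the Marčenko–Pastur distribution $\mathrm{MP}_c$. Equivalently, for any $p\ge1$ and any word $f\in\{AB,AC\}^p$, $$\lim_{N\to\infty}\mathbb E\,(N_AN)^{-p-1}\operatorname{Tr}\left(W^{(N)}_{f(p)}\cdots W^{(N)}_{f(2)}W^{(N)}_{f(1)}\right)=\sum_{\alpha\in\mathrm{NC}(p),\ \alpha\le\ker f}c^{\#\alpha},$$ where $\ker f$ is the partition of $\{1,\dots,p\}$ with (at most) two blocks $f^{-1}(AB)$ and $f^{-1}(AC)$. In terms of planar bicolored maps with one black vertex, the right-hand side rewrites as $$\sum_{\mathcal M\in\mathbb M_p^0,\ \Delta_f(\mathcal M)=0}c^{V(\mathcal M)-1},$$ the sum being restricted to maps all of whose white vertices only have incident edges of the same color.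
   Context: A standard complex Gaussian variable has density $\frac1\pi e^{-|z|^2}$ on $\mathbb C$. The four tensor factors are called $A,B,C,D$ in this order. Marginals: $W^{(N)}_{AB}=[\mathrm{id}\otimes\mathrm{id}\otimes\operatorname{Tr}\otimes\operatorname{Tr}](X_NX_N^* )$ and $W^{(N)}_{AC}=[\mathrm{id}\otimes\operatorname{Tr}\otimes\mathrm{id}\otimes\operatorname{Tr}](X_NX_N^* )$, both regarded as matrices on $\mathbb C^{N_A}\otimes\mathbb C^N$. Convergence in distribution means convergence of all mixed moments computed with $\mathbb E\frac1{N_AN}\operatorname{Tr}$. $\mathrm{MP}_c$ is the probability measure $\max(1-c,0)\delta_0+\frac{\sqrt{(b-x)(x-a)}}{2\pi x}\mathbf 1_{[a,b]}(x)\,dx$ with $a=(1-\sqrt c)^2$, $b=(1+\sqrt c)^2$; all its free cumulants equal $c$. $\mathrm{NC}(p)$ is the set of non-crossing partitions of $\{1,\dots,p\}$, $\#\alpha$ the number of blocks, and $\le$ the refinement order on partitions. Maps: $\mathbb M_p$ is the set of pairs $\mathcal M=(\gamma,\alpha)$ with $\gamma=(1\,2\cdots p)$ and $\alpha\in\mathcal S_p$ (bicolored combinatorial maps with one black vertex and edges $1,\dots,p$; white vertices are the cycles of $\alpha$); $V(\mathcal M)=1+\#\alpha$, and $\mathbb M_p^0$ is the subset of planar maps, those with $\#\alpha+\#(\gamma\alpha)=p+1$ ($\#$ = number of cycles). Edge $a$ carries the color $B$ if $f(a)=AB$ and $C$ if $f(a)=AC$. $\Delta_f(\mathcal M)$ is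 the number of white vertices of $\mathcal M$ having incident edges of both colors. *)

theory Defs
  imports
    "HOL-Probability.Probability"
    "HOL-Library.Poly_Mapping"
    "HOL-Library.Landau_Symbols"
    "HOL-Library.Disjoint_Sets"
    "HOL-Library.Nonpos_Ints"
    "HOL-Combinatorics.Orbits"
    "HOL-Combinatorics.Cycles"
    "Jordan_Normal_Form.Matrix"
begin

section \<open>Non-commutative probability\<close>

locale star_prob_space = vector_space sc
  for sc :: "complex \<Rightarrow> 'a \<Rightarrow> 'a::ring_1" +
  fixes star :: "'a \<Rightarrow> 'a" and \<phi> :: "'a \<Rightarrow> complex"
  assumes scale_mult_left: "sc r (a * b) = sc r a * b"
    and scale_mult_right: "sc r (a * b) = a * sc r b"
    and star_star: "star (star a) = a"
    and star_add: "star (a + b) = star a + star b"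
    and star_scale: "star (sc r a) = sc (cnj r) (star a)"
    and star_mult: "star (a * b) = star b * star a"
    and state_add: "\<phi> (a + b) = \<phi> a + \<phi> b"
    and state_scale: "\<phi> (sc r a) = r * \<phi> a"
    and state_one: "\<phi> 1 = 1"
    and state_pos: "\<phi> (star a * a) \<in> \<real>\<^sub>\<ge>\<^sub>0"

text \<open>The unital subalgebra generated by one element consists of its polynomials.\<close>

definition gen_subalgebra :: "(complex \<Rightarrow> 'a \<Rightarrow> 'a) \<Rightarrow> 'a::ring_1 \<Rightarrow> 'a set" where
  "gen_subalgebra sc x = Modules.module.span sc (range (\<lambda>k::nat. x ^ k))"

definition free_elements ::
    "(complex \<Rightarrow> 'a \<Rightarrow> 'a) \<Rightarrow> ('a \<Rightarrow> complex) \<Rightarrow> ('i \<Rightarrow> 'a::ring_1) \<Rightarrow> bool" where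
  "free_elements sc \<phi> x \<longleftrightarrow>
     (\<forall>(n::nat) (i :: nat \<Rightarrow> 'i) (a :: nat \<Rightarrow> 'a).
        n \<ge> 1 \<and>
        (\<forall>k<n. a k \<in> gen_subalgebra sc (x (i k)) \<and> \<phi> (a k) = 0) \<and>
        (\<forall>k. Suc k < n \<longrightarrow> i k \<noteq> i (Suc k)) \<longrightarrow>
        \<phi> (prod_list (map a [0..<n])) = 0)"

definition has_distribution ::
    "('a \<Rightarrow> complex) \<Rightarrow> 'a::ring_1 \<Rightarrow> real measure \<Rightarrow> bool" where
  "has_distribution \<phi> x \<mu> \<longleftrightarrow>
     (\<forall>k::nat. integrable \<mu> (\<lambda>t. t ^ k) \<and> \<phi> (x ^ k) = complex_of_real (\<integral>t. t ^ k \<partial>\<mu>))"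

definition MP_density :: "real \<Rightarrow> real \<Rightarrow> real" where
  "MP_density c x =
     (let a = (1 - sqrt c)\<^sup>2; b = (1 + sqrt c)\<^sup>2
      in sqrt ((b - x) * (x - a)) / (2 * pi * x) * indicator {a..b} x)"

definition MP :: "real \<Rightarrow> real measure" where
  "MP c = measure_of UNIV (sets borel)
     (\<lambda>S. ennreal (max (1 - c) 0) * indicator S 0 + (\<integral>\<^sup>+x\<in>S. ennreal (MP_density c x) \<partial>lborel))"

text \<open>The set function above is countably additive, so \<open>measure_of\<close> does not collapse
  to the zero measure.\<close>

lemma MP_density_measurable [measurable]: "MP_density c \<in> borel_measurable borel"
  unfolding MP_density_def Let_def by measurable

lemma sets_MP [simp, measurable_cong]: "sets (MP c) = sets borel"
  unfolding MP_def using sets.sets_measure_of_eq[of "borel :: real measure"] by simp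

lemma space_MP [simp]: "space (MP c) = UNIV"
  unfolding MP_def by (simp add: space_measure_of_conv)

lemma emeasure_MP:
  assumes S: "S \<in> sets borel"
  shows "emeasure (MP c) S = ennreal (max (1 - c) 0) * indicator S 0 +
           (\<integral>\<^sup>+x\<in>S. ennreal (MP_density c x) \<partial>lborel)"
proof -
  let ?r = "ennreal (max (1 - c) 0)"
  let ?D = "density lborel (\<lambda>x. ennreal (MP_density c x))"
  let ?f = "\<lambda>S. ?r * indicator S (0::real) + (\<integral>\<^sup>+x\<in>S. ennreal (MP_density c x) \<partial>lborel)"
  have D: "emeasure ?D A = (\<integral>\<^sup>+x\<in>A. ennreal (MP_density c x) \<partial>lborel)" if "A \<in> sets borel" for A
    using that by (subst emeasure_density) auto
  have R: "emeasure (return borel (0::real)) A = indicator A 0" if "A \<in> sets borel" for A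
    using that by simp
  have ca: "countably_additive (sets borel) ?f"
  proof (rule countably_additiveI)
    fix A :: "nat \<Rightarrow> real set"
    assume A: "range A \<subseteq> sets borel" "disjoint_family A" "(\<Union>i. A i) \<in> sets borel"
    have A': "A i \<in> sets borel" for i using A(1) by auto
    have "suminf (\<lambda>i. ?f (A i)) = suminf (\<lambda>i. ?r * emeasure (return borel (0::real)) (A i) + emeasure ?D (A i))"
      using A' by (simp only: D R)
    also have "\<dots> = suminf (\<lambda>i. ?r * emeasure (return borel (0::real)) (A i)) + suminf (\<lambda>i. emeasure ?D (A i))"
      by (rule suminf_add[symmetric]) auto
    also have "\<dots> = ?r * emeasure (return borel (0::real)) (\<Union>i. A i) + emeasure ?D (\<Union>i. A i)"
      using A(1,2) by (simp add: suminf_emeasure del: emeasure_return)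
    also have "\<dots> = ?f (\<Union>i. A i)"
      using A(3) by (simp only: D R)
    finally show "suminf (\<lambda>i. ?f (A i)) = ?f (\<Union>i. A i)" .
  qed
  show ?thesis
    unfolding MP_def
    by (rule emeasure_measure_of_sigma)
      (use S ca sets.sigma_algebra_axioms[of "borel :: real measure"] in \<open>auto simp: positive_def\<close>)
qed

text \<open>Non-commutative complex polynomials: the monoid algebra of the free monoid, written additively
  because \<open>poly_mapping\<close> multiplies by adding exponents.\<close>

datatype 'l free_monoid = Letters (letters: "'l list")

instantiation free_monoid :: (type) monoid_add
begin

definition "0 = Letters []"

definition "u + v = Letters (letters u @ letters v)"

instance
  by standard (simp_all add: zero_free_monoid_def plus_free_monoid_def)

end

type_synonym 'l nc_poly = "'l free_monoid \<Rightarrow>\<^sub>0 complex"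

section \<open>Random matrices\<close>

definition mat_trace :: "complex mat \<Rightarrow> complex" where
  "mat_trace A = (\<Sum>i<dim_row A. A $$ (i, i))"

definition mat_word :: "nat \<Rightarrow> ('l \<Rightarrow> complex mat) \<Rightarrow> 'l list \<Rightarrow> complex mat" where
  "mat_word n A w = foldr (\<lambda>l P. A l * P) w (1\<^sub>m n)"

definition converges_in_distribution ::
    "(nat \<Rightarrow> 'w measure) \<Rightarrow> (nat \<Rightarrow> nat) \<Rightarrow> (nat \<Rightarrow> 'w \<Rightarrow> 'l \<Rightarrow> complex mat) \<Rightarrow>
     ('a \<Rightarrow> complex) \<Rightarrow> ('l \<Rightarrow> 'a::ring_1) \<Rightarrow> bool" where
  "converges_in_distribution M n A \<phi> x \<longleftrightarrow>
     (\<forall>w. (\<forall>N. integrable (M N) (\<lambda>\<omega>. mat_trace (mat_word (n N) (A N \<omega>) w))) \<and>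
          (\<lambda>N. \<integral>\<omega>. mat_trace (mat_word (n N) (A N \<omega>) w) / of_nat (n N) \<partial>M N)
            \<longlonglongrightarrow> \<phi> (prod_list (map x w)))"

section \<open>The Gaussian tensor and its marginals\<close>

type_synonym tensor = "nat \<times> nat \<times> nat \<times> nat \<Rightarrow> complex"

definition standard_complex_gaussian :: "'w measure \<Rightarrow> ('w \<Rightarrow> complex) \<Rightarrow> bool" where
  "standard_complex_gaussian M Z \<longleftrightarrow>
     distributed M lborel Z (\<lambda>z. ennreal (1 / pi * exp (- (cmod z)\<^sup>2)))"

text \<open>The coordinates of \<open>\<complex>\<^sup>n\<close> are indexed by \<open>{..<n}\<close>.\<close>

definition gaussian_tensor ::
    "'w measure \<Rightarrow> nat \<Rightarrow> nat \<Rightarrow> nat \<Rightarrow> nat \<Rightarrow> ('w \<Rightarrow> tensor) \<Rightarrow> bool" where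
  "gaussian_tensor M nA nB nC nD X \<longleftrightarrow>
     (let I = {..<nA} \<times> {..<nB} \<times> {..<nC} \<times> {..<nD} in
       prob_space.indep_vars M (\<lambda>_. borel) (\<lambda>i \<omega>. X \<omega> i) I \<and>
       (\<forall>i\<in>I. standard_complex_gaussian M (\<lambda>\<omega>. X \<omega> i)))"

text \<open>The entries of \<open>T T\<^sup>*\<close> for the tensor \<open>T\<close> viewed as a column vector.\<close>

definition outer_square :: "tensor \<Rightarrow> nat \<times> nat \<times> nat \<times> nat \<Rightarrow> nat \<times> nat \<times> nat \<times> nat \<Rightarrow> complex" where
  "outer_square T i j = T i * cnj (T j)"

datatype marginal = AB | AC

text \<open>The entry of the marginal at row \<open>(a, s)\<close> and column \<open>(a', s')\<close>; here \<open>N\<close> is the common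
  dimension of the factors \<open>B\<close> and \<open>C\<close>.\<close>

fun marginal_entry ::
    "nat \<Rightarrow> nat \<Rightarrow> tensor \<Rightarrow> marginal \<Rightarrow> nat \<times> nat \<Rightarrow> nat \<times> nat \<Rightarrow> complex" where
  "marginal_entry N nD T AB (a, s) (a', s') =
     (\<Sum>t<N. \<Sum>d<nD. outer_square T (a, s, t, d) (a', s', t, d))"
| "marginal_entry N nD T AC (a, s) (a', s') =
     (\<Sum>t<N. \<Sum>d<nD. outer_square T (a, t, s, d) (a', t, s', d))"

text \<open>The basis vector \<open>(a, s)\<close> of \<open>\<complex>\<^bsup>nA\<^esup> \<otimes> \<complex>\<^sup>N\<close> has position \<open>a * N + s\<close>, for both marginals.\<close>

definition marginal_mat :: "nat \<Rightarrow> nat \<Rightarrow> nat \<Rightarrow> tensor \<Rightarrow> marginal \<Rightarrow> complex mat" where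
  "marginal_mat nA N nD T l =
     mat (nA * N) (nA * N)
       (\<lambda>(i, j). marginal_entry N nD T l (i div N, i mod N) (j div N, j mod N))"

section \<open>Non-crossing partitions\<close>

definition NC :: "nat \<Rightarrow> nat set set set" where
  "NC p = {\<alpha>. partition_on {1..p} \<alpha> \<and>
     (\<forall>B\<in>\<alpha>. \<forall>B'\<in>\<alpha>. \<forall>i j k l.
        i < j \<and> j < k \<and> k < l \<and> i \<in> B \<and> k \<in> B \<and> j \<in> B' \<and> l \<in> B' \<longrightarrow> B = B')}"

definition ker_partition :: "nat \<Rightarrow> (nat \<Rightarrow> marginal) \<Rightarrow> nat set set" where
  "ker_partition p f = {{i\<in>{1..p}. f i = AB}, {i\<in>{1..p}. f i = AC}} - {{}}"

section \<open>Bicolored combinatorial maps with one black vertex\<close>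

type_synonym bicolored_map = "(nat \<Rightarrow> nat) \<times> (nat \<Rightarrow> nat)"

text \<open>Cycles as sets of points; fixed points count as cycles.\<close>

definition cycles :: "nat \<Rightarrow> (nat \<Rightarrow> nat) \<Rightarrow> nat set set" where
  "cycles p \<sigma> = orbit \<sigma> ` {1..p}"

definition maps :: "nat \<Rightarrow> bicolored_map set" where
  "maps p = {(\<gamma>, \<alpha>). \<gamma> = cycle_of_list [1..<Suc p] \<and> \<alpha> permutes {1..p}}"

definition white_vertices :: "nat \<Rightarrow> bicolored_map \<Rightarrow> nat set set" where
  "white_vertices p m = cycles p (snd m)"

definition num_vertices :: "nat \<Rightarrow> bicolored_map \<Rightarrow> nat" where
  "num_vertices p m = 1 + card (white_vertices p m)"

definition planar_maps :: "nat \<Rightarrow> bicolored_map set" where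
  "planar_maps p =
     {(\<gamma>, \<alpha>) \<in> maps p. card (cycles p \<alpha>) + card (cycles p (\<gamma> \<circ> \<alpha>)) = p + 1}"

text \<open>The edge color \<open>B\<close> is encoded by \<open>AB\<close> and the edge color \<open>C\<close> by \<open>AC\<close>.\<close>

definition bicolored_vertices :: "nat \<Rightarrow> (nat \<Rightarrow> marginal) \<Rightarrow> bicolored_map \<Rightarrow> nat" where
  "bicolored_vertices p f m =
     card {v \<in> white_vertices p m. (\<exists>a\<in>v. f a = AB) \<and> (\<exists>a\<in>v. f a = AC)}"

end

theory Submission
  imports Defs
begin

text \<open>
  By Wick's formula the expected trace of a word \<open>f\<close> of length \<open>p\<close> is the sum over the permutations \<open>\<alpha>\<close>
  of \<open>{1..p}\<close> of \<open>N\<^sub>A\<close> to the number of cycles of \<open>\<gamma>\<alpha>\<close>, times \<open>N\<^sub>D\<close> to the number of cycles of \<open>\<alpha>\<close>,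
  times \<open>N\<close> to the number of cycles of \<open>\<Gamma>(\<alpha> \<times> id)\<close> on two copies of \<open>{1..p}\<close>, where \<open>\<Gamma>\<close> is the
  cycle through the points \<open>(k, f k)\<close>. Composing a permutation with a cycle of length \<open>p\<close> that meets
  \<open>h\<close> of its cycles raises the number of cycles by at most \<open>p + 1 - 2h\<close>. Applied to \<open>\<gamma>\<close> this is the genus
  inequality; applied to \<open>\<Gamma>\<close> it shows that the exponent of \<open>N\<close> is at most \<open>p + 1\<close>, with equality only
  if \<open>\<alpha>\<close> is planar and all its cycles are monochrome.

  Removing the last point from a planar permutation yields the recursion
  \<open>m(lw) = c m(w) + \<Sum> m(u) m(lv)\<close> for the limit moments, the sum running over the factorisations
  \<open>w = ulv\<close>. On products of centred powers this recursion acts as a derivation, which gives freeness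
  by induction on the number of factors. For words in one letter the generating function is
  algebraic of degree two, so that its coefficients satisfy a linear recurrence, which integration
  by parts also gives for the moments of the Marchenko-Pastur density. The limit functional is a
  state because it is a limit of normalised traces.
\<close>

section \<open>Cycle counts\<close>

text \<open>Only N is known to grow: N_A and N_D may stay bounded, so a deficit in their exponents
  forces no decay, and every term outside the limit has to be killed by N alone. Hence the cycles of
  \<Gamma> must detect non-planarity and mixed colours at once. For monochrome \<alpha> the exponent
  of N equals the sum of the exponents of N_A and N_D.

  The bound p + 1 - 2h comes from writing the p-cycle as p - 1 transpositions. Each of them changes
  the number of cycles by one, and h - 1 of them reach a cycle not met before and therefore merge,
  which leaves at most (p - 1) - 2(h - 1).

  Planar cycles run downwards because \<gamma> already moves points up by one: the interval from
  \<alpha> x up to x, with x excluded, is invariant under \<open>\<alpha> \<circ> \<gamma>\<close>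
  exactly when the descent from x to \<alpha> x jumps over an invariant gap.

  No cumulants enter: the recursion on the first letter takes their place. Positivity of the limit
  functional is invisible in the combinatorics, so it has to be inherited from the matrices.\<close>

definition num_cycles :: "'a set \<Rightarrow> ('a \<Rightarrow> 'a) \<Rightarrow> nat" where
  "num_cycles S \<sigma> = card (orbit \<sigma> ` S)"

lemma self_in_orbit_permutes:
  assumes "\<sigma> permutes S" "finite S" shows "x \<in> orbit \<sigma> x"
  by (rule permutation_self_in_orbit) (use assms permutation_permutes in metis)

lemma orbit_eq_permutes:
  assumes "\<sigma> permutes S" "finite S" "y \<in> orbit \<sigma> x" shows "orbit \<sigma> y = orbit \<sigma> x"
  using orbit_cyclic_eq3[OF cyclic_on_orbit[OF assms(1,2)] assms(3)] .

lemma orbit_subset_invariant: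
  assumes "x \<in> A" "\<And>y. y \<in> A \<Longrightarrow> \<sigma> y \<in> A" shows "orbit \<sigma> x \<subseteq> A"
proof
  fix y assume "y \<in> orbit \<sigma> x" then show "y \<in> A" by induct (use assms in auto)
qed

lemma image_eq_permutes_invariant:
  assumes "\<sigma> permutes S" "finite A" "\<sigma> ` A \<subseteq> A" shows "\<sigma> ` A = A"
  by (rule endo_inj_surj) (use assms permutes_inj_on in auto)

lemma permutes_invariant_iff:
  assumes "\<sigma> permutes S" "finite A" "\<sigma> ` A \<subseteq> A" shows "\<sigma> x \<in> A \<longleftrightarrow> x \<in> A"
  using image_eq_permutes_invariant[OF assms] permutes_inj[OF assms(1)]
  by (metis (no_types, lifting) image_iff inj_eq)

lemma num_cycles_id: "num_cycles S id = card S"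
proof -
  have "orbit id x = {x}" for x :: 'a by (simp add: orbit_eq_singleton_iff)
  then show ?thesis unfolding num_cycles_def by (simp add: card_image)
qed

lemma num_cycles_cong:
  assumes "\<And>x. x \<in> S \<Longrightarrow> \<sigma> x = \<tau> x" "\<tau> permutes S"
  shows "num_cycles S \<sigma> = num_cycles S \<tau>"
proof -
  have "orbit \<sigma> x = orbit \<tau> x" if "x \<in> S" for x
    by (rule orbit_cong0[of x S]) (use that assms permutes_in_image[OF assms(2)] in auto)
  then show ?thesis unfolding num_cycles_def by (metis (mono_tags, lifting) image_cong)
qed

lemma num_cycles_Un:
  assumes \<sigma>: "\<sigma> permutes S" and fin: "finite S" and S: "S = A \<union> B" "A \<inter> B = {}" and inv: "\<sigma> ` A \<subseteq> A" "\<sigma> ` B \<subseteq> B"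
  shows "num_cycles S \<sigma> = num_cycles A \<sigma> + num_cycles B \<sigma>"
proof -
  have "orbit \<sigma> x \<subseteq> A" if "x \<in> A" for x
    by (rule orbit_subset_invariant) (use that inv in auto)
  moreover have "x \<in> orbit \<sigma> x" for x by (rule self_in_orbit_permutes[OF \<sigma> fin])
  ultimately have "orbit \<sigma> x \<noteq> orbit \<sigma> y" if "x \<in> A" "y \<in> B" for x y
    using that S(2) by (metis disjoint_iff subsetD)
  then have "orbit \<sigma> ` A \<inter> orbit \<sigma> ` B = {}" by (auto simp: disjoint_iff)
  then show ?thesis
    unfolding num_cycles_def S(1) image_Un using fin S(1) by (intro card_Un_disjoint) auto
qed

text \<open>An injection that intertwines two permutations carries orbits onto orbits. Since
  \<open>A\<close> may be a proper subset of \<open>S\<close>, this serves for conjugate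
  permutations and also for copies of {1..p} inside a larger set.\<close>

lemma num_cycles_image:
  assumes \<sigma>: "\<sigma> permutes S" and fin: "finite S" "finite T" and inj: "inj_on h T" and h: "h ` T = A" "A \<subseteq> S"
    and \<tau>: "\<tau> permutes T" and eq: "\<And>x. x \<in> T \<Longrightarrow> \<sigma> (h x) = h (\<tau> x)"
  shows "num_cycles A \<sigma> = num_cycles T \<tau>"
proof -
  have sub: "orbit \<tau> x \<subseteq> T" if "x \<in> T" for x using permutes_orbit_subset[OF \<tau> that] .
  have *: "h ` orbit \<tau> x = orbit \<sigma> (h x)" if "x \<in> T" for x
    by (rule orbit_inverse[OF self_in_orbit_permutes[OF \<tau> fin(2)]]) (use sub that eq in auto)
  have "orbit \<sigma> ` A = image h ` (orbit \<tau> ` T)"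
    unfolding h(1)[symmetric] image_image using * by (intro image_cong) auto
  moreover have "inj_on (image h) (orbit \<tau> ` T)"
    by (rule inj_on_subset[OF inj_on_image_Pow[OF inj]]) (use sub in auto)
  ultimately show ?thesis unfolding num_cycles_def by (simp add: card_image)
qed

text \<open>The map \<sigma> itself intertwines the two products: \<sigma>\<tau> after \<sigma> is
  \<sigma> after \<tau>\<sigma>.\<close>

lemma num_cycles_comm:
  assumes "\<sigma> permutes S" "\<tau> permutes S" "finite S"
  shows "num_cycles S (\<sigma> \<circ> \<tau>) = num_cycles S (\<tau> \<circ> \<sigma>)"
  using num_cycles_image[OF permutes_compose[OF assms(2,1)] assms(3,3) permutes_inj_on[OF assms(1)]
      permutes_image[OF assms(1)] order.refl permutes_compose[OF assms(1,2)]]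
  by (simp only: comp_apply)

text \<open>The new map leaves a along the old cycle of b, reaches b, and leaves b along the old
  cycle of a. The two cycles are thus spliced into one, and all others are untouched.\<close>

lemma num_cycles_transpose_join:
  assumes \<sigma>: "\<sigma> permutes S" and fin: "finite S" and ab: "a \<in> S" "b \<in> S" "b \<notin> orbit \<sigma> a"
  shows "Suc (num_cycles S (\<sigma> \<circ> Transposition.transpose a b)) = num_cycles S \<sigma>"
    and "b \<in> orbit (\<sigma> \<circ> Transposition.transpose a b) a"
proof -
  let ?s = "\<sigma> \<circ> Transposition.transpose a b"
  let ?O = "orbit \<sigma> a \<union> orbit \<sigma> b"
  have s: "?s permutes S" by (rule permutes_compose[OF permutes_swap_id[OF ab(1,2)] \<sigma>])
  note self = self_in_orbit_permutes[OF \<sigma> fin] self_in_orbit_permutes[OF s fin]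
  have ne: "a \<notin> orbit \<sigma> b" using ab orbit_eq_permutes[OF \<sigma> fin] self by blast
  have outside: "orbit ?s x = orbit \<sigma> x" if "x \<notin> ?O" for x
  proof (rule orbit_cong[OF self(1)])
    fix y assume "y \<in> orbit \<sigma> x"
    then have "y \<noteq> a" "y \<noteq> b" using that orbit_eq_permutes[OF \<sigma> fin] self by blast+
    then show "?s y = \<sigma> y" by simp
  qed
  have sa: "?s a = \<sigma> b" and sb: "?s b = \<sigma> a" and sy: "y \<noteq> a \<Longrightarrow> y \<noteq> b \<Longrightarrow> ?s y = \<sigma> y" for y by simp_all
  \<comment> \<open>From b the new map enters the old cycle of a, which does not contain b, and
    agrees with \<sigma> there until it comes to a.\<close>
  have fromb: "orbit \<sigma> a \<subseteq> orbit ?s b"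
  proof
    fix y assume "y \<in> orbit \<sigma> a"
    then show "y \<in> orbit ?s b"
    proof induct
      case base show ?case using orbit.base[of ?s b] unfolding sb .
    next
      case (step y)
      show ?case
      proof (cases "y = a")
        case True show ?thesis unfolding True using orbit.base[of ?s b] unfolding sb .
      next
        case False
        moreover have "y \<noteq> b" using step ab by auto
        ultimately show ?thesis using orbit.step[OF step(2)] sy by metis
      qed
    qed
  qed
  have froma: "orbit \<sigma> b \<subseteq> orbit ?s a"
  proof
    fix y assume "y \<in> orbit \<sigma> b"
    then show "y \<in> orbit ?s a"
    proof induct
      case base show ?case using orbit.base[of ?s a] unfolding sa .
    next
      case (step y)
      show ?case
      proof (cases "y = b")
        case True show ?thesis unfolding True using orbit.base[of ?s a] unfolding sa .
      next
        case False
        moreover have "y \<noteq> a" using step ne by auto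
        ultimately show ?thesis using orbit.step[OF step(2)] sy by metis
      qed
    qed
  qed
  show 1: "b \<in> orbit ?s a" using froma self by blast
  have eq: "orbit ?s a = orbit ?s b" using orbit_eq_permutes[OF s fin 1] by simp
  have inv: "?s y \<in> ?O" if "y \<in> ?O" for y
  proof -
    have "\<sigma> y \<in> ?O" if "y \<in> ?O" for y using that orbit.step by fastforce
    moreover have "Transposition.transpose a b y \<in> ?O"
      using that self(1)[of a] self(1)[of b] by (cases "y = a \<or> y = b") auto
    ultimately show ?thesis by simp
  qed
  have O: "orbit ?s a = ?O"
    using orbit_subset_invariant[of a ?O ?s, OF _ inv] self froma fromb eq by auto
  have Ox: "orbit ?s x = ?O" if "x \<in> ?O" for x
    using O orbit_eq_permutes[OF s fin, of x a] that by auto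
  let ?R = "orbit \<sigma> ` (S - ?O)"
  have OS: "?O \<subseteq> S" using permutes_orbit_subset[OF \<sigma>] ab by blast
  have sub: "orbit \<sigma> x \<inter> ?O = {}" if "x \<notin> ?O" for x
    using that orbit_eq_permutes[OF \<sigma> fin] self by blast
  have S: "S = (S - ?O) \<union> ?O" using OS by auto
  have "orbit ?s ` S = orbit ?s ` (S - ?O) \<union> orbit ?s ` ?O" using S by (metis image_Un)
  also have "orbit ?s ` (S - ?O) = ?R" using outside by (intro image_cong) auto
  also have "orbit ?s ` ?O = {?O}" using Ox self by blast
  finally have e1: "orbit ?s ` S = insert ?O ?R" by (metis Un_insert_right sup_bot_right)
  have "orbit \<sigma> ` S = orbit \<sigma> ` (S - ?O) \<union> orbit \<sigma> ` ?O" using S by (metis image_Un)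
  also have "orbit \<sigma> ` ?O = {orbit \<sigma> a, orbit \<sigma> b}"
  proof -
    have "orbit \<sigma> ` orbit \<sigma> x = {orbit \<sigma> x}" for x
      using orbit_eq_permutes[OF \<sigma> fin] self by blast
    then show ?thesis by (simp add: image_Un insert_commute)
  qed
  finally have e2: "orbit \<sigma> ` S = insert (orbit \<sigma> a) (insert (orbit \<sigma> b) ?R)" by auto
  have n1: "?O \<notin> ?R" "orbit \<sigma> a \<notin> ?R" "orbit \<sigma> b \<notin> ?R" using sub self by blast+
  have n2: "orbit \<sigma> a \<noteq> orbit \<sigma> b" using ne self by blast
  have "finite ?R" using fin by simp
  then show "Suc (num_cycles S ?s) = num_cycles S \<sigma>"
    unfolding num_cycles_def e1 e2 using n1 n2 by simp
qed

text \<open>The arc from \<sigma> a to the first visit of b does not contain a. The new map sends b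
  back to \<sigma> a, so it closes this arc and a is left outside.\<close>

lemma transpose_splits_orbit:
  assumes \<sigma>: "\<sigma> permutes S" and fin: "finite S" and ab: "a \<in> S" "b \<in> S" "b \<in> orbit \<sigma> a" "a \<noteq> b"
  shows "b \<notin> orbit (\<sigma> \<circ> Transposition.transpose a b) a"
proof
  let ?s = "\<sigma> \<circ> Transposition.transpose a b"
  assume asm: "b \<in> orbit ?s a"
  have s: "?s permutes S" by (rule permutes_compose[OF permutes_swap_id[OF ab(1,2)] \<sigma>])
  have "a \<in> orbit ?s b" using orbit_eq_permutes[OF s fin asm] self_in_orbit_permutes[OF s fin] by metis
  obtain n0 where n0: "b = (\<sigma> ^^ n0) a" "0 < n0" using ab(3) unfolding orbit_altdef by auto
  define n where "n = (LEAST n. b = (\<sigma> ^^ n) a \<and> 0 < n)"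
  have n: "b = (\<sigma> ^^ n) a" "0 < n" using LeastI[of "\<lambda>n. b = (\<sigma> ^^ n) a \<and> 0 < n", OF conjI[OF n0]] unfolding n_def by auto
  have least: "b \<noteq> (\<sigma> ^^ i) a" if "0 < i" "i < n" for i
    using not_less_Least[of i "\<lambda>n. b = (\<sigma> ^^ n) a \<and> 0 < n"] that unfolding n_def by auto
  have nota: "a \<noteq> (\<sigma> ^^ i) a" if "0 < i" "i \<le> n" for i
  proof
    assume e: "a = (\<sigma> ^^ i) a"
    have "i \<noteq> n" using e n ab by auto
    have "b = (\<sigma> ^^ (n - i)) ((\<sigma> ^^ i) a)" using n that by (metis add.commute funpow_add le_add_diff_inverse o_apply)
    then have "b = (\<sigma> ^^ (n - i)) a" using e by simp
    then show False using least[of "n - i"] that \<open>i \<noteq> n\<close> by auto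
  qed
  let ?A = "{(\<sigma> ^^ i) a | i. 0 < i \<and> i \<le> n}"
  have "?s y \<in> ?A" if y: "y \<in> ?A" for y
  proof -
    obtain i where i: "y = (\<sigma> ^^ i) a" "0 < i" "i \<le> n" using y by auto
    then have "y \<noteq> a" using nota by metis
    show ?thesis
    proof (cases "y = b")
      case True
      then have "?s y = (\<sigma> ^^ 1) a" by simp
      moreover have "0 < (1::nat)" "1 \<le> n" using n(2) by auto
      ultimately show ?thesis by blast
    next
      case False
      then have "i \<noteq> n" using i n by auto
      have "?s y = (\<sigma> ^^ Suc i) a" using False \<open>y \<noteq> a\<close> i by simp
      moreover have "0 < Suc i" "Suc i \<le> n" using i \<open>i \<noteq> n\<close> by auto
      ultimately show ?thesis by blast
    qed
  qed
  then have "orbit ?s b \<subseteq> ?A" by (intro orbit_subset_invariant) (use n in auto)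
  then have "a \<in> ?A" using \<open>a \<in> orbit ?s b\<close> by auto
  then show False using nota by auto
qed

text \<open>Applying the same transposition twice gives back \<sigma>, so the count for splitting is
  the count for merging read backwards. The changes are added on opposite sides to avoid subtraction
  of naturals.\<close>

lemma num_cycles_transpose_right:
  assumes \<sigma>: "\<sigma> permutes S" and fin: "finite S" and ab: "a \<in> S" "b \<in> S" "a \<noteq> b"
  shows "num_cycles S (\<sigma> \<circ> Transposition.transpose a b) + (if b \<in> orbit \<sigma> a then 0 else 1) =
         num_cycles S \<sigma> + (if b \<in> orbit \<sigma> a then 1 else 0)"
    and "b \<in> orbit (\<sigma> \<circ> Transposition.transpose a b) a \<longleftrightarrow> b \<notin> orbit \<sigma> a"
proof -
  let ?s = "\<sigma> \<circ> Transposition.transpose a b"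
  have s: "?s permutes S" by (rule permutes_compose[OF permutes_swap_id[OF ab(1,2)] \<sigma>])
  have undo: "?s \<circ> Transposition.transpose a b = \<sigma>" by (simp add: fun_eq_iff)
  show iff: "b \<in> orbit ?s a \<longleftrightarrow> b \<notin> orbit \<sigma> a"
    using num_cycles_transpose_join(2)[OF \<sigma> fin ab(1,2)] transpose_splits_orbit[OF \<sigma> fin ab(1,2) _ ab(3)] by blast
  show "num_cycles S ?s + (if b \<in> orbit \<sigma> a then 0 else 1) = num_cycles S \<sigma> + (if b \<in> orbit \<sigma> a then 1 else 0)"
    using num_cycles_transpose_join(1)[OF \<sigma> fin ab(1,2)] num_cycles_transpose_join(1)[OF s fin ab(1,2)] iff
    unfolding undo by auto
qed

lemma num_cycles_transpose_left:
  assumes \<sigma>: "\<sigma> permutes S" and fin: "finite S" and ab: "a \<in> S" "b \<in> S" "a \<noteq> b"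
  shows "num_cycles S (Transposition.transpose a b \<circ> \<sigma>) + (if b \<in> orbit \<sigma> a then 0 else 1) =
         num_cycles S \<sigma> + (if b \<in> orbit \<sigma> a then 1 else 0)"
    and "b \<in> orbit (Transposition.transpose a b \<circ> \<sigma>) a \<longleftrightarrow> b \<notin> orbit \<sigma> a"
proof -
  have t: "Transposition.transpose a b permutes S" by (rule permutes_swap_id[OF ab(1,2)])
  show "num_cycles S (Transposition.transpose a b \<circ> \<sigma>) + (if b \<in> orbit \<sigma> a then 0 else 1) =
         num_cycles S \<sigma> + (if b \<in> orbit \<sigma> a then 1 else 0)"
    using num_cycles_transpose_right(1)[OF assms] num_cycles_comm[OF \<sigma> t fin] by simp
  let ?s = "\<sigma> \<circ> Transposition.transpose a b" and ?t = "Transposition.transpose a b"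
  have s: "?s permutes S" "(?t \<circ> \<sigma>) permutes S" by (rule permutes_compose[OF t \<sigma>] permutes_compose[OF \<sigma> t])+
  have "?t ` orbit ?s a = orbit (?t \<circ> \<sigma>) (?t a)"
    by (rule orbit_inverse[OF self_in_orbit_permutes[OF s(1) fin]]) (simp only: comp_apply)
  then have "orbit (?t \<circ> \<sigma>) b = ?t ` orbit ?s a" unfolding transpose_apply_first by (rule sym)
  then have "a \<in> orbit (?t \<circ> \<sigma>) b \<longleftrightarrow> b \<in> orbit ?s a"
    by (simp only: in_transpose_image_iff transpose_apply_first)
  then show "b \<in> orbit (?t \<circ> \<sigma>) a \<longleftrightarrow> b \<notin> orbit \<sigma> a"
    using num_cycles_transpose_right(2)[OF assms] orbit_swap[OF self_in_orbit_permutes[OF s(2) fin]] by blast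
qed

text \<open>A cycle through i, j, ... is the transposition of i and j after the cycle through j,
  .... If the cycle of i was already met, the left side gains at most one from the transposition. If
  it is new, the transposition merges, and the loss of one is offset by the two from the second
  term. In both cases the gain is at most the one from the length.\<close>

lemma num_cycles_cycle_comp_le:
  assumes "\<pi> permutes S" "finite S" "distinct xs" "set xs \<subseteq> S" "xs \<noteq> []"
  shows "num_cycles S (cycle_of_list xs \<circ> \<pi>) + 2 * card (orbit \<pi> ` set xs) \<le> num_cycles S \<pi> + length xs + 1"
  using assms(3-)
proof (induction xs rule: cycle_of_list.induct)
  case (1 i j cs)
  note \<pi> = assms(1) and fin = assms(2)
  let ?s = "cycle_of_list (j # cs) \<circ> \<pi>"
  have s: "?s permutes S"
    using permutes_compose[OF \<pi> permutes_subset[OF cycle_permutes]] 1 by auto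
  have IH: "num_cycles S ?s + 2 * card (orbit \<pi> ` set (j # cs)) \<le> num_cycles S \<pi> + length (j # cs) + 1"
    by (rule 1(1)) (use 1 in auto)
  have e: "cycle_of_list (i # j # cs) \<circ> \<pi> = Transposition.transpose i j \<circ> ?s"
    unfolding cycle_of_list.simps by (rule comp_assoc)
  have ij: "i \<in> S" "j \<in> S" "i \<noteq> j" using 1 by auto
  note T = num_cycles_transpose_left(1)[OF s fin ij]
  have T': "num_cycles S (Transposition.transpose i j \<circ> ?s) \<le> num_cycles S ?s + 1"
  proof (cases "j \<in> orbit ?s i")
    case True show ?thesis using T unfolding if_P[OF True] by linarith
  next
    case False show ?thesis using T unfolding if_not_P[OF False] by linarith
  qed
  have len: "length (i # j # cs) = Suc (length (j # cs))" by simp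
  show ?case
  proof (cases "orbit \<pi> i \<in> orbit \<pi> ` set (j # cs)")
    case True
    then have "orbit \<pi> ` set (i # j # cs) = orbit \<pi> ` set (j # cs)" by auto
    then have "card (orbit \<pi> ` set (i # j # cs)) = card (orbit \<pi> ` set (j # cs))" by (rule arg_cong)
    then show ?thesis unfolding e using T' IH len by linarith
  next
    case False
    \<comment> \<open>No point of this orbit lies on the shorter list, so the part of the cycle
      composed so far leaves the orbit alone.\<close>
    have "orbit ?s i = orbit \<pi> i"
    proof (rule orbit_cong[OF self_in_orbit_permutes[OF \<pi> fin]])
      fix y assume "y \<in> orbit \<pi> i"
      then have "\<pi> y \<in> orbit \<pi> i" by (rule orbit.step)
      then have "orbit \<pi> (\<pi> y) = orbit \<pi> i" using orbit_eq_permutes[OF \<pi> fin] by simp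
      then have "\<pi> y \<notin> set (j # cs)" using False by (metis image_eqI)
      then show "?s y = \<pi> y" using id_outside_supp by (metis comp_apply)
    qed
    moreover have "j \<notin> orbit \<pi> i"
      using False orbit_eq_permutes[OF \<pi> fin] by (metis image_eqI list.set_intros(1))
    ultimately have "j \<notin> orbit ?s i" by argo
    moreover have "card (orbit \<pi> ` set (i # j # cs)) = Suc (card (orbit \<pi> ` set (j # cs)))"
      using False by simp
    ultimately show ?thesis unfolding e using T IH len by presburger
  qed
qed (use assms in \<open>auto simp: fun_eq_iff num_cycles_def comp_def\<close>)

text \<open>An invariant function is a free choice of one value per cycle. This is how each family
  of summation indices becomes a power of its dimension.\<close>

lemma card_invariant_functions:
  assumes \<sigma>: "\<sigma> permutes S" and fin: "finite S" and D: "finite D"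
  shows "card {g \<in> S \<rightarrow>\<^sub>E D. \<forall>x\<in>S. g (\<sigma> x) = g x} = card D ^ num_cycles S \<sigma>"
proof -
  note self = self_in_orbit_permutes[OF \<sigma> fin] and eq = orbit_eq_permutes[OF \<sigma> fin]
  let ?L = "{g \<in> S \<rightarrow>\<^sub>E D. \<forall>x\<in>S. g (\<sigma> x) = g x}" and ?R = "(orbit \<sigma> ` S) \<rightarrow>\<^sub>E D"
  define lift where "lift h = (\<lambda>x\<in>S. h (orbit \<sigma> x))" for h :: "'a set \<Rightarrow> 'b"
  have const: "g y = g x" if "g \<in> ?L" "x \<in> S" "y \<in> orbit \<sigma> x" for g x y
    using that(3)
  proof induct
    case (step z)
    then have "z \<in> S" using permutes_orbit_subset[OF \<sigma> that(2)] by auto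
    then show ?case using step that(1) by auto
  qed (use that in auto)
  have "bij_betw lift ?R ?L"
  proof (intro bij_betw_imageI)
    show "inj_on lift ?R"
    proof (rule inj_onI)
      fix g h assume g: "g \<in> ?R" and h: "h \<in> ?R" and e: "lift g = lift h"
      show "g = h"
      proof (rule PiE_ext[OF g h])
        fix C assume "C \<in> orbit \<sigma> ` S"
        then show "g C = h C" using fun_cong[OF e] unfolding lift_def by (metis (no_types, lifting) image_iff restrict_apply')
      qed
    qed
    show "lift ` ?R = ?L"
    proof (intro equalityI subsetI)
      fix g assume "g \<in> lift ` ?R"
      then obtain h where h: "h \<in> ?R" "g = lift h" by auto
      have "orbit \<sigma> (\<sigma> x) = orbit \<sigma> x" for x using eq[OF orbit.base] .
      moreover have "\<sigma> x \<in> S" if "x \<in> S" for x using permutes_in_image[OF \<sigma>] that by simp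
      ultimately show "g \<in> ?L" using h(1) unfolding h(2) by (simp add: lift_def PiE_iff)
    next
      fix g assume g: "g \<in> ?L"
      define h where "h = (\<lambda>C\<in>orbit \<sigma> ` S. g (SOME x. x \<in> C))"
      have some: "(SOME y. y \<in> orbit \<sigma> x) \<in> orbit \<sigma> x" for x using self by (rule someI)
      have "h (orbit \<sigma> x) = g x" if "x \<in> S" for x
        using that const[OF g that some] by (simp add: h_def)
      moreover have "h \<in> ?R"
        using g subsetD[OF permutes_orbit_subset[OF \<sigma>] some] by (simp add: h_def PiE_iff)
      ultimately show "g \<in> lift ` ?R"
        using g by (intro image_eqI[of _ _ h]) (simp_all add: lift_def PiE_iff extensional_def fun_eq_iff)
    qed
  qed
  then have "card ?L = card ?R" by (rule bij_betw_same_card[symmetric])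
  also have "\<dots> = card D ^ num_cycles S \<sigma>"
    using fin by (simp add: card_PiE num_cycles_def)
  finally show ?thesis .
qed

section \<open>Planar permutations and non-crossing partitions\<close>

text \<open>Every descent jumps over an invariant interval. For a permutation this means that the cycles are
  non-crossing and each of them runs through its points in decreasing order.\<close>

definition nc_perm :: "(nat \<Rightarrow> nat) \<Rightarrow> bool" where
  "nc_perm \<alpha> \<longleftrightarrow> (\<forall>y z. \<alpha> y < z \<longrightarrow> z < y \<longrightarrow> \<alpha> y < \<alpha> z \<and> \<alpha> z < y)"

lemma nc_permD: "nc_perm \<alpha> \<Longrightarrow> \<alpha> y < z \<Longrightarrow> z < y \<Longrightarrow> \<alpha> y < \<alpha> z \<and> \<alpha> z < y"
  unfolding nc_perm_def by blast

lemma nc_permI: "(\<And>y z. \<alpha> y < y \<Longrightarrow> \<alpha> y < z \<Longrightarrow> z < y \<Longrightarrow> \<alpha> y < \<alpha> z \<and> \<alpha> z < y) \<Longrightarrow> nc_perm \<alpha>"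
  unfolding nc_perm_def by (meson less_trans)

lemma nc_perm_id: "nc_perm id"
  by (simp add: nc_perm_def)

text \<open>Here \<alpha> inserts p into the cycle of j, just before j. The only new descent goes
  from p to j and jumps over exactly the points that \<open>inv\<close> keeps together. The preimage
  of j was no descent, again by \<open>inv\<close>, and now ascends to p; so all other descents are
  shared by \<alpha> and \<beta>.\<close>

lemma nc_perm_transpose:
  assumes perm: "\<beta> permutes S" and S: "S \<subseteq> {..<p}" and j: "j < p"
    and inv: "\<And>x. j < x \<Longrightarrow> x < p \<Longrightarrow> j < \<beta> x \<and> \<beta> x < p"
    and \<alpha>: "\<alpha> = Transposition.transpose p j \<circ> \<beta>"
  shows "nc_perm \<alpha> \<longleftrightarrow> nc_perm \<beta>"
proof -
  have p: "\<beta> p = p" and above: "y > p \<Longrightarrow> \<beta> y = y" for y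
    using permutes_not_in[OF perm] S by (meson lessThan_iff less_asym less_irrefl subsetD)+
  have lt: "\<beta> y < p" if "y < p" for y
  proof (cases "y \<in> S")
    case True then show ?thesis using permutes_in_image[OF perm] S by blast
  next
    case False then show ?thesis using that permutes_not_in[OF perm] by simp
  qed
  have ne: "\<beta> y \<noteq> p" if "y \<noteq> p" for y
    using permutes_inj[OF perm] p that by (metis inj_eq)
  have ap: "\<alpha> p = j" by (simp add: \<alpha> p)
  have aj: "\<alpha> y = p" if "\<beta> y = j" for y using that by (simp add: \<alpha>)
  have ao: "\<alpha> y = \<beta> y" if "\<beta> y \<noteq> j" "y \<noteq> p" for y using that ne[of y] by (simp add: \<alpha>)
  show ?thesis
  proof
    assume nc: "nc_perm \<alpha>"
    show "nc_perm \<beta>"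
    proof (rule nc_permI)
      fix y z assume y: "\<beta> y < y" and z: "\<beta> y < z" "z < y"
      have "y < p" using y p above by (metis less_irrefl linorder_neqE_nat)
      have "\<beta> y \<noteq> j" using inv[of y] y \<open>y < p\<close> by auto
      have e: "\<alpha> y = \<beta> y" using \<open>\<beta> y \<noteq> j\<close> \<open>y < p\<close> ao by auto
      have z': "\<alpha> y < \<alpha> z \<and> \<alpha> z < y" using nc_permD[OF nc, of y z] e y z by simp
      then have "\<beta> z \<noteq> j" using aj[of z] \<open>y < p\<close> by auto
      then have "\<alpha> z = \<beta> z" using ao z \<open>y < p\<close> by auto
      then show "\<beta> y < \<beta> z \<and> \<beta> z < y" using z' e by simp
    qed
  next
    assume nc: "nc_perm \<beta>"
    show "nc_perm \<alpha>"
    proof (rule nc_permI)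
      fix y z assume y: "\<alpha> y < y" and z: "\<alpha> y < z" "z < y"
      consider "y = p" | "y < p" | "y > p" by linarith
      then show "\<alpha> y < \<alpha> z \<and> \<alpha> z < y"
      proof cases
        case 1
        then show ?thesis using inv[of z] z ap ao[of z] by simp
      next
        case 2
        have yj: "\<beta> y \<noteq> j" using aj[of y] y 2 by auto
        then have e: "\<alpha> y = \<beta> y" using 2 ao by auto
        then have z': "\<beta> y < \<beta> z \<and> \<beta> z < y" using nc_permD[OF nc, of y z] y z by simp
        have "\<beta> z \<noteq> j"
        proof
          assume "\<beta> z = j"
          then have "j < y" "\<beta> y < j" using z' by auto
          then show False using inv[of y] 2 by auto
        qed
        then have "\<alpha> z = \<beta> z" using ao z 2 by auto
        then show ?thesis using z' e by simp
      next
        case 3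
        then have "\<alpha> y = y" using above[of y] ao[of y] j by auto
        then show ?thesis using y by simp
      qed
    qed
  qed
qed

section \<open>The genus inequality and its case of equality\<close>

lemma cycle_of_list_upt:
  assumes "1 \<le> k" "k < n" shows "cycle_of_list [1..<Suc n] k = Suc k"
proof -
  have "map (cycle_of_list [1..<Suc n]) [1..<Suc n] = rotate1 [1..<Suc n]"
    using cyclic_rotation[of "[1..<Suc n]" 1] by simp
  then have "map (cycle_of_list [1..<Suc n]) [1..<Suc n] ! (k - 1) = rotate1 [1..<Suc n] ! (k - 1)" by simp
  then show ?thesis using assms by (simp add: nth_rotate1 del: upt_Suc)
qed

context
  fixes n :: nat and S :: "nat set" and \<gamma> :: "nat \<Rightarrow> nat"
  assumes n: "1 \<le> n"
  defines "S \<equiv> {1..n}" and "\<gamma> \<equiv> cycle_of_list [1..<Suc n]"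
begin

lemma long_cycle: "\<gamma> permutes S"
  using cycle_permutes[of "[1..<Suc n]"] unfolding S_def \<gamma>_def by (simp add: atLeastLessThanSuc_atLeastAtMost del: upt_Suc)

lemma num_cycles_planar_le:
  assumes "\<alpha> permutes S"
  shows "num_cycles S \<alpha> + num_cycles S (\<gamma> \<circ> \<alpha>) \<le> n + 1"
proof -
  have s: "set [1..<Suc n] = S" unfolding S_def by auto
  have "num_cycles S (\<gamma> \<circ> \<alpha>) + 2 * card (orbit \<alpha> ` S) \<le> num_cycles S \<alpha> + length [1..<Suc n] + 1"
    using num_cycles_cycle_comp_le[OF assms, of "[1..<Suc n]"] n unfolding s \<gamma>_def by (simp add: S_def del: upt_Suc)
  moreover have "length [1..<Suc n] = n" by simp
  ultimately show ?thesis unfolding num_cycles_def by linarith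
qed

text \<open>The identity has n cycles, so the genus inequality for it leaves at most one cycle to
  \<gamma>.\<close>

lemma num_cycles_long_cycle: "num_cycles S \<gamma> = 1"
proof -
  have "num_cycles S id = n" unfolding num_cycles_id S_def by simp
  then have "num_cycles S \<gamma> \<le> 1" using num_cycles_planar_le[OF permutes_id] by simp
  moreover have "num_cycles S \<gamma> \<noteq> 0" unfolding num_cycles_def S_def using n by simp
  ultimately show ?thesis by simp
qed

text \<open>The induction runs over the support of \<alpha> while \<gamma> keeps its full length, so
  that removing a point is just composing with a transposition. This gives \<beta> one cycle more
  than \<alpha>. Hence \<alpha> is planar iff \<beta> is planar and p and j lie on different cycles
  of \<open>\<alpha> \<circ> \<gamma>\<close>. Taking \<gamma> first makes the product send y to
  \<alpha> (y + 1).\<close>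

lemma planar_iff_nc_perm:
  assumes "\<alpha> permutes {1..m}" "m \<le> n"
  shows "num_cycles S \<alpha> + num_cycles S (\<alpha> \<circ> \<gamma>) = n + 1 \<longleftrightarrow> nc_perm \<alpha>"
  using assms
proof (induction m arbitrary: \<alpha>)
  case 0
  then have "\<alpha> = id" by simp
  moreover have "num_cycles S id = n" by (simp only: num_cycles_id S_def card_atLeastAtMost diff_Suc_1)
  ultimately show ?case using nc_perm_id num_cycles_long_cycle by (simp only: id_comp simp_thms)
next
  case (Suc m)
  define p j where "p = Suc m" and "j = \<alpha> p"
  have fin: "finite S" by (simp add: S_def)
  have sub: "{1..p} \<subseteq> S" using Suc by (auto simp: S_def p_def)
  have \<alpha>: "\<alpha> permutes {1..p}" using Suc by (simp add: p_def)
  have \<alpha>S: "\<alpha> permutes S" by (rule permutes_subset[OF \<alpha> sub])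
  show ?case
  proof (cases "\<alpha> p = p")
    case True
    have "\<alpha> permutes {1..m}" by (rule permutes_superset[OF \<alpha>]) (use True in \<open>auto simp: p_def le_Suc_eq\<close>)
    then show ?thesis using Suc by simp
  next
    case False
    have jm: "1 \<le> j" "j < p" using permutes_in_image[OF \<alpha>, of p] False by (auto simp: p_def j_def)
    have pS: "p \<in> S" "j \<in> S" "p \<noteq> j" using sub jm by (auto simp: S_def p_def)
    let ?t = "Transposition.transpose p j"
    define \<beta> where "\<beta> = ?t \<circ> \<alpha>"
    have \<alpha>\<beta>: "\<alpha> = ?t \<circ> \<beta>" by (simp add: \<beta>_def fun_eq_iff)
    have "\<beta> permutes {1..p}" unfolding \<beta>_def
      by (rule permutes_compose[OF \<alpha> permutes_swap_id]) (use jm in auto)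
    then have \<beta>: "\<beta> permutes {1..m}"
      by (rule permutes_superset) (auto simp: p_def \<beta>_def j_def le_Suc_eq)
    have \<beta>S: "\<beta> permutes S" by (rule permutes_subset[OF \<beta>]) (use sub in \<open>auto simp: p_def\<close>)
    have IH: "num_cycles S \<beta> + num_cycles S (\<beta> \<circ> \<gamma>) = n + 1 \<longleftrightarrow> nc_perm \<beta>"
      by (rule Suc.IH[OF \<beta>]) (use Suc in simp)
    define A B where "A = \<alpha> \<circ> \<gamma>" and "B = \<beta> \<circ> \<gamma>"
    have A: "A permutes S" and B: "B permutes S"
      unfolding A_def B_def using permutes_compose[OF long_cycle] \<alpha>S \<beta>S by auto
    have BA: "B = ?t \<circ> A" unfolding A_def B_def \<beta>_def by (simp add: fun_eq_iff)
    have "j \<in> orbit \<alpha> p" unfolding j_def by (rule orbit.base)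
    then have c1: "num_cycles S \<beta> = num_cycles S \<alpha> + 1"
      using num_cycles_transpose_left(1)[OF \<alpha>S fin pS] unfolding \<beta>_def by simp
    have c2: "num_cycles S B + (if j \<in> orbit A p then 0 else 1) = num_cycles S A + (if j \<in> orbit A p then 1 else 0)"
      and o2: "j \<in> orbit B p \<longleftrightarrow> j \<notin> orbit A p"
      using num_cycles_transpose_left[OF A fin pS] unfolding BA by auto
    have bound: "num_cycles S \<beta> + num_cycles S B \<le> n + 1"
      using num_cycles_planar_le[OF \<beta>S] num_cycles_comm[OF \<beta>S long_cycle fin] unfolding B_def by simp
    have \<gamma>: "\<gamma> k = Suc k" if "1 \<le> k" "k < p" for k
      using cycle_of_list_upt[of k n] that Suc.prems unfolding \<gamma>_def p_def by simp
    have pj: "\<beta> x < p" if "x < p" for x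
      using permutes_in_image[OF \<beta>, of x] permutes_not_in[OF \<beta>, of x] that unfolding p_def
      by (cases "x \<in> {1..m}") auto
    \<comment> \<open>Different cycles are always recognised by an invariant interval that contains
      j but not p.\<close>
    have sep: "j \<notin> orbit \<sigma> p" if "\<sigma> permutes S" "j \<in> X" "p \<notin> X" "\<And>y. y \<in> X \<Longrightarrow> \<sigma> y \<in> X" for \<sigma> X
      using orbit_subset_invariant[of j X \<sigma>] orbit_swap[OF self_in_orbit_permutes[OF that(1) fin], of j p] that by blast
    have \<beta>eq: "\<beta> x = \<alpha> x" if "\<alpha> x \<noteq> p" "\<alpha> x \<noteq> j" for x using that unfolding \<beta>_def by simp
    have S': "{1..m} \<subseteq> {..<p}" by (auto simp: p_def)
    show ?thesis
    proof
      assume nc: "nc_perm \<alpha>"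
      have inv: "j < \<alpha> x \<and> \<alpha> x < p" if "j < x" "x < p" for x
        using nc_permD[OF nc, of p x] that jm by (simp add: j_def)
      \<comment> \<open>The points above j and up to p are what \<gamma> makes of this interval.
        Those below p stay inside by non-crossing, and p itself goes to j.\<close>
      have "j \<notin> orbit A p"
      proof (rule sep[OF A, of "{j..<p}"])
        fix y assume y: "y \<in> {j..<p}"
        then have "A y = \<alpha> (Suc y)" unfolding A_def using \<gamma>[of y] jm by simp
        then show "A y \<in> {j..<p}" using inv[of "Suc y"] y jm by (cases "Suc y = p") (auto simp: j_def)
      qed (use jm in auto)
      then have c: "num_cycles S B + 1 = num_cycles S A" using c2 by simp
      have "nc_perm \<beta>"
      proof (rule nc_perm_transpose[OF \<beta> S' jm(2) _ \<alpha>\<beta>, THEN iffD1, OF _ nc])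
        fix x assume "j < x" "x < p"
        then have "j < \<alpha> x" "\<alpha> x < p" using inv by blast+
        then show "j < \<beta> x \<and> \<beta> x < p" using \<beta>eq[of x] by simp
      qed
      then show "num_cycles S \<alpha> + num_cycles S (\<alpha> \<circ> \<gamma>) = n + 1"
        using IH c c1 unfolding A_def[symmetric] B_def[symmetric] by simp
    next
      assume "num_cycles S \<alpha> + num_cycles S (\<alpha> \<circ> \<gamma>) = n + 1"
      then have pl: "num_cycles S \<alpha> + num_cycles S A = n + 1" unfolding A_def .
      have nj: "j \<notin> orbit A p" using c1 c2 bound pl by (cases "j \<in> orbit A p") auto
      then have "num_cycles S \<beta> + num_cycles S B = n + 1" using c1 c2 pl by simp
      then have nc: "nc_perm \<beta>" using IH unfolding B_def by simp
      have "j < \<beta> x \<and> \<beta> x < p" if x: "j < x" "x < p" for x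
      proof (rule ccontr)
        assume "\<not> (j < \<beta> x \<and> \<beta> x < p)"
        then have le: "\<beta> x \<le> j" using pj x by auto
        have pos: "1 \<le> \<beta> x" using permutes_in_image[OF \<beta>, of x] x jm by (auto simp: p_def)
        \<comment> \<open>A point x between j and p with \<beta> x at or below j would be a descent
          of \<beta> across j. Its jumped interval would separate j from p in B, hence join them in
          A.\<close>
        have "j \<notin> orbit B p"
        proof (rule sep[OF B, of "{\<beta> x..<x}"])
          fix y assume y: "y \<in> {\<beta> x..<x}"
          then have "B y = \<beta> (Suc y)" unfolding B_def using \<gamma>[of y] x pos by simp
          then show "B y \<in> {\<beta> x..<x}" using nc_permD[OF nc, of x "Suc y"] y le x by (cases "Suc y = x") auto
        qed (use le x in auto)
        then show False using o2 nj by simp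
      qed
      then show "nc_perm \<alpha>" by (rule nc_perm_transpose[OF \<beta> S' jm(2) _ \<alpha>\<beta>, THEN iffD2, OF _ nc])
    qed
  qed
qed

end

text \<open>Otherwise the part of the orbit at or above b would be invariant, hence the whole
  orbit.\<close>

lemma nc_perm_orbit_step_below:
  fixes \<alpha> :: "nat \<Rightarrow> nat"
  assumes "z \<in> orbit \<alpha> x" "x \<in> orbit \<alpha> x" "z < b" "b \<le> x"
  shows "\<exists>y\<in>orbit \<alpha> x. b \<le> y \<and> \<alpha> y < b"
proof (rule ccontr)
  assume *: "\<not> ?thesis"
  have "orbit \<alpha> x \<subseteq> {y \<in> orbit \<alpha> x. b \<le> y}"
  proof (rule orbit_subset_invariant)
    fix y assume "y \<in> {y \<in> orbit \<alpha> x. b \<le> y}"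
    then show "\<alpha> y \<in> {y \<in> orbit \<alpha> x. b \<le> y}" using * orbit.step[of y \<alpha> x] not_less by blast
  qed (use assms in simp)
  then have "z \<in> {y \<in> orbit \<alpha> x. b \<le> y}" using assms(1) by blast
  then show False using assms(3) by simp
qed

lemma nc_perm_orbit_interval:
  assumes "nc_perm \<alpha>" "\<alpha> y < b" "b < y" shows "orbit \<alpha> b \<subseteq> {\<alpha> y<..<y}"
  by (rule orbit_subset_invariant) (use assms nc_permD[of \<alpha> y] in auto)

definition cyclic_pred :: "nat set \<Rightarrow> nat \<Rightarrow> nat" where
  "cyclic_pred C y = (if \<exists>z\<in>C. z < y then Max {z \<in> C. z < y} else Max C)"

text \<open>A descent cannot jump over a point of its own cycle, because the jumped interval is
  invariant and omits y. Nor can a non-descent start above the minimum or end below the maximum: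
  another step would then cross y or \<alpha> y downwards. So the cycles as sets determine
  \<alpha>.\<close>

lemma nc_perm_eq_cyclic_pred:
  assumes perm: "\<alpha> permutes S" and fin: "finite S" and nc: "nc_perm \<alpha>"
  shows "\<alpha> y = cyclic_pred (orbit \<alpha> y) y"
proof -
  let ?C = "orbit \<alpha> y"
  note self = self_in_orbit_permutes[OF perm fin]
  have eq: "orbit \<alpha> z = ?C" if "z \<in> ?C" for z using orbit_eq_permutes[OF perm fin that] .
  have finC: "finite ?C" by (rule finite_orbit[OF self])
  have aC: "\<alpha> y \<in> ?C" by (rule orbit.base)
  have no: False if "u \<in> ?C" "b \<in> ?C" "\<alpha> u < b" "b < u" for u b
    using nc_perm_orbit_interval[OF nc that(3,4)] eq[OF that(2)] that(1) by auto
  have up: "\<not> \<alpha> y < y \<Longrightarrow> z \<in> ?C \<Longrightarrow> \<not> z < y" for z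
  proof
    assume a: "\<not> \<alpha> y < y" "z \<in> ?C" "z < y"
    obtain u where "u \<in> ?C" "y \<le> u" "\<alpha> u < y"
      using nc_perm_orbit_step_below[OF a(2) self a(3) order.refl] by auto
    moreover from this have "u \<noteq> y" using a by auto
    ultimately show False using no[of u y] self by auto
  qed
  show ?thesis
  proof (cases "\<alpha> y < y")
    case True
    have "Max {z \<in> ?C. z < y} = \<alpha> y"
      by (rule Max_eqI) (use finC aC True no[OF self] in \<open>auto simp: not_less[symmetric]\<close>)
    then show ?thesis using True aC unfolding cyclic_pred_def by auto
  next
    case False
    have "z \<le> \<alpha> y" if z: "z \<in> ?C" for z
    proof (rule ccontr)
      assume "\<not> z \<le> \<alpha> y"
      moreover have "\<alpha> y \<in> orbit \<alpha> z" "z \<in> orbit \<alpha> z" using eq[OF z] aC z by auto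
      ultimately obtain u where u: "u \<in> ?C" "Suc (\<alpha> y) \<le> u" "\<alpha> u < Suc (\<alpha> y)"
        using nc_perm_orbit_step_below[of "\<alpha> y" \<alpha> z "Suc (\<alpha> y)"] eq[OF z] by auto
      then have "u \<noteq> y" using False by auto
      then have "\<alpha> u \<noteq> \<alpha> y" using permutes_inj[OF perm] by (metis inj_eq)
      then show False using no[of u "\<alpha> y"] u aC by auto
    qed
    then have "Max ?C = \<alpha> y" by (intro Max_eqI) (use finC aC in auto)
    then show ?thesis using up[OF False] unfolding cyclic_pred_def by auto
  qed
qed

section \<open>The correspondence with non-crossing partitions\<close>

lemma cycles_conv: "cycles n \<alpha> = orbit \<alpha> ` {1..n}" and card_cycles: "card (cycles n \<alpha>) = num_cycles {1..n} \<alpha>"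
  by (simp_all add: cycles_def num_cycles_def)

lemma partition_on_cycles:
  assumes "\<alpha> permutes {1..n}" shows "partition_on {1..n} (cycles n \<alpha>)"
proof (rule partition_onI)
  note self = self_in_orbit_permutes[OF assms finite_atLeastAtMost]
  show "\<Union> (cycles n \<alpha>) = {1..n}"
    unfolding cycles_conv using self permutes_orbit_subset[OF assms] by blast
  show "{} \<notin> cycles n \<alpha>" unfolding cycles_conv using self by blast
  fix B C assume "B \<in> cycles n \<alpha>" "C \<in> cycles n \<alpha>" "B \<noteq> C"
  then obtain x y where xy: "B = orbit \<alpha> x" "C = orbit \<alpha> y" unfolding cycles_conv by auto
  show "disjnt B C"
    unfolding disjnt_def
  proof (rule ccontr)
    assume "B \<inter> C \<noteq> {}"
    then obtain z where "z \<in> orbit \<alpha> x" "z \<in> orbit \<alpha> y" using xy by auto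
    then have "orbit \<alpha> x = orbit \<alpha> y" using orbit_eq_permutes[OF assms finite_atLeastAtMost] by metis
    then show False using xy \<open>B \<noteq> C\<close> by simp
  qed
qed

text \<open>If two blocks cross, each makes a descent over a point of the other and so encloses it
  entirely. Then the starting points of the two descents would each be smaller than the
  other.\<close>

lemma cycles_nc_perm_in_NC:
  assumes perm: "\<alpha> permutes {1..n}" and nc: "nc_perm \<alpha>"
  shows "cycles n \<alpha> \<in> NC n"
proof -
  note self = self_in_orbit_permutes[OF perm finite_atLeastAtMost]
  note eq = orbit_eq_permutes[OF perm finite_atLeastAtMost]
  have "C = D" if B: "C \<in> cycles n \<alpha>" "D \<in> cycles n \<alpha>" and lt: "a < b" "b < c" "c < d"
    and mem: "a \<in> C" "c \<in> C" "b \<in> D" "d \<in> D" for C D a b c d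
  proof (rule ccontr)
    assume ne: "C \<noteq> D"
    have C: "C = orbit \<alpha> c" "C = orbit \<alpha> a" and D: "D = orbit \<alpha> d" "D = orbit \<alpha> b"
      using B mem eq unfolding cycles_conv by blast+
    have disj: "x \<notin> D" if "x \<in> C" for x using that eq C D ne by metis
    obtain y where y: "y \<in> C" "b \<le> y" "\<alpha> y < b"
      using nc_perm_orbit_step_below[of a \<alpha> c b] mem lt self C by auto
    obtain y' where y': "y' \<in> D" "c \<le> y'" "\<alpha> y' < c"
      using nc_perm_orbit_step_below[of b \<alpha> d c] mem lt self D by auto
    have "b < y" using y disj mem by (metis le_neq_implies_less)
    then have "D \<subseteq> {\<alpha> y<..<y}" using nc_perm_orbit_interval[OF nc y(3)] D by simp
    then have "y' < y" using y' by auto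
    have "c < y'" using y' disj mem by (metis le_neq_implies_less)
    then have "C \<subseteq> {\<alpha> y'<..<y'}" using nc_perm_orbit_interval[OF nc y'(3)] C by simp
    then show False using y \<open>y' < y\<close> by auto
  qed
  then show ?thesis unfolding NC_def using partition_on_cycles[OF perm] by blast
qed

lemma cycles_nc_perm_inj:
  assumes "\<alpha> permutes {1..n}" "nc_perm \<alpha>" "\<beta> permutes {1..n}" "nc_perm \<beta>" "cycles n \<alpha> = cycles n \<beta>"
  shows "\<alpha> = \<beta>"
proof
  fix y
  show "\<alpha> y = \<beta> y"
  proof (cases "y \<in> {1..n}")
    case True
    then have "orbit \<alpha> y \<in> cycles n \<beta>" using assms(5) unfolding cycles_conv by blast
    then obtain x where "orbit \<alpha> y = orbit \<beta> x" unfolding cycles_conv by auto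
    moreover have "y \<in> orbit \<alpha> y" by (rule self_in_orbit_permutes[OF assms(1) finite_atLeastAtMost])
    ultimately have "orbit \<beta> y = orbit \<alpha> y"
      using orbit_eq_permutes[OF assms(3) finite_atLeastAtMost] by metis
    then show ?thesis
      using nc_perm_eq_cyclic_pred[OF assms(1) finite_atLeastAtMost assms(2), of y]
        nc_perm_eq_cyclic_pred[OF assms(3) finite_atLeastAtMost assms(4), of y] by simp
  next
    case False
    then show ?thesis using permutes_not_in[OF assms(1)] permutes_not_in[OF assms(3)] by simp
  qed
qed

lemma orbit_transpose_new:
  assumes perm: "\<beta> permutes S" and fin: "finite S" and p: "p \<notin> S" and j: "j \<in> S"
    and \<alpha>: "\<alpha> = Transposition.transpose p j \<circ> \<beta>"
  shows "orbit \<alpha> p = insert p (orbit \<beta> j)"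
    and "x \<noteq> p \<Longrightarrow> j \<notin> orbit \<beta> x \<Longrightarrow> orbit \<alpha> x = orbit \<beta> x"
proof -
  have \<alpha>perm: "\<alpha> permutes insert p S"
    unfolding \<alpha> by (rule permutes_compose[OF permutes_subset[OF perm] permutes_swap_id]) (use j in auto)
  note self\<alpha> = self_in_orbit_permutes[OF \<alpha>perm finite.insertI[OF fin]]
  note self\<beta> = self_in_orbit_permutes[OF perm fin]
  have bp: "\<beta> p = p" using permutes_not_in[OF perm p] .
  have ap: "\<alpha> p = j" by (simp add: \<alpha> bp)
  have aj: "\<alpha> y = p" if "\<beta> y = j" for y using that by (simp add: \<alpha>)
  have ne: "\<beta> y \<noteq> p" if "y \<noteq> p" for y using permutes_inj[OF perm] bp that by (metis inj_eq)
  have ao: "\<alpha> y = \<beta> y" if "\<beta> y \<noteq> j" "y \<noteq> p" for y using that ne[of y] by (simp add: \<alpha>)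
  have pO: "y \<noteq> p" if "x \<noteq> p" "y \<in> orbit \<beta> x" for x y
    using that(2) by induct (use that(1) ne in auto)
  show "orbit \<alpha> x = orbit \<beta> x" if x: "x \<noteq> p" "j \<notin> orbit \<beta> x"
  proof (rule orbit_cong[OF self\<beta>])
    fix y assume y: "y \<in> orbit \<beta> x"
    then have "\<beta> y \<noteq> j" using x(2) orbit.step[OF y] by metis
    then show "\<alpha> y = \<beta> y" using ao pO[OF x(1) y] by simp
  qed
  have jp: "j \<noteq> p" using j p by auto
  have jO: "j \<in> orbit \<alpha> p" using orbit.base[of \<alpha> p] ap by simp
  have step: "\<beta> y \<in> orbit \<alpha> p" if "y \<in> orbit \<alpha> p" "y \<noteq> p" for y
    using orbit.step[OF that(1)] ao[of y] jO that(2) by (cases "\<beta> y = j") auto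
  show "orbit \<alpha> p = insert p (orbit \<beta> j)"
  proof
    show "orbit \<alpha> p \<subseteq> insert p (orbit \<beta> j)"
    proof (rule orbit_subset_invariant)
      fix y assume y: "y \<in> insert p (orbit \<beta> j)"
      show "\<alpha> y \<in> insert p (orbit \<beta> j)"
      proof (cases "y = p")
        case True then show ?thesis using ap self\<beta> by auto
      next
        case False
        then have "\<beta> y \<in> orbit \<beta> j" using y orbit.step by auto
        then show ?thesis using ao[of y] aj[of y] False by (cases "\<beta> y = j") auto
      qed
    qed simp
    have "orbit \<beta> j \<subseteq> orbit \<alpha> p \<inter> orbit \<beta> j"
      by (rule orbit_subset_invariant) (use jO self\<beta> step pO[OF jp] orbit.step in auto)
    then show "insert p (orbit \<beta> j) \<subseteq> orbit \<alpha> p" using self\<alpha>[of p] by auto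
  qed
qed

text \<open>The last point is removed from its block. In the joined case the final clause says that
  no block straddles the maximum of B; this is the invariance that \<open>nc_perm_transpose\<close>
  asks for when the point is put back.\<close>

lemma NC_cases:
  assumes P: "P \<in> NC (Suc m)"
  obtains (singleton) P' where "P' \<in> NC m" "P = insert {Suc m} P'"
  | (joined) P' B where "P' \<in> NC m" "B \<in> P'" "P = insert (insert (Suc m) B) (P' - {B})"
      "\<And>x y D. D \<in> P' \<Longrightarrow> x \<in> D \<Longrightarrow> y \<in> D \<Longrightarrow> Max B < x \<Longrightarrow> \<not> y \<le> Max B"
proof -
  let ?p = "Suc m"
  have part: "partition_on {1..?p} P" using P unfolding NC_def by simp
  have cross: "C = D" if "C \<in> P" "D \<in> P" "i < j" "j < k" "k < l" "i \<in> C" "k \<in> C" "j \<in> D" "l \<in> D" for C D i j k l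
    using P that unfolding NC_def by blast
  have "?p \<in> \<Union>P" using partition_onD1[OF part] by auto
  then obtain B0 where B0: "B0 \<in> P" "?p \<in> B0" by auto
  have dis: "C \<inter> D = {}" if "C \<in> P" "D \<in> P" "C \<noteq> D" for C D
    using partition_onD2[OF part] that by (auto dest: disjointD)
  have ne: "{} \<notin> P" using partition_onD3[OF part] .
  have U: "\<Union>P = {1..?p}" using partition_onD1[OF part] by simp
  define B where "B = B0 - {?p}"
  define P' where "P' = (if B = {} then P - {B0} else insert B (P - {B0}))"
  have U': "\<Union>P' = {1..m}"
  proof -
    have "\<Union>P' = \<Union>(P - {B0}) \<union> B" unfolding P'_def by auto
    also have "\<dots> = \<Union>P - {?p}" using B0 dis unfolding B_def by blast
    also have "\<dots> = {1..m}" using U by auto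
    finally show ?thesis .
  qed
  have BP: "B \<notin> P - {B0}" if "B \<noteq> {}"
    using dis[OF B0(1)] that unfolding B_def by blast
  have part': "partition_on {1..m} P'"
  proof (rule partition_onI)
    show "\<Union>P' = {1..m}" by (rule U')
    show "{} \<notin> P'" unfolding P'_def using ne by auto
    fix C D assume C: "C \<in> P'" "D \<in> P'" "C \<noteq> D"
    have 1: "X \<in> P - {B0} \<or> X = B" if "X \<in> P'" for X using that unfolding P'_def by (auto split: if_splits)
    have "X \<inter> B = {}" if "X \<in> P - {B0}" for X using dis[of X B0] that B0 unfolding B_def by auto
    then show "disjnt C D" unfolding disjnt_def using 1[OF C(1)] 1[OF C(2)] dis C(3) by blast
  qed
  have up: "\<exists>C'\<in>P. C \<subseteq> C' \<and> (C' = C \<or> C' = B0 \<and> C = B)" if "C \<in> P'" for C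
    using that B0 unfolding P'_def B_def by (auto split: if_splits)
  have NC': "P' \<in> NC m"
  proof -
    have "C = D" if CD: "C \<in> P'" "D \<in> P'" and lt: "i < j" "j < k" "k < l" and mem: "i \<in> C" "k \<in> C" "j \<in> D" "l \<in> D" for C D i j k l
    proof -
      obtain C' where C': "C' \<in> P" "C \<subseteq> C'" "C' = C \<or> C' = B0 \<and> C = B" using up[OF CD(1)] by auto
      obtain D' where D': "D' \<in> P" "D \<subseteq> D'" "D' = D \<or> D' = B0 \<and> D = B" using up[OF CD(2)] by auto
      have e: "C' = D'" using cross[OF C'(1) D'(1) lt] mem C'(2) D'(2) by auto
      have "B0 \<notin> P'" using U' B0(2) by (metis UnionI atLeastAtMost_iff not_less_eq_eq order_refl)
      then show "C = D" using e C'(3) D'(3) CD by auto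
    qed
    then show ?thesis unfolding NC_def using part' by blast
  qed
  show thesis
  proof (cases "B = {}")
    case True
    then have "B0 = {?p}" using B0 unfolding B_def by auto
    then show ?thesis using singleton[OF NC'] True B0 unfolding P'_def by auto
  next
    case False
    have BP': "B \<in> P'" using False unfolding P'_def by simp
    have "insert ?p B = B0" using B0 unfolding B_def by auto
    moreover have "P' - {B} = P - {B0}" using False BP unfolding P'_def by auto
    ultimately have Pe: "P = insert (insert ?p B) (P' - {B})" using B0 by auto
    have finB: "finite B" using U' BP' finite_subset[of B "{1..m}"] by auto
    have MB: "Max B \<in> B" using Max_in[OF finB False] .
    have "\<not> y \<le> Max B" if D: "D \<in> P'" "x \<in> D" "y \<in> D" "Max B < x" for x y D
    proof
      assume le: "y \<le> Max B"
      have "D \<noteq> B" using D(2,4) Max_ge[OF finB, of x] by auto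
      then have DP: "D \<in> P" "D \<noteq> B0" using D(1) unfolding P'_def by (auto split: if_splits)
      have "D \<inter> B0 = {}" using dis DP B0 by auto
      moreover have "Max B \<in> B0" using MB unfolding B_def by auto
      ultimately have "y < Max B" using le D(3) by (metis disjoint_iff le_neq_implies_less)
      moreover have "x < ?p" using U' D(1,2) by (auto simp: set_eq_iff) (metis Suc_leI le_imp_less_Suc)
      ultimately have "D = B0"
        using cross[OF DP(1) B0(1), of y "Max B" x ?p] D B0 MB unfolding B_def by auto
      then show False using DP by simp
    qed
    then show ?thesis using joined[OF NC' BP' Pe] by blast
  qed
qed

lemma NC_ex_nc_perm:
  "P \<in> NC n \<Longrightarrow> \<exists>\<alpha>. \<alpha> permutes {1..n} \<and> nc_perm \<alpha> \<and> cycles n \<alpha> = P"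
proof (induction n arbitrary: P)
  case 0
  then have "P = {}" unfolding NC_def by (auto simp: partition_on_def)
  moreover have "cycles 0 id = {}" by (simp add: cycles_def)
  ultimately show ?case using nc_perm_id permutes_id by blast
next
  case (Suc m)
  let ?p = "Suc m"
  have eq: "{1..?p} = insert ?p {1..m}" by auto
  from Suc.prems show ?case
  proof (cases rule: NC_cases)
    case (singleton P')
    then obtain \<alpha> where \<alpha>: "\<alpha> permutes {1..m}" "nc_perm \<alpha>" "cycles m \<alpha> = P'" using Suc.IH by blast
    have "\<alpha> ?p = ?p" using permutes_not_in[OF \<alpha>(1)] by simp
    then have "orbit \<alpha> ?p = {?p}" by (simp add: orbit_eq_singleton_iff)
    then have "cycles ?p \<alpha> = P" using \<alpha>(3) singleton unfolding cycles_conv eq by simp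
    moreover have "\<alpha> permutes {1..?p}" by (rule permutes_subset[OF \<alpha>(1)]) auto
    ultimately show ?thesis using \<alpha> by blast
  next
    case (joined P' B)
    then obtain \<beta> where \<beta>: "\<beta> permutes {1..m}" "nc_perm \<beta>" "cycles m \<beta> = P'" using Suc.IH by blast
    \<comment> \<open>Cycles run downwards, so the new largest point must be sent to the largest old
      point of its block.\<close>
    define j where "j = Max B"
    have part: "partition_on {1..m} P'" using joined(1) unfolding NC_def by simp
    have Bsub: "B \<subseteq> {1..m}" "B \<noteq> {}" using joined(2) partition_onD1[OF part] partition_onD3[OF part] by auto
    have jB: "j \<in> B" unfolding j_def using Max_in[of B] Bsub finite_subset[of B "{1..m}"] by auto
    then have jm: "j \<in> {1..m}" using Bsub by auto
    note self = self_in_orbit_permutes[OF \<beta>(1) finite_atLeastAtMost] and oeq = orbit_eq_permutes[OF \<beta>(1) finite_atLeastAtMost]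
    have orb: "orbit \<beta> x = D" if "D \<in> P'" "x \<in> D" for x D using that \<beta>(3) oeq unfolding cycles_conv by blast
    have Bo: "orbit \<beta> j = B" using orb[OF joined(2) jB] .
    define \<alpha> where "\<alpha> = Transposition.transpose ?p j \<circ> \<beta>"
    have p: "?p \<notin> {1..m}" by simp
    note O = orbit_transpose_new[OF \<beta>(1) finite_atLeastAtMost p jm \<alpha>_def]
    have "\<alpha> permutes {1..?p}" unfolding \<alpha>_def
      by (rule permutes_compose[OF permutes_subset[OF \<beta>(1)] permutes_swap_id]) (use jm in auto)
    moreover have "nc_perm \<alpha>"
    proof -
      have "j < \<beta> x \<and> \<beta> x < ?p" if x: "j < x" "x < ?p" for x
      proof -
        have xm: "x \<in> {1..m}" using x by auto
        then have D: "orbit \<beta> x \<in> P'" using \<beta>(3) unfolding cycles_conv by auto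
        have "\<not> \<beta> x \<le> j" using joined(4)[OF D self orbit.base, folded j_def] x by simp
        moreover have "\<beta> x \<in> {1..m}" using permutes_in_image[OF \<beta>(1)] xm by blast
        ultimately show ?thesis by auto
      qed
      then show ?thesis
        using nc_perm_transpose[OF \<beta>(1) _ _ _ \<alpha>_def] \<beta>(2) jm by (metis atLeastAtMost_iff le_imp_less_Suc lessThan_iff subsetI)
    qed
    moreover have "cycles ?p \<alpha> = P"
    proof -
      have split: "{1..m} = B \<union> ({1..m} - B)" using Bsub by auto
      have aB: "orbit \<alpha> x = insert ?p B" if "x \<in> B" for x
      proof -
        have "x \<in> orbit \<alpha> ?p" using O(1) Bo that by simp
        then show ?thesis
          using orbit_eq_permutes[OF \<open>\<alpha> permutes {1..?p}\<close> finite_atLeastAtMost] O(1) Bo by metis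
      qed
      have aN: "orbit \<alpha> x = orbit \<beta> x" if "x \<in> {1..m} - B" for x
      proof (rule O(2))
        show "x \<noteq> ?p" using that by auto
        show "j \<notin> orbit \<beta> x" using oeq[of j x] Bo self[of x] that by blast
      qed
      have bN: "orbit \<beta> ` ({1..m} - B) = P' - {B}"
      proof -
        have "orbit \<beta> x \<noteq> B" if "x \<notin> B" for x using self[of x] that by blast
        moreover have "D \<in> orbit \<beta> ` ({1..m} - B)" if D: "D \<in> P'" "D \<noteq> B" for D
        proof -
          obtain x where x: "x \<in> {1..m}" "D = orbit \<beta> x" using D(1) \<beta>(3) unfolding cycles_conv by auto
          then have "x \<notin> B" using orb[OF joined(2)] D(2) by blast
          then show ?thesis using x by blast
        qed
        ultimately show ?thesis using \<beta>(3) unfolding cycles_conv by blast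
      qed
      have "cycles ?p \<alpha> = insert (orbit \<alpha> ?p) (orbit \<alpha> ` B \<union> orbit \<alpha> ` ({1..m} - B))"
        unfolding cycles_conv eq by (subst split) (simp only: image_insert image_Un)
      also have "orbit \<alpha> ` B = {insert ?p B}" using aB Bsub(2) by auto
      also have "orbit \<alpha> ` ({1..m} - B) = P' - {B}" unfolding bN[symmetric] by (rule image_cong[OF refl aN])
      finally show ?thesis using O(1) Bo joined(3) by auto
    qed
    ultimately show ?thesis by blast
  qed
qed

lemma bij_betw_cycles_NC:
  "bij_betw (cycles n) {\<alpha>. \<alpha> permutes {1..n} \<and> nc_perm \<alpha>} (NC n)"
proof (rule bij_betw_imageI)
  show "inj_on (cycles n) {\<alpha>. \<alpha> permutes {1..n} \<and> nc_perm \<alpha>}"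
    using cycles_nc_perm_inj by (intro inj_onI) blast
  show "cycles n ` {\<alpha>. \<alpha> permutes {1..n} \<and> nc_perm \<alpha>} = NC n"
    using cycles_nc_perm_in_NC NC_ex_nc_perm by blast
qed

section \<open>The recursion for the moments of words\<close>

text \<open>The head of the word either forms a block of its own, which gives the factor c, or joins
  the block of an equal letter. In the second case that letter stays at the head of
  \<open>drop i w\<close> to account for the common block, and the letters skipped over,
  \<open>take i w\<close>, decouple.\<close>

fun word_moment :: "real \<Rightarrow> 'l list \<Rightarrow> real" where
  "word_moment c [] = 1"
| "word_moment c (l # w) = c * word_moment c w +
     (\<Sum>i<length w. if w ! i = l then word_moment c (take i w) * word_moment c (drop i w) else 0)"

text \<open>Both endpoints are free because the recursion cuts an interval into two.\<close>

definition nc_perms :: "(nat \<Rightarrow> 'l) \<Rightarrow> nat \<Rightarrow> nat \<Rightarrow> (nat \<Rightarrow> nat) set" where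
  "nc_perms f i k = {\<alpha>. \<alpha> permutes {i..<k} \<and> nc_perm \<alpha> \<and> (\<forall>x. f (\<alpha> x) = f x)}"

definition nc_sum :: "real \<Rightarrow> (nat \<Rightarrow> 'l) \<Rightarrow> nat \<Rightarrow> nat \<Rightarrow> real" where
  "nc_sum c f i k = (\<Sum>\<alpha>\<in>nc_perms f i k. c ^ num_cycles {i..<k} \<alpha>)"

lemma finite_nc_perms: "finite (nc_perms f i k)"
  by (rule finite_subset[OF _ finite_permutations[of "{i..<k}"]]) (auto simp: nc_perms_def)

section \<open>Permutations of two adjacent intervals\<close>

context
  fixes i j p :: nat and \<alpha>1 \<alpha>2 \<beta> :: "nat \<Rightarrow> nat"
  assumes ij: "i \<le> j" "j < p" and \<alpha>1: "\<alpha>1 permutes {Suc j..<p}" and \<alpha>2: "\<alpha>2 permutes {i..<Suc j}"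
  defines "\<beta> \<equiv> \<alpha>1 \<circ> \<alpha>2"
begin

lemma gap_comp_permutes: "\<beta> permutes {i..<p}"
  unfolding \<beta>_def by (intro permutes_compose permutes_subset[OF \<alpha>1] permutes_subset[OF \<alpha>2]) (use ij in auto)

lemma gap_comp_eq1: "j < x \<Longrightarrow> \<beta> x = \<alpha>1 x"
  using permutes_not_in[OF \<alpha>2, of x] by (simp add: \<beta>_def)

lemma gap_comp_eq2: "x \<le> j \<Longrightarrow> \<beta> x = \<alpha>2 x \<and> \<alpha>2 x \<le> j"
  using permutes_in_image[OF \<alpha>2, of x] permutes_not_in[OF \<alpha>2, of x] permutes_not_in[OF \<alpha>1, of "\<alpha>2 x"]
  unfolding \<beta>_def by (cases "x \<in> {i..<Suc j}") auto

lemma gap_comp_in: "j < x \<Longrightarrow> j < \<alpha>1 x"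
  using permutes_in_image[OF \<alpha>1, of x] permutes_not_in[OF \<alpha>1, of x] by (cases "x \<in> {Suc j..<p}") auto

lemma gap_comp_low1: "x \<le> j \<Longrightarrow> \<alpha>1 x = x"
  by (rule permutes_not_in[OF \<alpha>1]) simp

lemma gap_comp_high2: "j < x \<Longrightarrow> \<alpha>2 x = x"
  by (rule permutes_not_in[OF \<alpha>2]) simp

lemma gap_comp_nc_perm: "nc_perm \<beta> \<longleftrightarrow> nc_perm \<alpha>1 \<and> nc_perm \<alpha>2"
proof (intro iffI conjI)
  assume nc: "nc_perm \<beta>"
  show "nc_perm \<alpha>1"
  proof (rule nc_permI)
    fix y z assume *: "\<alpha>1 y < y" "\<alpha>1 y < z" "z < y"
    have "j < y" using gap_comp_low1[of y] *(1) by (cases "j < y") auto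
    then show "\<alpha>1 y < \<alpha>1 z \<and> \<alpha>1 z < y"
      using nc_permD[OF nc, of y z] * gap_comp_in[of y] gap_comp_eq1[of y] gap_comp_eq1[of z] by simp
  qed
  show "nc_perm \<alpha>2"
  proof (rule nc_permI)
    fix y z assume *: "\<alpha>2 y < y" "\<alpha>2 y < z" "z < y"
    have "y \<le> j" using gap_comp_high2[of y] *(1) by (cases "j < y") auto
    then show "\<alpha>2 y < \<alpha>2 z \<and> \<alpha>2 z < y"
      using nc_permD[OF nc, of y z] * gap_comp_eq2[of y] gap_comp_eq2[of z] by simp
  qed
next
  assume nc: "nc_perm \<alpha>1 \<and> nc_perm \<alpha>2"
  show "nc_perm \<beta>"
  proof (rule nc_permI)
    fix y z assume *: "\<beta> y < y" "\<beta> y < z" "z < y"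
    show "\<beta> y < \<beta> z \<and> \<beta> z < y"
    proof (cases "j < y")
      case True
      then have "j < z" using gap_comp_eq1[of y] gap_comp_in[of y] * by simp
      then show ?thesis using nc_permD[of \<alpha>1 y z] nc * gap_comp_eq1[OF True] gap_comp_eq1[of z] by simp
    next
      case False
      then show ?thesis using nc_permD[of \<alpha>2 y z] nc * gap_comp_eq2[of y] gap_comp_eq2[of z] by simp
    qed
  qed
qed

lemma gap_comp_num_cycles:
  "num_cycles {i..<p} \<beta> = num_cycles {Suc j..<p} \<alpha>1 + num_cycles {i..<Suc j} \<alpha>2"
proof -
  have "num_cycles {i..<p} \<beta> = num_cycles {Suc j..<p} \<beta> + num_cycles {i..<Suc j} \<beta>"
  proof (rule num_cycles_Un[OF gap_comp_permutes])
    show "{i..<p} = {Suc j..<p} \<union> {i..<Suc j}" using ij by auto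
    show "\<beta> ` {Suc j..<p} \<subseteq> {Suc j..<p}"
      using gap_comp_eq1 permutes_in_image[OF \<alpha>1] by auto
    show "\<beta> ` {i..<Suc j} \<subseteq> {i..<Suc j}"
      using gap_comp_eq2 permutes_in_image[OF \<alpha>2] by fastforce
  qed auto
  moreover have "num_cycles {Suc j..<p} \<beta> = num_cycles {Suc j..<p} \<alpha>1"
    by (rule num_cycles_cong[OF _ \<alpha>1]) (use gap_comp_eq1 in auto)
  moreover have "num_cycles {i..<Suc j} \<beta> = num_cycles {i..<Suc j} \<alpha>2"
    by (rule num_cycles_cong[OF _ \<alpha>2]) (use gap_comp_eq2 in auto)
  ultimately show ?thesis by simp
qed

end

lemma num_cycles_Suc_fixed:
  assumes "\<beta> permutes {i..<p}" "i \<le> p"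
  shows "num_cycles {i..<Suc p} \<beta> = Suc (num_cycles {i..<p} \<beta>)"
proof -
  have \<beta>p: "\<beta> p = p" by (rule permutes_not_in[OF assms(1)]) simp
  have "num_cycles {i..<Suc p} \<beta> = num_cycles {p} \<beta> + num_cycles {i..<p} \<beta>"
  proof (rule num_cycles_Un[OF permutes_subset[OF assms(1)]])
    show "\<beta> ` {i..<p} \<subseteq> {i..<p}" using permutes_image[OF assms(1)] by simp
  qed (use assms \<beta>p in auto)
  then show ?thesis by (simp add: num_cycles_def)
qed

lemma nc_sum_fixed:
  assumes "i \<le> p"
  shows "(\<Sum>\<alpha> | \<alpha> \<in> nc_perms f i (Suc p) \<and> \<alpha> p = p. c ^ num_cycles {i..<Suc p} \<alpha>) = c * nc_sum c f i p"
proof -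
  have e: "{\<alpha> \<in> nc_perms f i (Suc p). \<alpha> p = p} = nc_perms f i p"
  proof -
    have "\<alpha> permutes {i..<p}" if "\<alpha> permutes {i..<Suc p}" "\<alpha> p = p" for \<alpha>
      by (rule permutes_superset[OF that(1)]) (use that(2) less_Suc_eq in auto)
    moreover have "\<alpha> permutes {i..<Suc p}" "\<alpha> p = p" if "\<alpha> permutes {i..<p}" for \<alpha>
      using permutes_subset[OF that, of "{i..<Suc p}"] permutes_not_in[OF that, of p] by auto
    ultimately show ?thesis unfolding nc_perms_def by blast
  qed
  show ?thesis unfolding e nc_sum_def sum_distrib_left
  proof (rule sum.cong[OF refl])
    fix \<alpha> assume "\<alpha> \<in> nc_perms f i p"
    then have "num_cycles {i..<Suc p} \<alpha> = Suc (num_cycles {i..<p} \<alpha>)"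
      using num_cycles_Suc_fixed assms unfolding nc_perms_def by blast
    then show "c ^ num_cycles {i..<Suc p} \<alpha> = c * c ^ num_cycles {i..<p} \<alpha>" by simp
  qed
qed

text \<open>If p goes to j, the points between them are invariant, and removing p leaves independent
  permutations of the gap and of the points up to j. Putting p back merges it into the cycle of j,
  so the cycle counts simply add. The transposition respects the colours because p and j have the
  same one.\<close>

lemma nc_sum_split:
  assumes ij: "i \<le> j" "j < p" and f: "f j = f p"
  shows "(\<Sum>\<alpha> | \<alpha> \<in> nc_perms f i (Suc p) \<and> \<alpha> p = j. c ^ num_cycles {i..<Suc p} \<alpha>) =
         nc_sum c f (Suc j) p * nc_sum c f i (Suc j)"
proof -
  let ?t = "Transposition.transpose p j"
  let ?I = "{Suc j..<p}" and ?J = "{i..<Suc j}"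
  let ?S = "{\<alpha> \<in> nc_perms f i (Suc p). \<alpha> p = j}"
  let ?T = "nc_perms f (Suc j) p \<times> nc_perms f i (Suc j)"
  let ?split = "\<lambda>\<alpha>. (perm_restrict (?t \<circ> \<alpha>) ?I, perm_restrict (?t \<circ> \<alpha>) ?J)"
  let ?join = "\<lambda>(\<alpha>1, \<alpha>2). ?t \<circ> (\<alpha>1 \<circ> \<alpha>2)"
  have tt: "?t \<circ> (?t \<circ> \<alpha>) = \<alpha>" for \<alpha> :: "nat \<Rightarrow> nat" by (simp add: fun_eq_iff)
  have sub: "{i..<p} \<subseteq> {..<p}" by auto
  have ft: "f (?t x) = f x" for x using f by (metis transpose_apply_first transpose_apply_other transpose_apply_second)
  have joinS: "?join (\<alpha>1, \<alpha>2) \<in> ?S" and splitjoin: "?split (?join (\<alpha>1, \<alpha>2)) = (\<alpha>1, \<alpha>2)"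
    and val: "num_cycles {i..<Suc p} (?join (\<alpha>1, \<alpha>2)) = num_cycles ?I \<alpha>1 + num_cycles ?J \<alpha>2"
    if T: "(\<alpha>1, \<alpha>2) \<in> ?T" for \<alpha>1 \<alpha>2
  proof -
    have 1: "\<alpha>1 permutes ?I" "nc_perm \<alpha>1" "\<And>x. f (\<alpha>1 x) = f x" and 2: "\<alpha>2 permutes ?J" "nc_perm \<alpha>2" "\<And>x. f (\<alpha>2 x) = f x"
      using T unfolding nc_perms_def by auto
    define \<beta> \<alpha> where "\<beta> = \<alpha>1 \<circ> \<alpha>2" and "\<alpha> = ?t \<circ> \<beta>"
    note G = gap_comp_permutes[OF ij 1(1) 2(1), folded \<beta>_def] gap_comp_nc_perm[OF ij 1(1) 2(1), folded \<beta>_def]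
      gap_comp_num_cycles[OF ij 1(1) 2(1), folded \<beta>_def]
    note eq1 = gap_comp_eq1[OF ij 1(1) 2(1), folded \<beta>_def] and eq2 = gap_comp_eq2[OF ij 1(1) 2(1), folded \<beta>_def]
    have inv: "j < \<beta> x \<and> \<beta> x < p" if "j < x" "x < p" for x
      using eq1[OF that(1)] permutes_in_image[OF 1(1), of x] that by simp
    have nc: "nc_perm \<alpha>"
      using nc_perm_transpose[OF G(1) sub ij(2) inv \<alpha>_def] G(2) 1 2 by simp
    have \<beta>S: "\<beta> permutes {i..<Suc p}" by (rule permutes_subset[OF G(1)]) auto
    have pj: "p \<in> {i..<Suc p}" "j \<in> {i..<Suc p}" "p \<noteq> j" using ij by auto
    have perm: "\<alpha> permutes {i..<Suc p}"
      unfolding \<alpha>_def by (rule permutes_compose[OF \<beta>S permutes_swap_id[OF pj(1,2)]])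
    have \<beta>p: "\<beta> p = p" by (rule permutes_not_in[OF G(1)]) simp
    then have ap: "\<alpha> p = j" by (simp add: \<alpha>_def)
    have "f (\<alpha> x) = f x" for x using ft 1(3) 2(3) by (simp add: \<alpha>_def \<beta>_def)
    then show "?join (\<alpha>1, \<alpha>2) \<in> ?S"
      using perm nc ap unfolding nc_perms_def \<beta>_def[symmetric] prod.case \<alpha>_def[symmetric] by simp
    have "orbit \<beta> p = {p}" using \<beta>p by (simp add: orbit_eq_singleton_iff)
    then have "j \<notin> orbit \<beta> p" using pj by simp
    then have "num_cycles {i..<Suc p} \<alpha> + 1 = num_cycles {i..<Suc p} \<beta>"
      using num_cycles_transpose_left(1)[OF \<beta>S _ pj] unfolding \<alpha>_def by simp
    then show "num_cycles {i..<Suc p} (?join (\<alpha>1, \<alpha>2)) = num_cycles ?I \<alpha>1 + num_cycles ?J \<alpha>2"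
      using num_cycles_Suc_fixed[OF G(1)] ij G(3) unfolding \<beta>_def[symmetric] prod.case \<alpha>_def[symmetric] by simp
    have "perm_restrict \<beta> ?I = \<alpha>1"
    proof
      fix x show "perm_restrict \<beta> ?I x = \<alpha>1 x"
        using eq1[of x] permutes_not_in[OF 1(1), of x] unfolding perm_restrict_def by (cases "x \<in> ?I") simp_all
    qed
    moreover have "perm_restrict \<beta> ?J = \<alpha>2"
    proof
      fix x show "perm_restrict \<beta> ?J x = \<alpha>2 x"
        using eq2[of x] permutes_not_in[OF 2(1), of x] unfolding perm_restrict_def by (cases "x \<in> ?J") simp_all
    qed
    ultimately show "?split (?join (\<alpha>1, \<alpha>2)) = (\<alpha>1, \<alpha>2)"
      unfolding prod.case tt \<beta>_def[symmetric] by simp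
  qed
  have splitT: "?split \<alpha> \<in> ?T" and joinsplit: "?join (?split \<alpha>) = \<alpha>" if S: "\<alpha> \<in> ?S" for \<alpha>
  proof -
    have \<alpha>: "\<alpha> permutes {i..<Suc p}" "nc_perm \<alpha>" "\<And>x. f (\<alpha> x) = f x" "\<alpha> p = j"
      using S unfolding nc_perms_def by auto
    define \<beta> where "\<beta> = ?t \<circ> \<alpha>"
    have \<alpha>\<beta>: "\<alpha> = ?t \<circ> \<beta>" unfolding \<beta>_def tt ..
    have "\<beta> permutes {i..<Suc p}"
      unfolding \<beta>_def by (rule permutes_compose[OF \<alpha>(1) permutes_swap_id]) (use ij in auto)
    then have \<beta>: "\<beta> permutes {i..<p}"
      by (rule permutes_superset) (use \<alpha>(4) in \<open>auto simp: \<beta>_def less_Suc_eq\<close>)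
    have inv: "j < \<beta> x \<and> \<beta> x < p" if "j < x" "x < p" for x
    proof -
      have "j < \<alpha> x \<and> \<alpha> x < p" using nc_permD[OF \<alpha>(2), of p x] \<alpha>(4) that by simp
      then show ?thesis unfolding \<beta>_def by simp
    qed
    have nc: "nc_perm \<beta>" using nc_perm_transpose[OF \<beta> sub ij(2) inv \<alpha>\<beta>] \<alpha>(2) by simp
    define \<alpha>1 \<alpha>2 where "\<alpha>1 = perm_restrict \<beta> ?I" and "\<alpha>2 = perm_restrict \<beta> ?J"
    have invI: "\<beta> ` ?I \<subseteq> ?I" using inv by (auto simp: Suc_le_eq)
    have memI: "\<beta> x \<in> ?I \<longleftrightarrow> x \<in> ?I" for x by (rule permutes_invariant_iff[OF \<beta> _ invI]) simp
    have memJ: "\<beta> x \<in> ?J \<longleftrightarrow> x \<in> ?J" for x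
    proof -
      have J: "?J = {i..<p} - ?I" using ij by auto
      show ?thesis unfolding J using memI[of x] permutes_in_image[OF \<beta>, of x] by blast
    qed
    have restr: "perm_restrict \<beta> X permutes X" if "\<And>x. \<beta> x \<in> X \<longleftrightarrow> x \<in> X" "finite X" for X
    proof -
      have "bij_betw \<beta> X X"
        by (rule bij_betw_imageI[OF permutes_inj_on[OF \<beta>] image_eq_permutes_invariant[OF \<beta> that(2)]]) (use that in auto)
      then have "bij_betw (perm_restrict \<beta> X) X X"
        by (rule bij_betw_cong[THEN iffD1, rotated]) (simp add: perm_restrict_def)
      then show ?thesis by (rule bij_imp_permutes) (simp add: perm_restrict_def)
    qed
    have 1: "\<alpha>1 permutes ?I" and 2: "\<alpha>2 permutes ?J"
      unfolding \<alpha>1_def \<alpha>2_def using restr[of ?I] restr[of ?J] memI memJ by auto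
    have \<beta>c: "\<alpha>1 \<circ> \<alpha>2 = \<beta>"
    proof
      fix x
      show "(\<alpha>1 \<circ> \<alpha>2) x = \<beta> x"
      proof (cases "j < x")
        case True
        then have "(\<alpha>1 \<circ> \<alpha>2) x = \<alpha>1 x" by (rule gap_comp_eq1[OF ij 1 2])
        then show ?thesis using True permutes_not_in[OF \<beta>, of x] unfolding \<alpha>1_def perm_restrict_def by auto
      next
        case False
        then have "(\<alpha>1 \<circ> \<alpha>2) x = \<alpha>2 x" using gap_comp_eq2[OF ij 1 2] by simp
        then show ?thesis using False permutes_not_in[OF \<beta>, of x] unfolding \<alpha>2_def perm_restrict_def by auto
      qed
    qed
    have "nc_perm \<alpha>1 \<and> nc_perm \<alpha>2" using gap_comp_nc_perm[OF ij 1 2] nc unfolding \<beta>c by simp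
    moreover have "f (\<beta> x) = f x" for x using ft \<alpha>(3) by (simp add: \<beta>_def)
    then have "f (\<alpha>1 x) = f x" "f (\<alpha>2 x) = f x" for x unfolding \<alpha>1_def \<alpha>2_def perm_restrict_def by auto
    ultimately show "?split \<alpha> \<in> ?T"
      using 1 2 unfolding \<beta>_def[symmetric] \<alpha>1_def[symmetric] \<alpha>2_def[symmetric] nc_perms_def by simp
    show "?join (?split \<alpha>) = \<alpha>"
      unfolding \<beta>_def[symmetric] \<alpha>1_def[symmetric] \<alpha>2_def[symmetric] prod.case \<beta>c \<alpha>\<beta>[symmetric] ..
  qed
  have "(\<Sum>\<alpha>\<in>?S. c ^ num_cycles {i..<Suc p} \<alpha>) = (\<Sum>(\<alpha>1, \<alpha>2)\<in>?T. c ^ num_cycles ?I \<alpha>1 * c ^ num_cycles ?J \<alpha>2)"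
  proof (rule sum.reindex_bij_witness[of _ ?join ?split])
    fix \<alpha> assume S: "\<alpha> \<in> ?S"
    show "?join (?split \<alpha>) = \<alpha>" by (rule joinsplit[OF S])
    show "?split \<alpha> \<in> ?T" by (rule splitT[OF S])
    show "(case ?split \<alpha> of (\<alpha>1, \<alpha>2) \<Rightarrow> c ^ num_cycles ?I \<alpha>1 * c ^ num_cycles ?J \<alpha>2) = c ^ num_cycles {i..<Suc p} \<alpha>"
      using val[OF splitT[OF S]] joinsplit[OF S] unfolding prod.case by (simp only: power_add)
  next
    fix b assume b: "b \<in> ?T"
    obtain \<alpha>1 \<alpha>2 where e: "b = (\<alpha>1, \<alpha>2)" by fastforce
    show "?split (?join b) = b" unfolding e by (rule splitjoin[OF b[unfolded e]])
    show "?join b \<in> ?S" unfolding e by (rule joinS[OF b[unfolded e]])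
  qed
  then show ?thesis unfolding nc_sum_def sum_product sum.cartesian_product .
qed

lemma nc_sum_rec:
  assumes "i \<le> p"
  shows "nc_sum c f i (Suc p) = c * nc_sum c f i p +
    (\<Sum>j\<in>{i..<p}. if f j = f p then nc_sum c f (Suc j) p * nc_sum c f i (Suc j) else 0)"
proof -
  let ?A = "nc_perms f i (Suc p)" and ?w = "\<lambda>\<alpha>. c ^ num_cycles {i..<Suc p} \<alpha>"
  have mem: "\<alpha> p \<in> insert p {i..<p}" if "\<alpha> \<in> ?A" for \<alpha>
    using that permutes_in_image[of \<alpha> "{i..<Suc p}" p] assms unfolding nc_perms_def by auto
  have "nc_sum c f i (Suc p) = (\<Sum>j\<in>insert p {i..<p}. sum ?w {\<alpha> \<in> ?A. \<alpha> p = j})"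
    unfolding nc_sum_def by (rule sum.group[symmetric]) (use mem finite_nc_perms in blast)+
  also have "\<dots> = sum ?w {\<alpha> \<in> ?A. \<alpha> p = p} + (\<Sum>j\<in>{i..<p}. sum ?w {\<alpha> \<in> ?A. \<alpha> p = j})" by simp
  also have "(\<Sum>j\<in>{i..<p}. sum ?w {\<alpha> \<in> ?A. \<alpha> p = j}) =
    (\<Sum>j\<in>{i..<p}. if f j = f p then nc_sum c f (Suc j) p * nc_sum c f i (Suc j) else 0)"
  proof (rule sum.cong[OF refl])
    fix j assume j: "j \<in> {i..<p}"
    show "sum ?w {\<alpha> \<in> ?A. \<alpha> p = j} = (if f j = f p then nc_sum c f (Suc j) p * nc_sum c f i (Suc j) else 0)"
    proof (cases "f j = f p")
      case True then show ?thesis using nc_sum_split[of i j p f c] j by simp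
    next
      case False
      then have "{\<alpha> \<in> ?A. \<alpha> p = j} = {}" unfolding nc_perms_def by (auto dest: spec[of _ p])
      then show ?thesis using False by (simp only: sum.empty if_False)
    qed
  qed
  finally show ?thesis using nc_sum_fixed[OF assms] by simp
qed

lemma nc_sum_empty: "nc_sum c f i i = 1"
proof -
  have "nc_perms f i i = {id}" unfolding nc_perms_def using nc_perm_id by (auto simp: id_def)
  then show ?thesis unfolding nc_sum_def by (simp add: num_cycles_def)
qed

text \<open>The word lists the positions downwards, so its head is the last point of the interval.
  Letter t of the tail then sits at position p - Suc t; \<open>take t\<close> is the gap above it,
  and \<open>drop t\<close> consists of it and the points below.\<close>

lemma nc_sum_eq_word_moment:
  "i \<le> k \<Longrightarrow> nc_sum c f i k = word_moment c (map f (rev [i..<k]))"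
proof (induction "k - i" arbitrary: i k rule: less_induct)
  case less
  show ?case
  proof (cases "k = i")
    case True then show ?thesis by (simp add: nc_sum_empty)
  next
    case False
    then obtain p where p: "k = Suc p" "i \<le> p" using less.prems by (cases k) auto
    let ?w = "map f (rev [i..<p])"
    have len: "length ?w = p - i" by simp
    have nthw: "?w ! t = f (p - Suc t)" if "t < p - i" for t using that by (simp add: rev_nth)
    have takew: "take t ?w = map f (rev [Suc (p - Suc t)..<p])" if "t < p - i" for t
      using that by (simp add: take_map take_rev Suc_diff_Suc)
    have dropw: "drop t ?w = map f (rev [i..<Suc (p - Suc t)])" if "t < p - i" for t
      using that by (simp add: drop_map drop_rev Suc_diff_Suc take_upt)
    have "word_moment c (map f (rev [i..<k])) = c * word_moment c ?w +
      (\<Sum>t<p - i. if ?w ! t = f p then word_moment c (take t ?w) * word_moment c (drop t ?w) else 0)"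
      using p by simp
    also have "(\<Sum>t<p - i. if ?w ! t = f p then word_moment c (take t ?w) * word_moment c (drop t ?w) else 0) =
      (\<Sum>j\<in>{i..<p}. if f j = f p then nc_sum c f (Suc j) p * nc_sum c f i (Suc j) else 0)"
    proof (rule sum.reindex_bij_witness[of _ "\<lambda>j. p - Suc j" "\<lambda>t. p - Suc t"])
      fix t assume "t \<in> {..<p - i}"
      then have t: "t < p - i" by simp
      have "nc_sum c f (Suc (p - Suc t)) p = word_moment c (take t ?w)"
        unfolding takew[OF t] by (rule less.hyps) (use t p in auto)
      moreover have "nc_sum c f i (Suc (p - Suc t)) = word_moment c (drop t ?w)"
        unfolding dropw[OF t] by (rule less.hyps) (use t p in auto)
      ultimately show "(if f (p - Suc t) = f p then nc_sum c f (Suc (p - Suc t)) p * nc_sum c f i (Suc (p - Suc t)) else 0) =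
        (if ?w ! t = f p then word_moment c (take t ?w) * word_moment c (drop t ?w) else 0)"
        using nthw[OF t] by simp
    qed (use p in auto)
    finally have F: "word_moment c (map f (rev [i..<k])) = c * word_moment c ?w +
      (\<Sum>j\<in>{i..<p}. if f j = f p then nc_sum c f (Suc j) p * nc_sum c f i (Suc j) else 0)" .
    have "nc_sum c f i p = word_moment c ?w" by (rule less.hyps) (use p in auto)
    then show ?thesis unfolding F unfolding p(1) by (simp only: nc_sum_rec[OF p(2)])
  qed
qed

section \<open>Moments of the Marchenko-Pastur distribution\<close>

text \<open>The measure is given by its values on sets, so the formula is built up from indicators
  by sums and monotone limits.\<close>

lemma nn_integral_MP:
  assumes "f \<in> borel_measurable borel"
  shows "(\<integral>\<^sup>+x. f x \<partial>MP c) = ennreal (max (1 - c) 0) * f 0 + (\<integral>\<^sup>+x. f x * ennreal (MP_density c x) \<partial>lborel)"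
  using assms
proof (induction rule: borel_measurable_induct)
  case (cong f g) then show ?case by (simp cong: nn_integral_cong)
next
  case (set A)
  then show ?case by (simp add: emeasure_MP mult.commute)
next
  case (mult u r)
  then have [measurable]: "u \<in> borel_measurable borel" by simp
  have "u \<in> borel_measurable (MP c)" by measurable
  then show ?case using mult by (simp add: nn_integral_cmult mult.assoc distrib_left mult.left_commute)
next
  case (add u v)
  then have [measurable]: "u \<in> borel_measurable borel" "v \<in> borel_measurable borel" by simp_all
  have "u \<in> borel_measurable (MP c)" "v \<in> borel_measurable (MP c)" by measurable
  then show ?case using add by (simp add: nn_integral_add distrib_right distrib_left ac_simps)
next
  case (seq U)
  then have [measurable]: "U i \<in> borel_measurable borel" for i by simp
  have mU: "U i \<in> borel_measurable (MP c)" for i by measurable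
  let ?a = "ennreal (max (1 - c) 0)"
  have inc: "incseq (\<lambda>i. U i x)" for x using seq(3) by (auto simp: incseq_def le_fun_def)
  have SUPeq: "(Sup (range U)) x = (SUP i. U i x)" for x by (simp add: image_comp)
  have "(\<integral>\<^sup>+x. (SUP i. U i x) \<partial>MP c) = (SUP i. \<integral>\<^sup>+x. U i x \<partial>MP c)"
    by (rule nn_integral_monotone_convergence_SUP[OF seq(3) mU])
  also have "\<dots> = (SUP i. ?a * U i 0 + (\<integral>\<^sup>+x. U i x * ennreal (MP_density c x) \<partial>lborel))" using seq by simp
  also have "\<dots> = (SUP i. ?a * U i 0) + (SUP i. \<integral>\<^sup>+x. U i x * ennreal (MP_density c x) \<partial>lborel)"
  proof (rule ennreal_SUP_add)
    show "incseq (\<lambda>i. ?a * U i 0)" using inc[of 0] by (auto simp: incseq_def intro: mult_left_mono)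
    show "incseq (\<lambda>i. \<integral>\<^sup>+x. U i x * ennreal (MP_density c x) \<partial>lborel)"
      using seq(3) by (auto simp: incseq_def le_fun_def intro!: nn_integral_mono mult_right_mono)
  qed
  also have "(SUP i. ?a * U i 0) = ?a * (SUP i. U i 0)" by (rule SUP_mult_left_ennreal[symmetric])
  also have "(SUP i. \<integral>\<^sup>+x. U i x * ennreal (MP_density c x) \<partial>lborel) = (\<integral>\<^sup>+x. (SUP i. U i x * ennreal (MP_density c x)) \<partial>lborel)"
    by (rule nn_integral_monotone_convergence_SUP[symmetric])
      (use seq(3) in \<open>auto simp: incseq_def le_fun_def intro!: mult_right_mono\<close>)
  also have "\<dots> = (\<integral>\<^sup>+x. (SUP i. U i x) * ennreal (MP_density c x) \<partial>lborel)"
    by (simp add: SUP_mult_right_ennreal)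
  finally show ?case unfolding SUPeq .
qed

section \<open>Words in one letter\<close>

definition mono_moment :: "real \<Rightarrow> nat \<Rightarrow> real" where
  "mono_moment c k = word_moment c (replicate k ())"

lemma word_moment_replicate: "word_moment c (replicate k l) = mono_moment c k"
  unfolding mono_moment_def
proof (induction k rule: less_induct)
  case (less k)
  show ?case
  proof (cases k)
    case (Suc n)
    have "word_moment c (replicate n l) = word_moment c (replicate n ())" using less[of n] Suc by simp
    moreover have "(\<Sum>i<n. word_moment c (replicate (min n i) l) * word_moment c (replicate (n - i) l)) =
      (\<Sum>i<n. word_moment c (replicate (min n i) ()) * word_moment c (replicate (n - i) ()))"
      by (rule sum.cong[OF refl]) (use less Suc in auto)
    ultimately show ?thesis using Suc by (simp add: min.commute)
  qed simp
qed

lemma mono_moment_0 [simp]: "mono_moment c 0 = 1"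
  by (simp add: mono_moment_def)

lemma mono_moment_Suc: "mono_moment c (Suc n) = c * mono_moment c n + (\<Sum>i<n. mono_moment c i * mono_moment c (n - i))"
proof -
  have "(\<Sum>i<n. word_moment c (replicate (min n i) ()) * word_moment c (replicate (n - i) ())) =
      (\<Sum>i<n. mono_moment c i * mono_moment c (n - i))"
    by (rule sum.cong[OF refl]) (auto simp: mono_moment_def min_def)
  then show ?thesis unfolding mono_moment_def by (simp add: min.commute)
qed

text \<open>The generating function satisfies a quadratic equation whose discriminant is a quadratic
  polynomial \<open>D\<close>; differentiating \<open>Y\<^sup>2 = D\<close> linearises the recursion.\<close>

lemma mono_moment_linear_rec:
  "(real j + 3) * mono_moment c (j + 2) =
   (2 * real j + 3) * (1 + c) * mono_moment c (j + 1) - real j * (1 - c)\<^sup>2 * mono_moment c j"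
proof -
  define M where "M = Abs_fps (mono_moment c)"
  let ?X = "fps_X :: real fps"
  define K where "K = fps_const (c - 1) * ?X - 1"
  define Y where "Y = 2 * (?X * M) + K"
  define D where "D = 1 - fps_const (2 * (1 + c)) * ?X + fps_const ((1 - c)\<^sup>2) * (?X * ?X)"
  \<comment> \<open>The sum in the recursion stops before i = n. Completing it to the full
    convolution adds one copy of M, which is why c becomes c - 1.\<close>
  have M: "M = 1 + ?X * (fps_const (c - 1) * M + M * M)"
  proof (rule fps_ext)
    fix n show "fps_nth M n = fps_nth (1 + ?X * (fps_const (c - 1) * M + M * M)) n"
    proof (cases n)
      case (Suc k)
      have "fps_nth (M * M) k = (\<Sum>i\<le>k. mono_moment c i * mono_moment c (k - i))"
        by (simp add: fps_mult_nth M_def atLeast0AtMost)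
      also have "\<dots> = (\<Sum>i<k. mono_moment c i * mono_moment c (k - i)) + mono_moment c k"
        by (simp add: lessThan_Suc_atMost[symmetric])
      finally show ?thesis using Suc mono_moment_Suc[of c k] by (simp add: M_def algebra_simps)
    qed (simp add: M_def)
  qed
  \<comment> \<open>So M is a root of a quadratic with leading coefficient X and middle coefficient
    K; Y completes the square, and D is the discriminant K^2 - 4X.\<close>
  have "?X * (M * M) + K * M = -1" using M unfolding K_def by (simp add: algebra_simps)
  moreover have "Y * Y = 4 * (?X * (?X * (M * M) + K * M)) + K * K"
    unfolding Y_def by (simp add: algebra_simps)
  ultimately have "Y * Y = 4 * (?X * (-1)) + K * K" by (simp only:)
  also have "\<dots> = D"
    unfolding K_def D_def power2_eq_square
    by (simp add: algebra_simps fps_const_add[symmetric] fps_const_mult[symmetric] fps_const_sub[symmetric] numeral_fps_const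
        del: fps_const_add fps_const_mult fps_const_sub)
  finally have YD: "Y * Y = D" .
  have "fps_deriv D = 2 * (Y * fps_deriv Y)" unfolding YD[symmetric] by (simp add: algebra_simps)
  \<comment> \<open>Multiplying by Y once more replaces the square by D and leaves an equation that
    is linear in Y. Comparing coefficients then gives three terms, since D has degree two.\<close>
  then have "fps_deriv D * Y = 2 * (D * fps_deriv Y)" unfolding YD[symmetric] by (simp add: algebra_simps)
  then have "fps_nth (fps_deriv D * Y) (j + 2) = fps_nth (2 * (D * fps_deriv Y)) (j + 2)" by simp
  moreover have "fps_deriv D = - fps_const (2 * (1 + c)) + fps_const (2 * (1 - c)\<^sup>2) * ?X"
    unfolding D_def by (simp add: algebra_simps numeral_fps_const)
  moreover have "fps_nth Y (k + 2) = 2 * mono_moment c (k + 1)" for k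
    unfolding Y_def K_def by (simp add: M_def numeral_fps_const)
  moreover have "fps_nth Y (Suc 0) = c + 1" unfolding Y_def K_def by (simp add: M_def numeral_fps_const)
  ultimately show ?thesis
    unfolding D_def
    by (cases j) (simp_all add: algebra_simps numeral_fps_const numeral_2_eq_2 numeral_3_eq_3)
qed

section \<open>Integrals against the Marchenko-Pastur density\<close>

context
  fixes c a b s r :: real
  assumes c: "0 < c"
  defines "a \<equiv> (1 - sqrt c)\<^sup>2" and "b \<equiv> (1 + sqrt c)\<^sup>2" and "s \<equiv> 1 + c" and "r \<equiv> 2 * sqrt c"
begin

definition rad :: "real \<Rightarrow> real" where "rad x = (b - x) * (x - a)"

text \<open>So s is the centre of the support and r its half-length.\<close>

lemma MP_edges: "a = s - r" "b = s + r" "0 < r" "0 \<le> a" "a < b" "s\<^sup>2 - r\<^sup>2 = (1 - c)\<^sup>2" "r\<^sup>2 = 4 * c"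
proof -
  have sq: "sqrt c * sqrt c = c" "sqrt c > 0" using c by auto
  show "0 \<le> a" unfolding a_def by simp
  show "a = s - r" "b = s + r" "0 < r" "r\<^sup>2 = 4 * c" using sq unfolding a_def b_def s_def r_def
    by (auto simp: power2_eq_square algebra_simps)
  then show "a < b" "s\<^sup>2 - r\<^sup>2 = (1 - c)\<^sup>2" by (auto simp: s_def power2_eq_square algebra_simps)
qed

lemma MP_rad: "rad x = r\<^sup>2 - (x - s)\<^sup>2" "rad x = - x\<^sup>2 + 2 * s * x - (1 - c)\<^sup>2"
  using MP_edges unfolding rad_def MP_edges(1,2) by (auto simp: power2_eq_square algebra_simps)

lemma MP_rad_pos: "a < x \<Longrightarrow> x < b \<Longrightarrow> 0 < rad x" and MP_rad_ends: "rad a = 0" "rad b = 0"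
  and MP_rad_nonneg: "a \<le> x \<Longrightarrow> x \<le> b \<Longrightarrow> 0 \<le> rad x"
  by (auto simp: rad_def)

lemma MP_rad_deriv: "(rad has_real_derivative 2 * (s - x)) (at x)"
  unfolding MP_rad(1)[abs_def] by (auto intro!: derivative_eq_intros simp: algebra_simps)

lemma MP_rad_cont: "continuous_on A rad"
  unfolding rad_def by (intro continuous_intros)

lemma MP_sqrt_rad_deriv: "0 < rad x \<Longrightarrow> ((\<lambda>x. sqrt (rad x)) has_real_derivative (s - x) / sqrt (rad x)) (at x)"
  by (rule derivative_eq_intros MP_rad_deriv refl | simp add: field_simps)+

text \<open>Up to the factor 2 pi this is the moment of order k + 1: one power of x cancels the 1/x
  of the density.\<close>

definition "MP_L k = integral {a..b} (\<lambda>x. x ^ k * sqrt (rad x))"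

lemma MP_L_integrable: "((\<lambda>x. x ^ k * sqrt (rad x)) has_integral MP_L k) {a..b}"
  unfolding MP_L_def
  by (intro integrable_integral integrable_continuous_interval continuous_intros MP_rad_cont)

text \<open>Integrate the derivative of x^j times the power 3/2 of \<open>rad\<close>, which
  vanishes at both edges. With this exponent the derivative is a polynomial times the square root,
  with only three powers of x. For j = 0 the truncated j - 1 is harmless because its coefficient
  vanishes.\<close>

lemma MP_L_rec: "(real j + 3) * MP_L (Suc j) = (2 * real j + 3) * s * MP_L j - real j * (1 - c)\<^sup>2 * MP_L (j - 1)"
proof -
  let ?G = "\<lambda>x. x ^ j * (rad x * sqrt (rad x))"
  let ?g = "\<lambda>x. - (real j + 3) * (x ^ Suc j * sqrt (rad x)) + (2 * real j + 3) * s * (x ^ j * sqrt (rad x))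
      - real j * (1 - c)\<^sup>2 * (x ^ (j - 1) * sqrt (rad x))"
  have "(?g has_integral (?G b - ?G a)) {a..b}"
  proof (rule fundamental_theorem_of_calculus_interior)
    show "a \<le> b" using MP_edges by simp
    show "continuous_on {a..b} ?G" by (intro continuous_intros MP_rad_cont)
    fix x assume x: "x \<in> {a<..<b}"
    then have pos: "0 < rad x" using MP_rad_pos by simp
    have sq: "rad x / sqrt (rad x) = sqrt (rad x)" using pos by (simp add: real_div_sqrt)
    have "((\<lambda>x. rad x * sqrt (rad x)) has_real_derivative 3 * (s - x) * sqrt (rad x)) (at x)"
    proof -
      have "((\<lambda>x. rad x * sqrt (rad x)) has_real_derivative (2 * (s - x) * sqrt (rad x) + ((s - x) / sqrt (rad x)) * rad x)) (at x)"
        by (rule DERIV_mult[OF MP_rad_deriv MP_sqrt_rad_deriv[OF pos]])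
      also have "2 * (s - x) * sqrt (rad x) + ((s - x) / sqrt (rad x)) * rad x = 3 * (s - x) * sqrt (rad x)"
      proof -
        have "((s - x) / sqrt (rad x)) * rad x = (s - x) * (rad x / sqrt (rad x))" by simp
        then show ?thesis unfolding sq by (simp add: algebra_simps)
      qed
      finally show ?thesis .
    qed
    then have "(?G has_real_derivative (real j * x ^ (j - 1) * (rad x * sqrt (rad x)) + 3 * (s - x) * sqrt (rad x) * x ^ j)) (at x)"
      using DERIV_mult[OF DERIV_pow[of j x]] by fastforce
    also have "real j * x ^ (j - 1) * (rad x * sqrt (rad x)) + 3 * (s - x) * sqrt (rad x) * x ^ j = ?g x"
    proof (cases j)
      case (Suc i)
      then show ?thesis unfolding MP_rad(2)[of x] by (simp add: algebra_simps power2_eq_square)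
    qed (simp add: algebra_simps)
    finally show "(?G has_vector_derivative ?g x) (at x)" by (simp add: has_real_derivative_iff_has_vector_derivative)
  qed
  then have 0: "(?g has_integral 0) {a..b}" using MP_rad_ends by simp
  have "(?g has_integral (- (real j + 3) * MP_L (Suc j) + (2 * real j + 3) * s * MP_L j - real j * (1 - c)\<^sup>2 * MP_L (j - 1))) {a..b}"
    by (intro has_integral_add has_integral_diff has_integral_mult_right MP_L_integrable)
  from has_integral_unique[OF 0 this] show ?thesis by (simp add: algebra_simps)
qed

lemma MP_u: "a \<le> x \<Longrightarrow> x \<le> b \<Longrightarrow> -1 \<le> (x - s) / r \<and> (x - s) / r \<le> 1"
  "a < x \<Longrightarrow> x < b \<Longrightarrow> -1 < (x - s) / r \<and> (x - s) / r < 1"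
  using MP_edges by (auto simp: field_simps)

lemma MP_arcsin_u_deriv:
  assumes "a < x" "x < b"
  shows "((\<lambda>x. arcsin ((x - s) / r)) has_real_derivative 1 / sqrt (rad x)) (at x)"
proof -
  have pos: "0 < rad x" by (rule MP_rad_pos[OF assms])
  have "1 - ((x - s) / r)\<^sup>2 = rad x / r\<^sup>2" unfolding MP_rad(1) using MP_edges(3) by (simp add: power_divide field_simps)
  then have "sqrt (1 - ((x - s) / r)\<^sup>2) = sqrt (rad x) / r" using MP_edges(3) by (simp add: real_sqrt_divide)
  moreover have "((\<lambda>x. arcsin ((x - s) / r)) has_real_derivative (inverse (sqrt (1 - ((x - s) / r)\<^sup>2)) * (1 / r))) (at x)"
    by (rule DERIV_chain2[OF DERIV_arcsin]) (use MP_u(2)[OF assms] MP_edges(3) in \<open>auto intro!: derivative_eq_intros\<close>)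
  ultimately show ?thesis using MP_edges(3) by simp
qed

lemma MP_arcsin_u_cont: "continuous_on {a..b} (\<lambda>x. arcsin ((x - s) / r))"
  by (intro continuous_intros ballI) (use MP_u(1) MP_edges(3) in auto)

lemma MP_u_ends: "(a - s) / r = -1" "(b - s) / r = 1"
  using MP_edges by (auto simp: field_simps)

text \<open>This is the area of a half disc of radius r = 2 sqrt c.\<close>

lemma MP_L_0: "MP_L 0 = 2 * pi * c"
proof -
  let ?F = "\<lambda>x. r\<^sup>2 / 2 * arcsin ((x - s) / r) + (x - s) * sqrt (rad x) / 2"
  have "((\<lambda>x. x ^ 0 * sqrt (rad x)) has_integral (?F b - ?F a)) {a..b}"
  proof (rule fundamental_theorem_of_calculus_interior)
    show "a \<le> b" using MP_edges by simp
    show "continuous_on {a..b} ?F" by (intro continuous_intros MP_rad_cont MP_arcsin_u_cont) auto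
    fix x assume "x \<in> {a<..<b}"
    then have x: "a < x" "x < b" by auto
    have pos: "0 < rad x" by (rule MP_rad_pos[OF x])
    have "((\<lambda>x. (x - s) * sqrt (rad x)) has_real_derivative (1 * sqrt (rad x) + (s - x) / sqrt (rad x) * (x - s))) (at x)"
      by (rule DERIV_mult[OF _ MP_sqrt_rad_deriv[OF pos]]) (auto intro!: derivative_eq_intros)
    then have "(?F has_real_derivative (r\<^sup>2 / 2 * (1 / sqrt (rad x)) + (1 * sqrt (rad x) + (s - x) / sqrt (rad x) * (x - s)) / 2)) (at x)"
      by (intro DERIV_add DERIV_cmult[OF MP_arcsin_u_deriv[OF x]] DERIV_cdivide)
    also have "r\<^sup>2 / 2 * (1 / sqrt (rad x)) + (1 * sqrt (rad x) + (s - x) / sqrt (rad x) * (x - s)) / 2 = sqrt (rad x)"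
    proof -
      have "r\<^sup>2 + (s - x) * (x - s) = sqrt (rad x) * sqrt (rad x)"
        using pos MP_rad(1)[of x] by (simp add: power2_eq_square algebra_simps)
      then show ?thesis using pos by (simp add: field_simps)
    qed
    finally show "(?F has_vector_derivative x ^ 0 * sqrt (rad x)) (at x)"
      by (simp add: has_real_derivative_iff_has_vector_derivative)
  qed
  then have "MP_L 0 = ?F b - ?F a" using MP_L_integrable has_integral_unique by blast
  then show ?thesis unfolding MP_u_ends MP_rad_ends by (simp add: arcsin_minus MP_edges(7))
qed

text \<open>With \<open>d = sqrt (ab)\<close>, the function \<open>sqrt (rad x) / x\<close> has the primitive
  \<open>sqrt (rad x) + s arcsin ((x - s) / r) - d arcsin ((sx - d\<^sup>2) / (rx))\<close>; the last term is absent if \<open>c = 1\<close>.\<close>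

lemma MP_mass: "((\<lambda>x. sqrt (rad x) / x) has_integral 2 * pi * min 1 c) {a..b}"
proof -
  define d where "d = \<bar>1 - c\<bar>"
  have d2: "d\<^sup>2 = (1 - c)\<^sup>2" by (simp add: d_def)
  have abd: "a * b = d\<^sup>2" unfolding d2 MP_edges(1,2) using MP_edges(6) by (simp add: power2_eq_square algebra_simps)
  \<comment> \<open>The arcsines run from - pi/2 to pi/2, so each contributes pi times its
    coefficient. Together with the atom max (1 - c) 0 the mass 2 pi min 1 c, divided by 2 pi, makes
    one.\<close>
  have val: "pi * s - pi * d = 2 * pi * min 1 c"
    unfolding s_def d_def by (cases "c \<le> 1") (auto simp: algebra_simps)
  have deriv0: "((\<lambda>x. sqrt (rad x) + s * arcsin ((x - s) / r)) has_real_derivative (s - x) / sqrt (rad x) + s * (1 / sqrt (rad x))) (at x)"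
    if "a < x" "x < b" for x
    by (rule derivative_eq_intros MP_arcsin_u_deriv[OF that] MP_sqrt_rad_deriv[OF MP_rad_pos[OF that]] refl | simp)+
  have alg: "(s - x) / sqrt (rad x) + s * (1 / sqrt (rad x)) - d * (d / (x * sqrt (rad x))) = sqrt (rad x) / x"
    if "a < x" "x < b" for x
  proof -
    have pos: "0 < rad x" "0 < x" using MP_rad_pos[OF that] MP_edges that by auto
    have q2: "sqrt (rad x) * sqrt (rad x) = 2 * s * x - x * x - d * d"
      using pos MP_rad(2)[of x] d2 by (simp add: power2_eq_square)
    define q where "q = sqrt (rad x)"
    have q: "q > 0" using pos by (simp add: q_def)
    have "(s - x) / q + s * (1 / q) - d * (d / (x * q)) = (2 * s * x - x * x - d * d) / (x * q)"
      using q pos by (simp add: field_simps)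
    also have "\<dots> = q * q / (x * q)" using q2 by (simp only: q_def)
    also have "\<dots> = q / x" using q by simp
    finally show ?thesis unfolding q_def .
  qed
  show ?thesis
  \<comment> \<open>If c = 1 the lower edge is 0, where the second arcsine would involve a division
    by zero.\<close>
  proof (cases "d = 0")
    case True
    let ?F = "\<lambda>x. sqrt (rad x) + s * arcsin ((x - s) / r)"
    have "((\<lambda>x. sqrt (rad x) / x) has_integral (?F b - ?F a)) {a..b}"
    proof (rule fundamental_theorem_of_calculus_interior)
      show "a \<le> b" using MP_edges by simp
      show "continuous_on {a..b} ?F" by (intro continuous_intros MP_rad_cont MP_arcsin_u_cont)
      fix x assume "x \<in> {a<..<b}"
      then have x: "a < x" "x < b" by auto
      show "(?F has_vector_derivative sqrt (rad x) / x) (at x)"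
        using deriv0[OF x] alg[OF x] True by (simp add: has_real_derivative_iff_has_vector_derivative)
    qed
    moreover have "?F b - ?F a = pi * s - pi * d" unfolding MP_u_ends MP_rad_ends using True by (simp add: arcsin_minus)
    ultimately show ?thesis using val by simp
  next
    case False
    then have d: "d > 0" by (simp add: d_def)
    then have "a * b > 0" unfolding abd by simp
    then have "a \<noteq> 0" by (rule contrapos_pn) simp
    then have a: "a > 0" using MP_edges(4) by linarith
    \<comment> \<open>Up to sign this is (y - s)/r at y = ab/x: the inversion exchanges the two
      edges and turns the 1/x of the integrand into an arcsine.\<close>
    define v where "v x = (s * x - d\<^sup>2) / (x * r)" for x
    have v2: "1 - (v x)\<^sup>2 = (d * d * rad x) / ((x * r) * (x * r))" if "x > 0" for x
    proof -
      have "(x * r) * (x * r) - (s * x - d\<^sup>2) * (s * x - d\<^sup>2) = d * d * rad x"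
      proof -
        have rr: "r * r = s * s - d * d" using MP_edges(6) unfolding d2[symmetric] by (simp add: power2_eq_square)
        have "(x * r) * (x * r) = x * x * (r * r)" by simp
        then show ?thesis unfolding rr MP_rad(2) d2[symmetric] by (simp add: power2_eq_square algebra_simps)
      qed
      moreover have "1 - (v x)\<^sup>2 = ((x * r) * (x * r) - (s * x - d\<^sup>2) * (s * x - d\<^sup>2)) / ((x * r) * (x * r))"
      proof -
        have "1 - (p / q)\<^sup>2 = (q * q - p * p) / (q * q)" if "q \<noteq> 0" for p q :: real
          using that by (simp add: power_divide power2_eq_square diff_divide_distrib)
        then show ?thesis unfolding v_def using that MP_edges(3) by simp
      qed
      ultimately show ?thesis by (simp only:)
    qed
    have vb: "-1 \<le> v x \<and> v x \<le> 1" if "a \<le> x" "x \<le> b" for x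
    proof -
      have "0 \<le> 1 - (v x)\<^sup>2" unfolding v2[OF order.strict_trans2[OF a that(1)]] using MP_rad_nonneg[OF that] by simp
      then show ?thesis using abs_le_square_iff[of "v x" 1] by auto
    qed
    have vb': "-1 < v x \<and> v x < 1" if "a < x" "x < b" for x
    proof -
      have x: "x > 0" using a that by simp
      have "0 < 1 - (v x)\<^sup>2" unfolding v2[OF x] using MP_rad_pos[OF that] d x MP_edges(3) by simp
      then have "(v x)\<^sup>2 < 1" by simp
      then have "\<bar>v x\<bar> < 1" by (simp only: abs_square_less_1)
      then show ?thesis by auto
    qed
    have va: "v a = -1" and vbb: "v b = 1"
    proof -
      have "s * a - d\<^sup>2 = - (a * r)" "s * b - d\<^sup>2 = b * r"
        unfolding abd[symmetric] MP_edges(1,2) by (auto simp: algebra_simps)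
      then show "v a = -1" "v b = 1" unfolding v_def using a MP_edges by auto
    qed
    let ?F = "\<lambda>x. sqrt (rad x) + s * arcsin ((x - s) / r) - d * arcsin (v x)"
    have "((\<lambda>x. sqrt (rad x) / x) has_integral (?F b - ?F a)) {a..b}"
    proof (rule fundamental_theorem_of_calculus_interior)
      show "a \<le> b" using MP_edges by simp
      have "continuous_on {a..b} v" unfolding v_def by (intro continuous_intros) (use a MP_edges(3) in auto)
      then show "continuous_on {a..b} ?F"
        by (intro continuous_intros MP_rad_cont MP_arcsin_u_cont) (use vb in auto)
      fix x assume "x \<in> {a<..<b}"
      then have x: "a < x" "x < b" by auto
      have x0: "x > 0" using a x by simp
      have pos: "0 < rad x" by (rule MP_rad_pos[OF x])
      have dv: "(v has_real_derivative d\<^sup>2 / (r * (x * x))) (at x)"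
      proof -
        have "(v has_real_derivative (s * (x * r) - (s * x - d\<^sup>2) * r) / ((x * r) * (x * r))) (at x)"
          unfolding v_def by (rule derivative_eq_intros refl | use x0 MP_edges(3) in simp)+
        also have "(s * (x * r) - (s * x - d\<^sup>2) * r) / ((x * r) * (x * r)) = d\<^sup>2 / (r * (x * x))"
          using x0 MP_edges(3) by (simp add: field_simps)
        finally show ?thesis .
      qed
      have "sqrt (1 - (v x)\<^sup>2) = d * sqrt (rad x) / (x * r)"
        unfolding v2[OF x0] using d x0 MP_edges(3) by (simp add: real_sqrt_divide real_sqrt_mult)
      moreover have "((\<lambda>x. arcsin (v x)) has_real_derivative (inverse (sqrt (1 - (v x)\<^sup>2)) * (d\<^sup>2 / (r * (x * x))))) (at x)"
        by (rule DERIV_chain2[OF DERIV_arcsin dv]) (use vb'[OF x] in auto)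
      moreover have e: "inverse (d * sqrt (rad x) / (x * r)) * (d\<^sup>2 / (r * (x * x))) = d / (x * sqrt (rad x))"
        using d x0 MP_edges(3) pos by (simp add: field_simps power2_eq_square)
      ultimately have da: "((\<lambda>x. arcsin (v x)) has_real_derivative d / (x * sqrt (rad x))) (at x)"
        using e by (simp only:)
      have "(?F has_real_derivative (s - x) / sqrt (rad x) + s * (1 / sqrt (rad x)) - d * (d / (x * sqrt (rad x)))) (at x)"
        by (rule DERIV_diff[OF deriv0[OF x] DERIV_cmult[OF da]])
      then show "(?F has_vector_derivative sqrt (rad x) / x) (at x)"
        unfolding alg[OF x] by (simp add: has_real_derivative_iff_has_vector_derivative)
    qed
    moreover have "?F b - ?F a = pi * s - pi * d" unfolding MP_u_ends MP_rad_ends va vbb by (simp add: arcsin_minus algebra_simps)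
    ultimately show ?thesis using val by simp
  qed
qed

text \<open>Both sides satisfy the same linear recursion. The coefficient j of its oldest term
  vanishes at j = 0, so the single value at k = 0 starts the induction.\<close>

lemma mono_moment_eq_MP_L: "mono_moment c (Suc k) = MP_L k / (2 * pi)"
proof (induction k rule: less_induct)
  case (less k)
  show ?case
  proof (cases k)
    case 0
    then show ?thesis using MP_L_0 by (simp add: mono_moment_Suc)
  next
    case (Suc j)
    have 1: "mono_moment c (j + 1) = MP_L j / (2 * pi)" using less[of j] Suc by simp
    have 2: "real j * mono_moment c j = real j * (MP_L (j - 1) / (2 * pi))"
      using less[of "j - 1"] Suc by (cases j) auto
    have "(real j + 3) * mono_moment c (j + 2) = (2 * real j + 3) * s * mono_moment c (j + 1) - (1 - c)\<^sup>2 * (real j * mono_moment c j)"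
      using mono_moment_linear_rec[of j c] by (simp add: s_def)
    also have "\<dots> = ((2 * real j + 3) * s * MP_L j - real j * (1 - c)\<^sup>2 * MP_L (j - 1)) / (2 * pi)"
      unfolding 1 2 by (simp add: diff_divide_distrib)
    also have "\<dots> = (real j + 3) * (MP_L (Suc j) / (2 * pi))"
      unfolding MP_L_rec[symmetric] by simp
    finally have "(real j + 3) * mono_moment c (j + 2) = (real j + 3) * (MP_L (Suc j) / (2 * pi))" .
    moreover have "real j + 3 \<noteq> 0" by linarith
    ultimately have "mono_moment c (j + 2) = MP_L (Suc j) / (2 * pi)" by (metis mult_left_cancel)
    then show ?thesis using Suc by (simp only: add_2_eq_Suc')
  qed
qed

theorem has_bochner_integral_MP_power: "has_bochner_integral (MP c) (\<lambda>t. t ^ k) (mono_moment c k)"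
proof -
  define g where "g x = (if x \<in> {a..b} then x ^ k * sqrt (rad x) / (2 * pi * x) else 0)" for x
  have dens: "MP_density c x = (if x \<in> {a..b} then sqrt (rad x) / (2 * pi * x) else 0)" for x
    unfolding MP_density_def Let_def rad_def a_def b_def by (simp add: indicator_def)
  have dens0: "0 \<le> MP_density c x" for x
    unfolding dens using MP_rad_nonneg[of x] MP_edges(4) by auto
  have gd: "x ^ k * MP_density c x = g x" for x unfolding dens g_def by simp
  have g0: "0 \<le> g x" for x unfolding g_def using MP_rad_nonneg[of x] MP_edges(4) by auto
  have gm: "g \<in> borel_measurable borel" unfolding gd[symmetric] by measurable
  \<comment> \<open>The share of the density alone. The atom at 0 contributes only to the moment of
    order 0, where it fills up min 1 c to one.\<close>
  define J where "J = (if k = 0 then min 1 c else mono_moment c k)"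
  have "((\<lambda>x. x ^ k * sqrt (rad x) / (2 * pi * x)) has_integral J) {a..b}"
  proof (cases k)
    case 0
    then show ?thesis using has_integral_divide[OF MP_mass, of "2 * pi"] by (simp add: J_def field_simps)
  next
    case (Suc j)
    have e: "x ^ j * sqrt (rad x) / (2 * pi) = x ^ k * sqrt (rad x) / (2 * pi * x)" if "x \<in> {a..b}" for x
    proof (cases "x = 0")
      \<comment> \<open>This happens only if the lower edge is 0, where the square root vanishes;
        the value 0 that HOL gives to division by 0 then agrees.\<close>
      case True
      then have "a = 0" using that MP_edges(4) by auto
      then have "rad x = 0" using True MP_rad_ends by simp
      then show ?thesis by simp
    next
      case False then show ?thesis using Suc by simp
    qed
    have "((\<lambda>x. x ^ j * sqrt (rad x) / (2 * pi)) has_integral J) {a..b}"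
      using has_integral_divide[OF MP_L_integrable[of j], of "2 * pi"] mono_moment_eq_MP_L[of j] Suc by (simp add: J_def)
    then show ?thesis by (rule has_integral_eq[rotated]) (rule e)
  qed
  then have "(g has_integral J) UNIV"
    unfolding g_def by (simp only: has_integral_restrict_UNIV)
  then have nn: "(\<integral>\<^sup>+x. ennreal (g x) \<partial>lborel) = ennreal J"
    by (rule nn_integral_has_integral_lborel[OF gm g0])
  have J0: "0 \<le> J" using \<open>(g has_integral J) UNIV\<close> g0 by (rule has_integral_nonneg)
  have neg0: "emeasure (MP c) {x. x < 0} = 0"
  proof -
    have "(\<integral>\<^sup>+x\<in>{x. x < 0}. ennreal (MP_density c x) \<partial>lborel) = (\<integral>\<^sup>+x. 0 \<partial>(lborel :: real measure))"
      by (intro nn_integral_cong) (use MP_edges(4) in \<open>auto simp: dens indicator_def\<close>)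
    then show ?thesis by (subst emeasure_MP) auto
  qed
  \<comment> \<open>Odd powers are non-negative only on the support, and the passage from the
    non-negative integral needs non-negativity almost everywhere.\<close>
  have AE: "AE x in MP c. 0 \<le> x"
    by (rule AE_I[where N="{x. x < 0}"]) (use neg0 in auto)
  have "(\<integral>\<^sup>+x. ennreal (x ^ k) \<partial>MP c) = ennreal (max (1 - c) 0) * ennreal (0 ^ k) + (\<integral>\<^sup>+x. ennreal (x ^ k) * ennreal (MP_density c x) \<partial>lborel)"
    by (rule nn_integral_MP) measurable
  also have "(\<integral>\<^sup>+x. ennreal (x ^ k) * ennreal (MP_density c x) \<partial>lborel) = (\<integral>\<^sup>+x. ennreal (g x) \<partial>lborel)"
  proof (rule nn_integral_cong)
    fix x
    show "ennreal (x ^ k) * ennreal (MP_density c x) = ennreal (g x)"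
    proof (cases "x \<in> {a..b}")
      case True
      then have "0 \<le> x ^ k" using MP_edges(4) by simp
      then show ?thesis using dens0[of x] by (simp add: ennreal_mult[symmetric] gd)
    next
      case False
      then have "MP_density c x = 0" "g x = 0" unfolding dens g_def by (simp_all only: if_False)
      then show ?thesis by simp
    qed
  qed
  also have "ennreal (max (1 - c) 0) * ennreal (0 ^ k) + (\<integral>\<^sup>+x. ennreal (g x) \<partial>lborel) = ennreal (mono_moment c k)"
  proof (cases "k = 0")
    case True
    then show ?thesis unfolding nn using J0 by (simp add: J_def ennreal_plus[symmetric] max_def min_def del: ennreal_plus)
  qed (simp add: nn J_def)
  finally have N: "(\<integral>\<^sup>+x. ennreal (x ^ k) \<partial>MP c) = ennreal (mono_moment c k)" .
  have m0: "0 \<le> mono_moment c k" using J0 unfolding J_def by (cases "k = 0") auto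
  show ?thesis
    by (rule has_bochner_integral_nn_integral) (use AE N m0 in auto)
qed

end

section \<open>Freeness\<close>

text \<open>\<open>centered c w L\<close> is the moment of the word \<open>w\<close> followed by the centred powers
  \<open>x\<^sub>i\<^sup>r - \<phi>(x\<^sub>i\<^sup>r)\<close> for \<open>(i, r)\<close> in \<open>L\<close>.\<close>

fun centered :: "real \<Rightarrow> 'l list \<Rightarrow> ('l \<times> nat) list \<Rightarrow> real" where
  "centered c w [] = word_moment c w"
| "centered c w ((i, r) # L) = centered c (w @ replicate r i) L - word_moment c (replicate r i) * centered c w L"

text \<open>The moment of w, then the centred blocks K, then the plain power s of the letter l: the
  scalar subtracted by centring is added back.\<close>

definition centered_then :: "real \<Rightarrow> 'l list \<Rightarrow> ('l \<times> nat) list \<Rightarrow> 'l \<Rightarrow> nat \<Rightarrow> real" where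
  "centered_then c w K l s = centered c w (K @ [(l, s)]) + word_moment c (replicate s l) * centered c w K"

lemma centered_then_Nil: "centered_then c w [] l s = word_moment c (w @ replicate s l)"
  by (simp add: centered_then_def)

lemma centered_then_Cons:
  "centered_then c w ((i, r) # K) l s =
   centered_then c (w @ replicate r i) K l s - word_moment c (replicate r i) * centered_then c w K l s"
  by (simp add: centered_then_def algebra_simps)

text \<open>The terms of the recursion in which the leading letter l joins a letter inside a centred
  block. That block is cut after s letters: the left part becomes a plain power behind the preceding
  blocks, the right part a plain power in front of the following ones. The scalar subtracted in the
  block contains no letter to join.\<close>

definition block_terms :: "real \<Rightarrow> 'l \<Rightarrow> 'l list \<Rightarrow> ('l \<times> nat) list \<Rightarrow> real" where
  "block_terms c l w L = (\<Sum>t<length L. if fst (L ! t) = l then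
     (\<Sum>s<snd (L ! t). centered_then c w (take t L) l s * centered c (replicate (snd (L ! t) - s) l) (drop (Suc t) L)) else 0)"

lemma block_terms_Cons:
  "block_terms c l w ((i, r) # L) =
   (if i = l then (\<Sum>s<r. word_moment c (w @ replicate s l) * centered c (replicate (r - s) l) L) else 0) +
   (block_terms c l (w @ replicate r i) L - word_moment c (replicate r i) * block_terms c l w L)"
proof -
  have "block_terms c l w ((i, r) # L) =
    (if i = l then (\<Sum>s<r. word_moment c (w @ replicate s l) * centered c (replicate (r - s) l) L) else 0) +
    (\<Sum>t<length L. if fst (L ! t) = l then
     (\<Sum>s<snd (L ! t). centered_then c w ((i, r) # take t L) l s * centered c (replicate (snd (L ! t) - s) l) (drop (Suc t) L)) else 0)"
    unfolding block_terms_def by (simp add: sum.lessThan_Suc_shift centered_then_Nil del: sum.lessThan_Suc cong: if_cong)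
  also have "(\<Sum>t<length L. if fst (L ! t) = l then
     (\<Sum>s<snd (L ! t). centered_then c w ((i, r) # take t L) l s * centered c (replicate (snd (L ! t) - s) l) (drop (Suc t) L)) else 0) =
     block_terms c l (w @ replicate r i) L - word_moment c (replicate r i) * block_terms c l w L"
    unfolding block_terms_def sum_distrib_left sum_subtractf[symmetric]
    by (intro sum.cong refl)
      (simp add: centered_then_Cons sum_distrib_left sum_subtractf[symmetric] left_diff_distrib mult.assoc)
  finally show ?thesis .
qed

lemma word_sum_append_replicate:
  fixes h :: "'l list \<Rightarrow> real"
  shows "(\<Sum>t<length (w @ replicate r i). if (w @ replicate r i) ! t = l
      then word_moment c (take t (w @ replicate r i)) * h (drop t (w @ replicate r i)) else 0) =
    (\<Sum>t<length w. if w ! t = l then word_moment c (take t w) * h (drop t w @ replicate r i) else 0) +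
    (if i = l then (\<Sum>s<r. word_moment c (w @ replicate s l) * h (replicate (r - s) l)) else 0)"
proof -
  let ?g = "\<lambda>t. if (w @ replicate r i) ! t = l then word_moment c (take t (w @ replicate r i)) * h (drop t (w @ replicate r i)) else 0"
  have "(\<Sum>t<n + k. g t) = (\<Sum>t<n. g t) + (\<Sum>s<k. g (n + s))" for g :: "nat \<Rightarrow> real" and n k
    by (induction k) (simp_all add: add.assoc)
  from this[of ?g "length w" r]
  have "(\<Sum>t<length w + r. ?g t) = (\<Sum>t<length w. ?g t) + (\<Sum>s<r. ?g (length w + s))" .
  moreover have "(\<Sum>t<length w. ?g t) = (\<Sum>t<length w. if w ! t = l then word_moment c (take t w) * h (drop t w @ replicate r i) else 0)"
    by (intro sum.cong refl) (auto simp: nth_append)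
  moreover have "(\<Sum>s<r. ?g (length w + s)) = (if i = l then (\<Sum>s<r. word_moment c (w @ replicate s l) * h (replicate (r - s) l)) else 0)"
  proof (cases "i = l")
    case True
    then show ?thesis unfolding if_P[OF True]
      by (intro sum.cong refl) (auto simp: nth_append min_def)
  next
    case False
    then have "(w @ replicate r i) ! (length w + s) \<noteq> l" if "s < r" for s using that by (simp add: nth_append)
    then show ?thesis unfolding if_not_P[OF False] by (intro sum.neutral) simp
  qed
  ultimately show ?thesis by (simp only: length_append length_replicate)
qed

text \<open>Expanding the first letter by the recursion acts as a derivation on the centred blocks.\<close>

lemma centered_Cons_word:
  "centered c (l # w) L = c * centered c w L +
     (\<Sum>t<length w. if w ! t = l then word_moment c (take t w) * centered c (drop t w) L else 0) + block_terms c l w L"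
proof (induction L arbitrary: w)
  case Nil
  then show ?case by (simp add: block_terms_def cong: if_cong)
next
  case (Cons b L)
  obtain i r where b: "b = (i, r)" by fastforce
  let ?m = "word_moment c (replicate r i)" and ?w = "w @ replicate r i"
  let ?W = "\<lambda>w g. (\<Sum>t<length w. if w ! t = l then word_moment c (take t w) * g (drop t w) else 0)"
  have "centered c (l # w) (b # L) = centered c (l # ?w) L - ?m * centered c (l # w) L" unfolding b by simp
  also have "\<dots> = (c * centered c ?w L + ?W ?w (\<lambda>v. centered c v L) + block_terms c l ?w L) -
      ?m * (c * centered c w L + ?W w (\<lambda>v. centered c v L) + block_terms c l w L)"
    by (simp only: Cons.IH)
  also have "\<dots> = c * (centered c ?w L - ?m * centered c w L) +
      (?W w (\<lambda>v. centered c (v @ replicate r i) L) - ?m * ?W w (\<lambda>v. centered c v L)) + block_terms c l w ((i, r) # L)"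
    unfolding word_sum_append_replicate[where h="\<lambda>v. centered c v L"] block_terms_Cons by (simp add: algebra_simps)
  also have "?W w (\<lambda>v. centered c (v @ replicate r i) L) - ?m * ?W w (\<lambda>v. centered c v L) = ?W w (\<lambda>v. centered c v (b # L))"
    unfolding sum_distrib_left sum_subtractf[symmetric] b
    by (intro sum.cong refl) (simp add: right_diff_distrib mult.left_commute)
  finally show ?case unfolding b by simp
qed

text \<open>The centred first block is a difference of plain powers, so it suffices to treat a plain
  power of l followed by an alternating list that does not start with l. Expanding its first letter,
  the terms within the power have a shorter power. A term joining a later block cuts the list in
  two. The right part vanishes if blocks are left in it; otherwise the left part is again
  alternating, now ends in a power of l, and stands behind a shorter leading power.\<close>

theorem centered_alternating:
  assumes "L \<noteq> []" "distinct_adj (map fst L)"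
  shows "centered c [] L = 0"
  using assms
proof (induction "length L" arbitrary: L rule: less_induct)
  case less
  obtain l k L' where L: "L = (l, k) # L'" using less.prems(1) by (cases L) auto
  have IH: "centered c [] D = 0" if "D \<noteq> []" "distinct_adj (map fst D)" "length D \<le> length L'" for D :: "('a \<times> nat) list"
    using less.hyps[of D] that L by simp
  \<comment> \<open>A plain power is its centred version plus a scalar, and both resulting
    alternating products have few enough blocks.\<close>
  have IH2: "centered c (replicate q j) D = 0"
    if "D \<noteq> []" "distinct_adj (j # map fst D)" "length D < length L'" for D :: "('a \<times> nat) list" and q j
  proof -
    have "centered c [] ((j, q) # D) = 0" using that by (intro IH) auto
    moreover have "centered c [] D = 0" using that by (intro IH) (auto dest: distinct_adj_ConsD)
    ultimately show ?thesis by simp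
  qed
  show ?case
  proof (cases "L' = []")
    case True then show ?thesis using L by simp
  next
    case False
    \<comment> \<open>D varies in this inner induction because cutting the last block changes its
      exponent.\<close>
    have main: "centered c (replicate k l) D = 0"
      if "length D = length L'" "distinct_adj (l # map fst D)" for k and D :: "('a \<times> nat) list"
      using that
    proof (induction k arbitrary: D rule: less_induct)
      case (less k)
      have Dne: "D \<noteq> []" using less.prems False by auto
      have adj: "distinct_adj (map fst D)" using less.prems(2) by (rule distinct_adj_ConsD)
      show ?case
      proof (cases k)
        case 0
        then show ?thesis using IH[OF Dne adj] less.prems by simp
      next
        case (Suc k')
        have hd: "fst (D ! 0) \<noteq> l" using less.prems(2) Dne by (cases D) auto
        have "block_terms c l (replicate k' l) D = 0"
          unfolding block_terms_def
        proof (rule sum.neutral, intro ballI)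
          fix t assume "t \<in> {..<length D}"
          then have t: "t < length D" by simp
          show "(if fst (D ! t) = l then
            (\<Sum>s<snd (D ! t). centered_then c (replicate k' l) (take t D) l s * centered c (replicate (snd (D ! t) - s) l) (drop (Suc t) D)) else 0) = 0"
          proof (cases "fst (D ! t) = l")
            case True
            have t0: "t \<noteq> 0" using True hd by (intro notI) simp
            have split: "map fst D = map fst (take t D) @ l # map fst (drop (Suc t) D)"
              using id_take_nth_drop[OF t] True by (metis list.simps(9) map_append)
            have a1: "distinct_adj (l # map fst (drop (Suc t) D))"
              using adj unfolding split by (rule distinct_adj_appendD2)
            have a2: "distinct_adj (l # (map fst (take t D) @ [l]))"
              using less.prems(2) unfolding split by (metis append_Cons append_Nil append_assoc distinct_adj_appendD1)
            have a3: "distinct_adj (l # map fst (take t D))"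
              using a2 by (metis append_Cons distinct_adj_appendD1)
            \<comment> \<open>If blocks follow the cut, the right factor vanishes by the outer
              induction. If the cut block is the last one, the left factor vanishes: its centred
              part by the inner induction, since k' < k, and its scalar part because it has fewer
              blocks.\<close>
            have "centered_then c (replicate k' l) (take t D) l s * centered c (replicate (snd (D ! t) - s) l) (drop (Suc t) D) = 0" for s
            proof (cases "drop (Suc t) D = []")
              case False
              then show ?thesis using IH2[OF False a1] t less.prems(1) by simp
            next
              case True
              then have len: "length D = Suc t" using t by simp
              have "centered c (replicate k' l) (take t D @ [(l, s)]) = 0"
                by (rule less.IH) (use Suc len less.prems(1) a2 in auto)
              moreover have "centered c (replicate k' l) (take t D) = 0"
                by (rule IH2[OF _ a3]) (use t0 len less.prems(1) in auto)
              ultimately show ?thesis unfolding centered_then_def by simp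
            qed
            then show ?thesis unfolding if_P[OF True] by (rule sum.neutral[OF ballI])
          qed simp
        qed
        moreover have "(\<Sum>t<k'. if replicate k' l ! t = l then word_moment c (take t (replicate k' l)) * centered c (drop t (replicate k' l)) D else 0) = 0"
        proof (rule sum.neutral, intro ballI)
          fix t assume "t \<in> {..<k'}"
          then have "centered c (drop t (replicate k' l)) D = 0"
            using less.IH[of "k' - t" D] less.prems Suc by simp
          then show "(if replicate k' l ! t = l then word_moment c (take t (replicate k' l)) * centered c (drop t (replicate k' l)) D else 0) = 0" by simp
        qed
        moreover have "centered c (replicate k' l) D = 0" using less.IH[of k' D] less.prems Suc by simp
        ultimately show ?thesis using Suc centered_Cons_word[of c l "replicate k' l" D] by simp
      qed
    qed
    have "centered c (replicate k l) L' = 0" by (rule main) (use less.prems L in auto)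
    moreover have "centered c [] L' = 0" by (rule IH[OF False]) (use less.prems L in \<open>auto dest: distinct_adj_ConsD\<close>)
    ultimately show ?thesis using L by simp
  qed
qed

section \<open>The star-algebra of non-commutative polynomials and freeness of its variables\<close>

lemma nc_poly_induct [case_names single add]:
  fixes P :: "'l nc_poly"
  assumes "\<And>k v. Q (Poly_Mapping.single k v)" "\<And>a b. Q a \<Longrightarrow> Q b \<Longrightarrow> Q (a + b)"
  shows "Q P"
proof -
  have "P = (\<Sum>k\<in>Poly_Mapping.keys P. Poly_Mapping.single k (Poly_Mapping.lookup P k))"
    by (rule poly_mapping_eqI) (auto simp: lookup_sum lookup_single when_def in_keys_iff)
  moreover have "Q (\<Sum>k\<in>K. Poly_Mapping.single k (Poly_Mapping.lookup P k))" if "finite K" for K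
    using that
  proof induct
    case empty show ?case using assms(1)[of 0 0] by simp
  qed (simp add: assms)
  ultimately show ?thesis by (metis finite_keys)
qed

definition nc_scale :: "complex \<Rightarrow> 'l nc_poly \<Rightarrow> 'l nc_poly" where
  "nc_scale r P = Poly_Mapping.single 0 r * P"

definition rev_word :: "'l free_monoid \<Rightarrow> 'l free_monoid" where
  "rev_word k = Letters (rev (letters k))"

text \<open>The variables are to be self-adjoint, so the adjoint only reverses words and conjugates
  coefficients.\<close>

definition nc_star :: "'l nc_poly \<Rightarrow> 'l nc_poly" where
  "nc_star P = Abs_poly_mapping (\<lambda>k. cnj (Poly_Mapping.lookup P (rev_word k)))"

definition moment_functional :: "real \<Rightarrow> 'l nc_poly \<Rightarrow> complex" where
  "moment_functional c P = (\<Sum>k\<in>Poly_Mapping.keys P. Poly_Mapping.lookup P k * word_moment c (letters k))"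

definition nc_var :: "'l \<Rightarrow> 'l nc_poly" where
  "nc_var l = Poly_Mapping.single (Letters [l]) 1"

lemma rev_word_simps [simp]: "rev_word (rev_word k) = k" "rev_word (k + l) = rev_word l + rev_word k"
  by (simp_all add: rev_word_def plus_free_monoid_def)

lemma lookup_nc_star: "Poly_Mapping.lookup (nc_star P) k = cnj (Poly_Mapping.lookup P (rev_word k))"
proof -
  have "{k. cnj (Poly_Mapping.lookup P (rev_word k)) \<noteq> 0} \<subseteq> rev_word ` Poly_Mapping.keys P"
  proof
    fix k assume "k \<in> {k. cnj (Poly_Mapping.lookup P (rev_word k)) \<noteq> 0}"
    then have "rev_word k \<in> Poly_Mapping.keys P" by (simp add: in_keys_iff)
    then show "k \<in> rev_word ` Poly_Mapping.keys P" by (rule rev_image_eqI) simp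
  qed
  then have "finite {k. cnj (Poly_Mapping.lookup P (rev_word k)) \<noteq> 0}" by (rule finite_subset) simp
  then show ?thesis unfolding nc_star_def by simp
qed

lemma nc_star_single: "nc_star (Poly_Mapping.single k v) = Poly_Mapping.single (rev_word k) (cnj v)"
proof (rule poly_mapping_eqI)
  fix k'
  have "k = rev_word k' \<longleftrightarrow> rev_word k = k'" by (metis rev_word_simps(1))
  then show "Poly_Mapping.lookup (nc_star (Poly_Mapping.single k v)) k' = Poly_Mapping.lookup (Poly_Mapping.single (rev_word k) (cnj v)) k'"
    by (simp add: lookup_nc_star lookup_single when_def)
qed

lemma nc_star_add: "nc_star (a + b) = nc_star a + nc_star b"
  by (rule poly_mapping_eqI) (simp add: lookup_nc_star lookup_add)

lemma nc_star_star: "nc_star (nc_star a) = a"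
  by (rule poly_mapping_eqI) (simp add: lookup_nc_star)

lemma nc_star_mult: "nc_star (a * b) = nc_star b * nc_star a"
proof (induction a rule: nc_poly_induct)
  case (single k v)
  show ?case
  proof (induction b rule: nc_poly_induct)
    case (single l w)
    show ?case by (simp add: nc_star_single mult_single mult.commute)
  qed (simp add: nc_star_add distrib_left distrib_right)
qed (simp add: nc_star_add distrib_left distrib_right)

lemma single_0_commute: "a * Poly_Mapping.single 0 r = Poly_Mapping.single 0 r * a" for a :: "'l nc_poly"
  by (induction a rule: nc_poly_induct) (simp_all add: mult_single mult.commute distrib_left distrib_right)

lemma rev_word_0 [simp]: "rev_word 0 = 0"
  by (simp add: rev_word_def zero_free_monoid_def)

lemma nc_star_scale: "nc_star (nc_scale r a) = nc_scale (cnj r) (nc_star a)"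
  unfolding nc_scale_def nc_star_mult nc_star_single rev_word_0 by (rule single_0_commute)

lemma nc_scale_mult: "nc_scale r (a * b) = nc_scale r a * b" "nc_scale r (a * b) = a * nc_scale r b"
  unfolding nc_scale_def
  by (simp add: mult.assoc) (metis mult.assoc single_0_commute)

lemma nc_vector_space: "vector_space (nc_scale :: complex \<Rightarrow> 'l nc_poly \<Rightarrow> 'l nc_poly)"
proof
  show "nc_scale 1 x = x" for x :: "'l nc_poly" by (simp add: nc_scale_def)
  show "nc_scale a (nc_scale b x) = nc_scale (a * b) x" for a b and x :: "'l nc_poly"
    by (simp add: nc_scale_def mult.assoc[symmetric] mult_single)
qed (simp_all add: nc_scale_def distrib_left distrib_right single_add)

lemma moment_functional_superset:
  assumes "finite K" "Poly_Mapping.keys P \<subseteq> K"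
  shows "moment_functional c P = (\<Sum>k\<in>K. Poly_Mapping.lookup P k * word_moment c (letters k))"
  unfolding moment_functional_def
  by (rule sum.mono_neutral_left) (use assms in \<open>auto simp: in_keys_iff\<close>)

lemma moment_functional_add: "moment_functional c (a + b) = moment_functional c a + moment_functional c b"
proof -
  let ?K = "Poly_Mapping.keys a \<union> Poly_Mapping.keys b"
  have "moment_functional c (a + b) = (\<Sum>k\<in>?K. Poly_Mapping.lookup (a + b) k * word_moment c (letters k))"
    by (rule moment_functional_superset) (auto simp: keys_add)
  also have "\<dots> = (\<Sum>k\<in>?K. Poly_Mapping.lookup a k * word_moment c (letters k)) + (\<Sum>k\<in>?K. Poly_Mapping.lookup b k * word_moment c (letters k))"
    by (simp add: lookup_add distrib_right sum.distrib)
  also have "\<dots> = moment_functional c a + moment_functional c b"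
    using moment_functional_superset[of ?K a c] moment_functional_superset[of ?K b c] by simp
  finally show ?thesis .
qed

lemma moment_functional_single [simp]: "moment_functional c (Poly_Mapping.single k v) = v * word_moment c (letters k)"
  unfolding moment_functional_def by simp

lemma moment_functional_scale: "moment_functional c (nc_scale r a) = r * moment_functional c a"
  unfolding nc_scale_def
  by (induction a rule: nc_poly_induct) (simp_all add: mult_single moment_functional_add distrib_left mult.assoc)

lemma moment_functional_0 [simp]: "moment_functional c 0 = 0"
  by (simp add: moment_functional_def)

lemma moment_functional_diff: "moment_functional c (a - b) = moment_functional c a - moment_functional c b"
  using moment_functional_add[of c "a - b" b] by simp

lemma moment_functional_sum: "moment_functional c (sum h K) = (\<Sum>k\<in>K. moment_functional c (h k))"
  by (induction K rule: infinite_finite_induct) (simp_all add: moment_functional_add)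

lemma moment_functional_one: "moment_functional c (1 :: 'a nc_poly) = 1"
  using moment_functional_single[of c "0 :: 'a free_monoid" 1] unfolding single_one
  by (simp add: zero_free_monoid_def)

lemma prod_list_nc_var: "prod_list (map nc_var w) = Poly_Mapping.single (Letters w) 1"
proof (induction w)
  case Nil
  have "Letters [] = (0 :: 'a free_monoid)" by (simp add: zero_free_monoid_def)
  then show ?case by simp
qed (simp add: nc_var_def mult_single plus_free_monoid_def)

lemma nc_var_power: "nc_var l ^ k = Poly_Mapping.single (Letters (replicate k l)) 1"
  using prod_list_nc_var[of "replicate k l"] by (simp add: prod_list_replicate)

lemma nc_star_var: "nc_star (nc_var l) = nc_var l"
  by (simp add: nc_var_def nc_star_single rev_word_def)

definition centered_power :: "real \<Rightarrow> 'l \<Rightarrow> nat \<Rightarrow> 'l nc_poly" where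
  "centered_power c l k = nc_var l ^ k - nc_scale (word_moment c (replicate k l)) 1"

text \<open>This ties the recursively defined \<open>centered\<close> to honest products in the
  algebra.\<close>

lemma moment_functional_centered:
  "moment_functional c (Poly_Mapping.single (Letters w) 1 * prod_list (map (\<lambda>(l, k). centered_power c l k) L)) = centered c w L"
proof (induction L arbitrary: w)
  case (Cons b L)
  obtain l k where b: "b = (l, k)" by fastforce
  let ?P = "prod_list (map (\<lambda>(l, k). centered_power c l k) L)" and ?s = "Poly_Mapping.single (Letters w) (1::complex)"
  have "?s * (centered_power c l k * ?P) = (?s * nc_var l ^ k) * ?P - nc_scale (word_moment c (replicate k l)) (?s * ?P)"
    unfolding centered_power_def by (simp add: left_diff_distrib right_diff_distrib mult.assoc nc_scale_mult[symmetric])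
  also have "?s * nc_var l ^ k = Poly_Mapping.single (Letters (w @ replicate k l)) 1"
    unfolding nc_var_power by (simp add: mult_single plus_free_monoid_def)
  finally show ?case unfolding b using Cons by (simp add: moment_functional_diff moment_functional_scale)
qed simp

text \<open>By linearity the factors are replaced by centred powers one at a time: L collects those
  already replaced, \<open>as\<close> those still to come. The exponent 0 in the second assumption
  is only a filler; that assumption says that not both lists are empty.\<close>

lemma moment_functional_alternating:
  assumes "\<forall>(l, a)\<in>set as. a \<in> Modules.module.span nc_scale (range (centered_power c l))"
    and "L @ map (\<lambda>(l, a). (l, 0)) as \<noteq> []" "distinct_adj (map fst L @ map fst as)"
  shows "moment_functional c (prod_list (map (\<lambda>(l, k). centered_power c l k) L) * prod_list (map snd as)) = 0"
  using assms
proof (induction as arbitrary: L)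
  case Nil
  have "Letters [] = (0 :: 'a free_monoid)" by (simp add: zero_free_monoid_def)
  then have "moment_functional c (prod_list (map (\<lambda>(l, k). centered_power c l k) L)) = centered c [] L"
    using moment_functional_centered[of c "[]" L] by simp
  then show ?case using Nil centered_alternating[of L c] by simp
next
  case (Cons b as)
  interpret V: vector_space "nc_scale :: complex \<Rightarrow> 'a nc_poly \<Rightarrow> 'a nc_poly" by (rule nc_vector_space)
  obtain l a where b: "b = (l, a)" by fastforce
  let ?P = "prod_list (map (\<lambda>(l, k). centered_power c l k) L)" and ?Q = "prod_list (map snd as)"
  let ?Z = "{a. moment_functional c (?P * (a * ?Q)) = 0}"
  have "a \<in> V.span (range (centered_power c l))" using Cons.prems(1) unfolding b by simp
  moreover have "V.subspace ?Z"
  proof (rule V.subspaceI)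
    show "nc_scale r x \<in> ?Z" if "x \<in> ?Z" for r x
    proof -
      have "?P * (nc_scale r x * ?Q) = nc_scale r (?P * (x * ?Q))" by (simp only: nc_scale_mult(1)[symmetric] nc_scale_mult(2)[symmetric])
      then show ?thesis using that by (simp add: moment_functional_scale)
    qed
  qed (auto simp: distrib_left distrib_right moment_functional_add)
  moreover have "x \<in> ?Z" if xr: "x \<in> range (centered_power c l)" for x
  proof -
    obtain k where x: "x = centered_power c l k" using xr by auto
    have "moment_functional c (prod_list (map (\<lambda>(l, k). centered_power c l k) (L @ [(l, k)])) * ?Q) = 0"
      by (rule Cons.IH) (use Cons.prems in \<open>auto simp: b\<close>)
    then show ?thesis unfolding x by (simp add: mult.assoc)
  qed
  ultimately have "a \<in> ?Z" using V.span_minimal[of "range (centered_power c l)" ?Z] by blast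
  then show ?case unfolding b by simp
qed

text \<open>Subtracting the expectation is linear and sends each power to its centred power, so it
  maps the whole subalgebra into the span.\<close>

lemma centered_span:
  assumes "a \<in> gen_subalgebra nc_scale (nc_var l)" "moment_functional c a = 0"
  shows "a \<in> Modules.module.span nc_scale (range (centered_power c l))"
proof -
  interpret V: vector_space "nc_scale :: complex \<Rightarrow> 'a nc_poly \<Rightarrow> 'a nc_poly" by (rule nc_vector_space)
  let ?Z = "{a. a - nc_scale (moment_functional c a) 1 \<in> V.span (range (centered_power c l))}"
  have "V.subspace ?Z"
  proof (rule V.subspaceI)
    show "0 \<in> ?Z" using V.span_zero by simp
    show "x + y \<in> ?Z" if "x \<in> ?Z" "y \<in> ?Z" for x y
    proof -
      have "(x - nc_scale (moment_functional c x) 1) + (y - nc_scale (moment_functional c y) 1) \<in> V.span (range (centered_power c l))"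
        using that by (intro V.span_add) auto
      then show ?thesis by (simp add: moment_functional_add V.scale_left_distrib algebra_simps)
    qed
    show "nc_scale r x \<in> ?Z" if "x \<in> ?Z" for r x
    proof -
      have "nc_scale r (x - nc_scale (moment_functional c x) 1) \<in> V.span (range (centered_power c l))"
        using that by (intro V.span_scale) auto
      then show ?thesis by (simp add: moment_functional_scale V.scale_right_diff_distrib)
    qed
  qed
  moreover have "range (\<lambda>k. nc_var l ^ k) \<subseteq> ?Z"
  proof
    fix x assume "x \<in> range (\<lambda>k. nc_var l ^ k)"
    then obtain k where x: "x = nc_var l ^ k" by auto
    have "x - nc_scale (moment_functional c x) 1 = centered_power c l k"
      unfolding x centered_power_def by (simp add: nc_var_power)
    then show "x \<in> ?Z" by (auto intro: V.span_base)
  qed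
  ultimately have "a \<in> ?Z" using assms(1) V.span_minimal[of _ ?Z] unfolding gen_subalgebra_def by blast
  then show ?thesis using assms(2) by simp
qed

theorem free_elements_nc_var: "free_elements nc_scale (moment_functional c) nc_var"
  unfolding free_elements_def
proof (intro allI impI)
  fix n i a
  assume A: "1 \<le> n \<and> (\<forall>k<n. a k \<in> gen_subalgebra nc_scale (nc_var (i k)) \<and> moment_functional c (a k) = 0) \<and>
    (\<forall>k. Suc k < n \<longrightarrow> i k \<noteq> i (Suc k))"
  let ?as = "map (\<lambda>k. (i k, a k)) [0..<n]"
  have "moment_functional c (prod_list (map (\<lambda>(l, k). centered_power c l k) []) * prod_list (map snd ?as)) = 0"
  proof (rule moment_functional_alternating)
    show "\<forall>(l, a)\<in>set ?as. a \<in> Modules.module.span nc_scale (range (centered_power c l))"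
      using A by (auto intro!: centered_span)
    show "[] @ map (\<lambda>(l, a). (l, 0)) ?as \<noteq> []" using A by simp
    show "distinct_adj (map fst [] @ map fst ?as)" using A by (simp add: distinct_adj_conv_nth comp_def)
  qed
  then show "moment_functional c (prod_list (map a [0..<n])) = 0" by (simp add: comp_def)
qed

section \<open>Wick's formula\<close>

text \<open>The law of the real and of the imaginary part: variance 1/2, so that the product of two
  such densities is exp (- |z|^2) / pi.\<close>

definition gauss_measure :: "real measure" where
  "gauss_measure = density lborel (normal_density 0 (1 / sqrt 2))"

text \<open>For even k this is the double factorial of k - 1 times the variance 1/2 to the power
  k/2.\<close>

definition gauss_moment :: "nat \<Rightarrow> real" where
  "gauss_moment k = (if even k then fact k / (4 ^ (k div 2) * fact (k div 2)) else 0)"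

lemma prob_space_gauss: "prob_space gauss_measure"
  unfolding gauss_measure_def by (rule prob_space_normal_density) simp

lemma sets_gauss [measurable_cong, simp]: "sets gauss_measure = sets borel"
  by (simp add: gauss_measure_def)

lemma space_gauss [simp]: "space gauss_measure = UNIV"
  by (simp add: gauss_measure_def)

lemma has_bochner_integral_gauss_power:
  "has_bochner_integral gauss_measure (\<lambda>x. x ^ k) (gauss_moment k)"
proof -
  let ?s = "1 / sqrt 2"
  have "has_bochner_integral lborel (\<lambda>x. normal_density 0 ?s x * x ^ k) (gauss_moment k)"
  proof (cases "even k")
    case True
    then obtain l where l: "k = 2 * l" by blast
    show ?thesis using normal_moment_even[of ?s 0 l] by (simp add: l gauss_moment_def power_divide)
  next
    case False
    then obtain l where l: "k = 2 * l + 1" using oddE by blast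
    show ?thesis using normal_moment_odd[of ?s 0 l] by (simp add: l gauss_moment_def)
  qed
  then show ?thesis unfolding gauss_measure_def
    by (intro has_bochner_integral_density) (simp_all add: ac_simps)
qed

lemma gauss_moment_1: "gauss_moment (Suc 0) = 0"
  by (simp add: gauss_moment_def)

lemma gauss_moment_rec: "gauss_moment (Suc (Suc k)) = (k + 1) / 2 * gauss_moment k"
proof (cases "even k")
  case True
  then obtain l where l: "k = 2 * l" by blast
  show ?thesis by (simp add: l gauss_moment_def divide_simps) (simp add: algebra_simps)
qed (simp add: gauss_moment_def)

lemma integrable_gauss_poly: "integrable gauss_measure (\<lambda>x. poly p (complex_of_real x))"
  and integral_gauss_poly: "(\<integral>x. poly p (complex_of_real x) \<partial>gauss_measure) = (\<Sum>k\<le>degree p. coeff p k * gauss_moment k)"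
proof -
  have *: "has_bochner_integral gauss_measure (\<lambda>x. coeff p k * complex_of_real x ^ k) (coeff p k * gauss_moment k)" for k
    using has_bochner_integral_mult_right[of "coeff p k", OF has_bochner_integral_of_real[OF has_bochner_integral_gauss_power[of k]]]
    by (simp only: of_real_power)
  have "has_bochner_integral gauss_measure (\<lambda>x. poly p (complex_of_real x)) (\<Sum>k\<le>degree p. coeff p k * gauss_moment k)"
    unfolding poly_altdef by (rule has_bochner_integral_sum) (rule *)
  then show "integrable gauss_measure (\<lambda>x. poly p (complex_of_real x))"
    "(\<integral>x. poly p (complex_of_real x) \<partial>gauss_measure) = (\<Sum>k\<le>degree p. coeff p k * gauss_moment k)"
    by (auto simp: has_bochner_integral_iff)
qed

text \<open>Integration by parts against the Gaussian weight (Stein's identity).\<close>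

lemma gauss_stein:
  "(\<integral>x. complex_of_real x * poly p (complex_of_real x) \<partial>gauss_measure) =
   (\<integral>x. poly (pderiv p) (complex_of_real x) \<partial>gauss_measure) / 2"
proof -
  let ?n = "degree p"
  have "(\<integral>x. complex_of_real x * poly p (complex_of_real x) \<partial>gauss_measure) = (\<integral>x. poly (pCons 0 p) (complex_of_real x) \<partial>gauss_measure)"
    by simp
  also have "\<dots> = (\<Sum>k\<le>degree (pCons 0 p). coeff (pCons 0 p) k * gauss_moment k)" by (rule integral_gauss_poly)
  also have "\<dots> = (\<Sum>k\<le>Suc ?n. coeff (pCons 0 p) k * gauss_moment k)"
    by (rule sum.mono_neutral_left) (auto simp: degree_pCons_le coeff_eq_0 split: if_splits)
  also have "\<dots> = (\<Sum>k\<le>?n. coeff p k * gauss_moment (Suc k))"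
    by (simp only: sum.atMost_Suc_shift) simp
  also have "\<dots> = (\<Sum>k\<le>Suc ?n. coeff p k * gauss_moment (Suc k))"
    by (simp add: coeff_eq_0)
  also have "\<dots> = (\<Sum>k\<le>?n. coeff p (Suc k) * gauss_moment (Suc (Suc k)))"
    by (simp only: sum.atMost_Suc_shift) (simp add: gauss_moment_1)
  also have "\<dots> = (\<Sum>k\<le>?n. coeff (pderiv p) k * gauss_moment k) / 2"
    unfolding sum_divide_distrib by (intro sum.cong) (simp_all add: gauss_moment_rec coeff_pderiv field_simps)
  also have "(\<Sum>k\<le>?n. coeff (pderiv p) k * gauss_moment k) = (\<Sum>k\<le>degree (pderiv p). coeff (pderiv p) k * gauss_moment k)"
    by (rule sum.mono_neutral_right) (auto simp: degree_pderiv coeff_eq_0)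
  finally show ?thesis unfolding integral_gauss_poly[of "pderiv p"] .
qed

section \<open>Mixed moments of a complex Gaussian variable\<close>

abbreviation gauss2 :: "(real \<times> real) measure" where "gauss2 \<equiv> gauss_measure \<Otimes>\<^sub>M gauss_measure"

interpretation gauss: prob_space gauss_measure by (rule prob_space_gauss)
interpretation gauss2: pair_prob_space gauss_measure gauss_measure ..

text \<open>The bound is a product of functions of one variable, so Fubini reduces integrability to
  moments on the line.\<close>

lemma integrable_gauss2_poly_bound:
  assumes [measurable]: "f \<in> borel_measurable (borel \<Otimes>\<^sub>M borel)"
    and "\<And>x y. cmod (f (x, y)) \<le> (1 + x\<^sup>2) ^ k * (1 + y\<^sup>2) ^ k"
  shows "integrable gauss2 f"
proof -
  have 1: "integrable gauss_measure (\<lambda>x. (1 + x\<^sup>2) ^ k)"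
  proof -
    have "integrable gauss_measure (\<lambda>x. Re (poly ([:1, 0, 1:] ^ k) (complex_of_real x)))"
      by (rule integrable_Re[OF integrable_gauss_poly])
    also have "(\<lambda>x. Re (poly ([:1, 0, 1:] ^ k) (complex_of_real x))) = (\<lambda>x. (1 + x\<^sup>2) ^ k)"
    proof
      fix x :: real
      have "poly ([:1, 0, 1:] ^ k) (complex_of_real x) = of_real ((1 + x\<^sup>2) ^ k)"
        by (simp add: poly_power power2_eq_square)
      then show "Re (poly ([:1, 0, 1:] ^ k) (complex_of_real x)) = (1 + x\<^sup>2) ^ k" by (simp only: Re_complex_of_real)
    qed
    finally show ?thesis .
  qed
  have "integrable gauss2 (\<lambda>(x, y). (1 + x\<^sup>2) ^ k * (1 + y\<^sup>2) ^ k)"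
  proof (rule gauss2.Fubini_integrable)
    show "(\<lambda>(x, y). (1 + x\<^sup>2) ^ k * (1 + y\<^sup>2) ^ k) \<in> borel_measurable gauss2" by measurable
  qed (use 1 in auto)
  then show ?thesis
    by (rule Bochner_Integration.integrable_bound) (use assms(2) in \<open>auto intro!: AE_I2 order.trans[OF assms(2)]\<close>)
qed

definition cgauss_moment :: "nat \<Rightarrow> nat \<Rightarrow> complex" where
  "cgauss_moment m n = (\<integral>(x, y). (Complex x y) ^ m * cnj (Complex x y) ^ n \<partial>gauss2)"

lemma integrable_cgauss:
  "integrable gauss2 (\<lambda>(x, y). (Complex x y) ^ m * cnj (Complex x y) ^ n)"
  "integrable gauss2 (\<lambda>(x, y). of_real x * ((Complex x y) ^ m * cnj (Complex x y) ^ n))"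
  "integrable gauss2 (\<lambda>(x, y). of_real y * ((Complex x y) ^ m * cnj (Complex x y) ^ n))"
proof -
  have c [measurable]: "(\<lambda>(x, y). Complex x y) \<in> borel_measurable (borel \<Otimes>\<^sub>M borel)"
    unfolding borel_prod Complex_eq split_beta'
    by (intro borel_measurable_continuous_onI continuous_intros)
  have b: "cmod (Complex x y) \<le> (1 + x\<^sup>2) * (1 + y\<^sup>2)" for x y
  proof -
    have "1 \<le> (1 + x\<^sup>2) * (1 + y\<^sup>2)" by (simp add: algebra_simps)
    moreover have "x\<^sup>2 + y\<^sup>2 \<le> (1 + x\<^sup>2) * (1 + y\<^sup>2)" by (simp add: algebra_simps)
    ultimately have "x\<^sup>2 + y\<^sup>2 \<le> ((1 + x\<^sup>2) * (1 + y\<^sup>2))\<^sup>2"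
      by (smt (verit, best) power2_eq_square mult_left_mono mult_cancel_left1)
    then show ?thesis unfolding cmod_def by (intro real_le_lsqrt) auto
  qed
  have 1: "1 \<le> (1 + x\<^sup>2) * (1 + y\<^sup>2)" for x y :: real by (simp add: algebra_simps)
  have bp: "cmod (Complex x y) ^ l \<le> ((1 + x\<^sup>2) * (1 + y\<^sup>2)) ^ l" for x y l
    by (rule power_mono[OF b]) simp
  have e: "cmod (Complex x y ^ m * cnj (Complex x y) ^ n) = cmod (Complex x y) ^ (m + n)" for x y
    by (simp add: norm_mult norm_power power_add)
  have le: "cmod (Complex x y ^ m * cnj (Complex x y) ^ n) \<le> (1 + x\<^sup>2) ^ (m + n) * (1 + y\<^sup>2) ^ (m + n)" for x y
    unfolding e using bp[of x y "m + n"] by (simp only: power_mult_distrib)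
  show "integrable gauss2 (\<lambda>(x, y). (Complex x y) ^ m * cnj (Complex x y) ^ n)"
    by (rule integrable_gauss2_poly_bound[of _ "m + n"]) (unfold borel_prod Complex_eq split_beta',
      intro borel_measurable_continuous_onI continuous_intros, use le in \<open>simp add: Complex_eq\<close>)
  have le2: "cmod (of_real u * (Complex x y ^ m * cnj (Complex x y) ^ n)) \<le> (1 + x\<^sup>2) ^ (Suc (m + n)) * (1 + y\<^sup>2) ^ (Suc (m + n))"
    if "\<bar>u\<bar> \<le> cmod (Complex x y)" for x y u
  proof -
    have "cmod (of_real u * (Complex x y ^ m * cnj (Complex x y) ^ n)) = \<bar>u\<bar> * cmod (Complex x y) ^ (m + n)"
      unfolding norm_mult[of "of_real u"] e by simp
    also have "\<dots> \<le> cmod (Complex x y) ^ Suc (m + n)" using that by (simp add: mult_right_mono)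
    also have "\<dots> \<le> (1 + x\<^sup>2) ^ (Suc (m + n)) * (1 + y\<^sup>2) ^ (Suc (m + n))"
      using bp[of x y "Suc (m + n)"] by (simp only: power_mult_distrib)
    finally show ?thesis .
  qed
  have re: "\<bar>x\<bar> \<le> cmod (Complex x y)" "\<bar>y\<bar> \<le> cmod (Complex x y)" for x y
    using abs_Re_le_cmod[of "Complex x y"] abs_Im_le_cmod[of "Complex x y"] by auto
  show "integrable gauss2 (\<lambda>(x, y). of_real x * ((Complex x y) ^ m * cnj (Complex x y) ^ n))"
    by (rule integrable_gauss2_poly_bound[of _ "Suc (m + n)"]) (unfold borel_prod Complex_eq split_beta',
      intro borel_measurable_continuous_onI continuous_intros, unfold Complex_eq[symmetric], simp only: fst_conv snd_conv le2 re)
  show "integrable gauss2 (\<lambda>(x, y). of_real y * ((Complex x y) ^ m * cnj (Complex x y) ^ n))"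
    by (rule integrable_gauss2_poly_bound[of _ "Suc (m + n)"]) (unfold borel_prod Complex_eq split_beta',
      intro borel_measurable_continuous_onI continuous_intros, unfold Complex_eq[symmetric], simp only: fst_conv snd_conv le2 re)
qed

text \<open>Write z = x + iy. With one coordinate fixed, z and its conjugate are linear polynomials
  in the other, so Stein's identity applies to each part. The x part gives (a + b)/2 and the iy part
  (b - a)/2, where a comes from differentiating z and b from differentiating its conjugate; only b
  survives.\<close>

lemma cgauss_moment_rec: "cgauss_moment (Suc m) n = of_nat n * cgauss_moment m (n - 1)"
proof -
  define F where "F m n = (\<lambda>x y. Complex x y ^ m * cnj (Complex x y) ^ n)" for m n
  have J: "cgauss_moment m n = (\<integral>(x, y). F m n x y \<partial>gauss2)" for m n
    unfolding cgauss_moment_def F_def ..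
  have int: "integrable gauss2 (\<lambda>z. F m n (fst z) (snd z))" "integrable gauss2 (\<lambda>z. of_real (fst z) * F m n (fst z) (snd z))"
    "integrable gauss2 (\<lambda>z. of_real (snd z) * F m n (fst z) (snd z))" for m n
    using integrable_cgauss[of m n] unfolding F_def split_beta' by simp_all
  let ?a = "of_nat m * cgauss_moment (m - 1) n" and ?b = "of_nat n * cgauss_moment m (n - 1)"
  have X: "(\<integral>(x, y). of_real x * F m n x y \<partial>gauss2) = (?a + ?b) / 2"
  proof -
    have p: "(\<integral>x. of_real x * F m n x y \<partial>gauss_measure) =
      (\<integral>x. of_nat m * F (m - 1) n x y + of_nat n * F m (n - 1) x y \<partial>gauss_measure) / 2" for y
    proof -
      let ?p = "[:\<i> * of_real y, 1:] ^ m * [:- \<i> * of_real y, 1:] ^ n"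
      have "F m n x y = poly ?p (of_real x)" for x
        unfolding F_def by (simp add: poly_power Complex_eq algebra_simps)
      moreover have "poly (pderiv ?p) (of_real x) = of_nat m * F (m - 1) n x y + of_nat n * F m (n - 1) x y" for x
        unfolding F_def pderiv_mult pderiv_power by (simp add: poly_power pderiv_pCons Complex_eq algebra_simps)
      ultimately show ?thesis using gauss_stein[of ?p] by simp
    qed
    have "(\<integral>(x, y). of_real x * F m n x y \<partial>gauss2) = (\<integral>y. \<integral>x. of_real x * F m n x y \<partial>gauss_measure \<partial>gauss_measure)"
      by (rule gauss2.integral_snd[symmetric]) (use int(2)[of m n] in \<open>simp add: split_beta'\<close>)
    also have "\<dots> = (\<integral>y. (\<integral>x. of_nat m * F (m - 1) n x y + of_nat n * F m (n - 1) x y \<partial>gauss_measure) \<partial>gauss_measure) / 2"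
      unfolding p by simp
    also have "\<dots> = (\<integral>(x, y). of_nat m * F (m - 1) n x y + of_nat n * F m (n - 1) x y \<partial>gauss2) / 2"
      using int(1)[of "m - 1" n] int(1)[of m "n - 1"]
      by (subst gauss2.integral_snd) (simp_all add: split_beta')
    also have "\<dots> = (?a + ?b) / 2"
      unfolding J using int(1)[of "m - 1" n] int(1)[of m "n - 1"] by (simp add: split_beta')
    finally show ?thesis .
  qed
  have Y: "(\<integral>(x, y). of_real y * F m n x y \<partial>gauss2) = \<i> * (?a - ?b) / 2"
  proof -
    have p: "(\<integral>y. of_real y * F m n x y \<partial>gauss_measure) =
      (\<integral>y. \<i> * (of_nat m * F (m - 1) n x y - of_nat n * F m (n - 1) x y) \<partial>gauss_measure) / 2" for x
    proof -
      let ?p = "[:of_real x, \<i>:] ^ m * [:of_real x, - \<i>:] ^ n"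
      have "F m n x y = poly ?p (of_real y)" for y
        unfolding F_def by (simp add: poly_power Complex_eq algebra_simps)
      moreover have "poly (pderiv ?p) (of_real y) = \<i> * (of_nat m * F (m - 1) n x y - of_nat n * F m (n - 1) x y)" for y
        unfolding F_def pderiv_mult pderiv_power by (simp add: poly_power pderiv_pCons Complex_eq algebra_simps)
      ultimately show ?thesis using gauss_stein[of ?p] by simp
    qed
    have "(\<integral>(x, y). of_real y * F m n x y \<partial>gauss2) = (\<integral>x. \<integral>y. of_real y * F m n x y \<partial>gauss_measure \<partial>gauss_measure)"
      by (rule gauss2.integral_fst[symmetric]) (use int(3)[of m n] in \<open>simp add: split_beta'\<close>)
    also have "\<dots> = (\<integral>x. (\<integral>y. \<i> * (of_nat m * F (m - 1) n x y - of_nat n * F m (n - 1) x y) \<partial>gauss_measure) \<partial>gauss_measure) / 2"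
      unfolding p by simp
    also have "\<dots> = (\<integral>(x, y). \<i> * (of_nat m * F (m - 1) n x y - of_nat n * F m (n - 1) x y) \<partial>gauss2) / 2"
      using int(1)[of "m - 1" n] int(1)[of m "n - 1"]
      by (subst gauss2.integral_fst) (simp_all add: split_beta')
    also have "\<dots> = \<i> * (?a - ?b) / 2"
      unfolding J using int(1)[of "m - 1" n] int(1)[of m "n - 1"] by (simp add: split_beta')
    finally show ?thesis .
  qed
  have "F (Suc m) n x y = of_real x * F m n x y + \<i> * (of_real y * F m n x y)" for x y
    unfolding F_def by (simp add: Complex_eq algebra_simps)
  then have "cgauss_moment (Suc m) n = (\<integral>(x, y). of_real x * F m n x y + \<i> * (of_real y * F m n x y) \<partial>gauss2)"
    unfolding J split_beta' by (simp only:)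
  also have "\<dots> = (\<integral>(x, y). of_real x * F m n x y \<partial>gauss2) + \<i> * (\<integral>(x, y). of_real y * F m n x y \<partial>gauss2)"
    using int(2,3)[of m n] by (simp add: split_beta')
  also have "\<dots> = ?b" unfolding X Y by (simp add: field_simps)
  finally show ?thesis .
qed

lemma cgauss_moment_eq: "cgauss_moment m n = (if m = n then fact n else 0)"
proof (induction m arbitrary: n)
  case 0
  \<comment> \<open>The recursion can only be entered through the first exponent, so the roles are
    exchanged by conjugation.\<close>
  have cnj: "cgauss_moment 0 n = cnj (cgauss_moment n 0)" for n
    unfolding cgauss_moment_def by (subst Bochner_Integration.integral_cnj[symmetric]) (simp add: split_beta')
  have "cgauss_moment 0 0 = 1" unfolding cgauss_moment_def by (simp add: split_beta' gauss2.prob_space)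
  moreover have "cgauss_moment 0 (Suc k) = 0" for k using cnj[of "Suc k"] cgauss_moment_rec[of k 0] by simp
  ultimately show ?case by (cases n) auto
next
  case (Suc m)
  then show ?case using cgauss_moment_rec[of m n] by (cases n) auto
qed

section \<open>The law of a standard complex Gaussian variable\<close>

lemma lborel_complex: "(lborel :: complex measure) = distr (lborel \<Otimes>\<^sub>M lborel) borel (\<lambda>(x, y). Complex x y)"
proof (rule lborel_eqI)
  have c: "(\<lambda>(x, y). Complex x y) \<in> borel_measurable (lborel \<Otimes>\<^sub>M lborel)"
    unfolding lborel_prod Complex_eq split_beta'
    by (simp, intro borel_measurable_continuous_onI continuous_intros)
  fix l u :: complex assume le: "\<And>b. b \<in> Basis \<Longrightarrow> l \<bullet> b \<le> u \<bullet> b"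
  have le': "Re l \<le> Re u" "Im l \<le> Im u" using le[of 1] le[of \<i>] by (auto simp: Basis_complex_def)
  have pre: "(\<lambda>(x, y). Complex x y) -` box l u \<inter> space (lborel \<Otimes>\<^sub>M lborel) = {Re l<..<Re u} \<times> {Im l<..<Im u}"
    by (auto simp: box_def Basis_complex_def space_pair_measure)
  have "emeasure (distr (lborel \<Otimes>\<^sub>M lborel) borel (\<lambda>(x, y). Complex x y)) (box l u) =
      emeasure (lborel \<Otimes>\<^sub>M lborel) ({Re l<..<Re u} \<times> {Im l<..<Im u})"
    by (subst emeasure_distr[OF c]) (simp_all only: pre, simp)
  also have "\<dots> = ennreal (Re u - Re l) * ennreal (Im u - Im l)"
    using le' by (subst lborel.emeasure_pair_measure_Times) auto
  also have "\<dots> = ennreal (\<Prod>b\<in>Basis. (u - l) \<bullet> b)"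
    using le' by (simp add: Basis_complex_def ennreal_mult)
  finally show "emeasure (distr (lborel \<Otimes>\<^sub>M lborel) borel (\<lambda>(x, y). Complex x y)) (box l u) = ennreal (\<Prod>b\<in>Basis. (u - l) \<bullet> b)" .
qed simp

lemma density_complex_gauss:
  "density lborel (\<lambda>z. ennreal (1 / pi * exp (- (cmod z)\<^sup>2))) = distr gauss2 borel (\<lambda>(x, y). Complex x y)"
proof -
  let ?n = "normal_density 0 (1 / sqrt 2)"
  have c [measurable]: "(\<lambda>(x, y). Complex x y) \<in> borel_measurable (lborel \<Otimes>\<^sub>M lborel)"
    unfolding lborel_prod Complex_eq split_beta'
    by (simp, intro borel_measurable_continuous_onI continuous_intros)
  have n: "?n x = exp (- x\<^sup>2) / sqrt pi" for x unfolding normal_density_def by (simp add: power_divide)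
  have "gauss2 = density (lborel \<Otimes>\<^sub>M lborel) (\<lambda>(x, y). ennreal (?n x) * ennreal (?n y))"
    unfolding gauss_measure_def
    by (rule pair_measure_density)
      (simp_all add: gauss_measure_def[symmetric] prob_space_imp_sigma_finite prob_space_gauss lborel.sigma_finite_measure_axioms)
  also have "(\<lambda>(x, y). ennreal (?n x) * ennreal (?n y)) = (\<lambda>z. ennreal (1 / pi * exp (- (cmod z)\<^sup>2))) \<circ> (\<lambda>(x, y). Complex x y)"
    by (auto simp: fun_eq_iff n cmod_power2 ennreal_mult[symmetric] exp_minus exp_add field_simps exp_diff)
  finally have g: "gauss2 = density (lborel \<Otimes>\<^sub>M lborel) ((\<lambda>z. ennreal (1 / pi * exp (- (cmod z)\<^sup>2))) \<circ> (\<lambda>(x, y). Complex x y))" .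
  show ?thesis unfolding g
    by (subst lborel_complex) (subst density_distr, auto simp: comp_def)
qed

lemma (in prob_space) standard_complex_gaussian_moment:
  assumes "standard_complex_gaussian M Z"
  shows "integrable M (\<lambda>\<omega>. Z \<omega> ^ m * cnj (Z \<omega>) ^ n)"
    and "expectation (\<lambda>\<omega>. Z \<omega> ^ m * cnj (Z \<omega>) ^ n) = (if m = n then fact n else 0)"
    and "random_variable borel Z"
proof -
  have Z: "Z \<in> measurable M lborel" and d: "distr M lborel Z = density lborel (\<lambda>z. ennreal (1 / pi * exp (- (cmod z)\<^sup>2)))"
    using assms unfolding standard_complex_gaussian_def distributed_def by auto
  show Zb [measurable]: "random_variable borel Z" using Z by simp
  have D: "distr M borel Z = distr gauss2 borel (\<lambda>(x, y). Complex x y)"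
    using d density_complex_gauss by (metis distr_cong sets_lborel)
  have c [measurable]: "(\<lambda>(x, y). Complex x y) \<in> borel_measurable gauss2"
    using borel_measurable_continuous_onI[of "\<lambda>p. Complex (fst p) (snd p)"]
    by (subst measurable_cong_sets[OF sets_pair_measure_cong[OF sets_gauss sets_gauss] refl])
      (auto simp: borel_prod Complex_eq split_beta' intro!: borel_measurable_continuous_onI continuous_intros)
  let ?f = "\<lambda>z. z ^ m * cnj z ^ n"
  have f [measurable]: "?f \<in> borel_measurable borel" by (intro borel_measurable_continuous_onI continuous_intros)
  have "integrable (distr gauss2 borel (\<lambda>(x, y). Complex x y)) ?f"
    using integrable_cgauss(1)[of m n] by (subst integrable_distr_eq) (auto simp: split_beta')
  then show "integrable M (\<lambda>\<omega>. Z \<omega> ^ m * cnj (Z \<omega>) ^ n)"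
    unfolding D[symmetric] by (subst (asm) integrable_distr_eq) auto
  have "expectation (\<lambda>\<omega>. ?f (Z \<omega>)) = integral\<^sup>L (distr gauss2 borel (\<lambda>(x, y). Complex x y)) ?f"
    unfolding D[symmetric] by (rule integral_distr[symmetric]) auto
  also have "\<dots> = cgauss_moment m n"
    unfolding cgauss_moment_def by (subst integral_distr) (auto simp: split_beta')
  finally show "expectation (\<lambda>\<omega>. Z \<omega> ^ m * cnj (Z \<omega>) ^ n) = (if m = n then fact n else 0)"
    by (simp add: cgauss_moment_eq)
qed

text \<open>Such a bijection is a choice of bijections between the classes of equal label, so each
  label contributes a factorial, or zero if the class sizes differ. These factors are the mixed
  moments of a complex Gaussian. Two separate sets are used because the induction removes k0 from
  one and its image from the other.\<close>

lemma card_labelled_bijections: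
  fixes T :: "'a \<Rightarrow> 'i" and T' :: "'b \<Rightarrow> 'i"
  assumes "finite K'" "finite K" "finite I" "T ` K \<subseteq> I" "T' ` K' \<subseteq> I"
  shows "card {g \<in> K' \<rightarrow>\<^sub>E K. bij_betw g K' K \<and> (\<forall>k\<in>K'. T (g k) = T' k)} =
    (\<Prod>i\<in>I. if card {k \<in> K. T k = i} = card {k \<in> K'. T' k = i} then fact (card {k \<in> K. T k = i}) else 0)"
  using assms
proof (induction K' arbitrary: K rule: finite_induct)
  case empty
  show ?case
  proof (cases "K = {}")
    case True
    then have "{g \<in> {} \<rightarrow>\<^sub>E K. bij_betw g {} K \<and> (\<forall>k\<in>{}. T (g k) = T' k)} = {\<lambda>_. undefined}"
      by (auto simp: bij_betw_def)
    then show ?thesis using True by simp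
  next
    case False
    then obtain k where k: "k \<in> K" "T k \<in> I" using empty by auto
    then have "card {k' \<in> K. T k' = T k} \<noteq> 0" using empty by auto
    moreover have "{g \<in> {} \<rightarrow>\<^sub>E K. bij_betw g {} K \<and> (\<forall>k\<in>{}. T (g k) = T' k)} = {}"
      using False by (auto simp: bij_betw_def)
    moreover have "(\<Prod>i\<in>I. if card {k \<in> K. T k = i} = card {k \<in> {}. T' k = i} then fact (card {k \<in> K. T k = i}) else 0 :: nat) = 0"
      by (rule prod_zero[OF empty(2)], rule bexI[OF _ k(2)]) (use calculation(1) in simp)
    ultimately show ?thesis by (simp only: card.empty)
  qed
next
  case (insert k0 K')
  define B where "B K' K = {g \<in> K' \<rightarrow>\<^sub>E K. bij_betw g K' K \<and> (\<forall>k\<in>K'. T (g k) = T' k)}" for K' K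
  define i0 where "i0 = T' k0"
  define J where "J = {j \<in> K. T j = i0}"
  have k0: "k0 \<notin> K'" using insert by simp
  have finJ: "finite J" using insert by (simp add: J_def)
  have finB: "finite (B K' (K - {j}))" for j
    unfolding B_def using insert by (intro finite_subset[OF _ finite_PiE[of K' "\<lambda>_. K - {j}"]]) auto
  have decomp: "B (insert k0 K') K = (\<Union>j\<in>J. (\<lambda>g. g(k0 := j)) ` B K' (K - {j}))"
  proof (intro equalityI subsetI)
    fix g assume g: "g \<in> B (insert k0 K') K"
    then have bij: "bij_betw g (insert k0 K') K" and lab: "\<And>k. k \<in> insert k0 K' \<Longrightarrow> T (g k) = T' k"
      and ext: "g \<in> insert k0 K' \<rightarrow>\<^sub>E K" by (auto simp: B_def)
    let ?j = "g k0"
    have j: "?j \<in> J" using bij lab unfolding J_def i0_def by (auto simp: bij_betw_def)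
    have Ke: "K = (K - {?j}) \<union> {?j}" using j unfolding J_def by auto
    have "bij_betw g (K' \<union> {k0}) ((K - {?j}) \<union> {?j})" using bij Ke by simp
    then have "bij_betw g K' (K - {?j})" using notIn_Un_bij_betw3[of k0 K' g "K - {?j}"] k0 by simp
    then have "bij_betw (g(k0 := undefined)) K' (K - {?j})"
      by (rule bij_betw_cong[THEN iffD1, rotated]) (use k0 in auto)
    then have "g(k0 := undefined) \<in> B K' (K - {?j})"
      unfolding B_def using lab k0 ext by (auto simp: bij_betw_def PiE_iff extensional_def)
    moreover have "g = (g(k0 := undefined))(k0 := ?j)" by simp
    ultimately show "g \<in> (\<Union>j\<in>J. (\<lambda>g. g(k0 := j)) ` B K' (K - {j}))" using j by blast
  next
    fix g assume "g \<in> (\<Union>j\<in>J. (\<lambda>g. g(k0 := j)) ` B K' (K - {j}))"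
    then obtain j h where j: "j \<in> J" and h: "h \<in> B K' (K - {j})" and g: "g = h(k0 := j)" by auto
    have "bij_betw h K' (K - {j})" using h by (simp add: B_def)
    then have "bij_betw g K' (K - {j})"
      by (rule bij_betw_cong[THEN iffD1, rotated]) (use k0 g in auto)
    then have "bij_betw g (K' \<union> {k0}) ((K - {j}) \<union> {j})"
      using notIn_Un_bij_betw3[of k0 K' g "K - {j}"] k0 g by simp
    moreover have "(K - {j}) \<union> {j} = K" using j by (auto simp: J_def)
    ultimately have "bij_betw g (insert k0 K') K" by simp
    then show "g \<in> B (insert k0 K') K"
      using h j g k0 unfolding B_def J_def i0_def by (auto simp: PiE_iff extensional_def)
  qed
  have disj: "(\<lambda>g. g(k0 := j)) ` B K' (K - {j}) \<inter> (\<lambda>g. g(k0 := j')) ` B K' (K - {j'}) = {}" if "j \<noteq> j'" for j j'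
    using that by (auto dest: fun_cong[of _ _ k0])
  have inj: "inj_on (\<lambda>g. g(k0 := j)) (B K' (K - {j}))" for j
  proof (rule inj_onI)
    fix g h assume g: "g \<in> B K' (K - {j})" and h: "h \<in> B K' (K - {j})" and e: "g(k0 := j) = h(k0 := j)"
    have "g k0 = undefined" "h k0 = undefined" using g h k0 by (auto simp: B_def PiE_iff extensional_def)
    then show "g = h" using e by (metis fun_upd_triv fun_upd_upd)
  qed
  have "card (B (insert k0 K') K) = (\<Sum>j\<in>J. card (B K' (K - {j})))"
    unfolding decomp by (subst card_UN_disjoint) (use finJ finB disj inj in \<open>auto simp: card_image\<close>)
  define m n where "m K i = card {k \<in> K. T k = i}" and "n K' i = card {k \<in> K'. T' k = i}" for K K' i
  define h where "h K' K i = (if m K i = n K' i then fact (m K i) else 0 :: nat)" for K' K i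
  have IH: "card (B K' (K - {j})) = (\<Prod>i\<in>I. h K' (K - {j}) i)" for j
    unfolding B_def h_def m_def n_def by (rule insert.IH) (use insert in auto)
  have i0: "i0 \<in> I" using insert unfolding i0_def by auto
  define R where "R = (\<Prod>i\<in>I - {i0}. h (insert k0 K') K i)"
  have n0: "n (insert k0 K') i0 = Suc (n K' i0)"
  proof -
    have "{k \<in> insert k0 K'. T' k = i0} = insert k0 {k \<in> K'. T' k = i0}" unfolding i0_def by auto
    then show ?thesis unfolding n_def using insert by simp
  qed
  have n1: "n (insert k0 K') i = n K' i" if "i \<noteq> i0" for i
    unfolding n_def using that i0_def by (intro arg_cong[where f=card]) auto
  have m0: "m K i0 = card J" unfolding m_def J_def ..
  have part: "(\<Prod>i\<in>I. h K' (K - {j}) i) = (if card J = Suc (n K' i0) then fact (card J - 1) else 0) * R" if j: "j \<in> J" for j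
  proof -
    have "{k \<in> K - {j}. T k = i0} = J - {j}" by (auto simp: J_def)
    then have a: "m (K - {j}) i0 = card J - 1" unfolding m_def using j finJ by simp
    have "card J \<noteq> 0" using j finJ by auto
    then have b: "h K' (K - {j}) i0 = (if card J = Suc (n K' i0) then fact (card J - 1) else 0)"
      unfolding h_def a by auto
    have "h K' (K - {j}) i = h (insert k0 K') K i" if "i \<noteq> i0" for i
    proof -
      have "{k \<in> K - {j}. T k = i} = {k \<in> K. T k = i}" using j that by (auto simp: J_def)
      then have "m (K - {j}) i = m K i" unfolding m_def by simp
      then show ?thesis unfolding h_def n1[OF that] by simp
    qed
    then have "(\<Prod>i\<in>I - {i0}. h K' (K - {j}) i) = R" unfolding R_def by (intro prod.cong) auto
    then show ?thesis using prod.remove[OF insert.prems(2) i0, of "h K' (K - {j})"] b by simp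
  qed
  have "(\<Sum>j\<in>J. card (B K' (K - {j}))) = (\<Sum>j\<in>J. (if card J = Suc (n K' i0) then fact (card J - 1) else 0) * R)"
    by (intro sum.cong refl) (simp only: IH part)
  also have "\<dots> = h (insert k0 K') K i0 * R"
    unfolding h_def m0 n0 by (cases "card J") (auto simp: distrib_right)
  also have "\<dots> = (\<Prod>i\<in>I. h (insert k0 K') K i)"
    unfolding R_def using prod.remove[OF insert.prems(2) i0, of "h (insert k0 K') K"] by simp
  finally show ?case
    using \<open>card (B (insert k0 K') K) = _\<close> unfolding B_def h_def m_def n_def by simp
qed

lemma card_labelled_permutations:
  fixes T T' :: "'k \<Rightarrow> 'i"
  assumes "finite K" "finite I" "T ` K \<subseteq> I" "T' ` K \<subseteq> I"
  shows "card {\<alpha>. \<alpha> permutes K \<and> (\<forall>k\<in>K. T (\<alpha> k) = T' k)} =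
    (\<Prod>i\<in>I. if card {k \<in> K. T k = i} = card {k \<in> K. T' k = i} then fact (card {k \<in> K. T k = i}) else 0)"
proof -
  let ?P = "{\<alpha>. \<alpha> permutes K \<and> (\<forall>k\<in>K. T (\<alpha> k) = T' k)}"
  let ?B = "{g \<in> K \<rightarrow>\<^sub>E K. bij_betw g K K \<and> (\<forall>k\<in>K. T (g k) = T' k)}"
  have "bij_betw (\<lambda>\<alpha>. restrict \<alpha> K) ?P ?B"
  proof (rule bij_betw_byWitness[where f' = "\<lambda>g x. if x \<in> K then g x else x"])
    show "\<forall>\<alpha>\<in>?P. (\<lambda>x. if x \<in> K then restrict \<alpha> K x else x) = \<alpha>"
      by (auto simp: fun_eq_iff permutes_not_in)
    show "\<forall>g\<in>?B. restrict (\<lambda>x. if x \<in> K then g x else x) K = g"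
      by (auto simp: fun_eq_iff PiE_iff extensional_def)
    show "(\<lambda>\<alpha>. restrict \<alpha> K) ` ?P \<subseteq> ?B"
    proof (intro image_subsetI)
      fix \<alpha> assume \<alpha>: "\<alpha> \<in> ?P"
      then have "bij_betw \<alpha> K K" by (simp add: permutes_imp_bij)
      then have "bij_betw (restrict \<alpha> K) K K" by (rule bij_betw_cong[THEN iffD1, rotated]) simp
      then show "restrict \<alpha> K \<in> ?B" using \<alpha> permutes_in_image[of \<alpha> K] by auto
    qed
    show "(\<lambda>g x. if x \<in> K then g x else x) ` ?B \<subseteq> ?P"
    proof (intro image_subsetI)
      fix g assume g: "g \<in> ?B"
      then have "bij_betw g K K" by simp
      then have "bij_betw (\<lambda>x. if x \<in> K then g x else x) K K" by (rule bij_betw_cong[THEN iffD1, rotated]) simp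
      then have "(\<lambda>x. if x \<in> K then g x else x) permutes K" by (rule bij_imp_permutes) simp
      then show "(\<lambda>x. if x \<in> K then g x else x) \<in> ?P" using g by auto
    qed
  qed
  then have "card ?P = card ?B" by (rule bij_betw_same_card)
  then show ?thesis using card_labelled_bijections[OF assms(1,1,2,3,4)] by simp
qed

lemma prod_comp_eq_prod_power:
  fixes x :: "'i \<Rightarrow> 'c::comm_monoid_mult"
  assumes "finite K" "finite I" "T ` K \<subseteq> I"
  shows "(\<Prod>k\<in>K. x (T k)) = (\<Prod>i\<in>I. x i ^ card {k \<in> K. T k = i})"
proof -
  have "(\<Prod>k\<in>K. x (T k)) = (\<Prod>i\<in>I. \<Prod>k\<in>{k \<in> K. T k = i}. x (T k))"
    by (rule prod.group[symmetric]) (use assms in auto)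
  also have "\<dots> = (\<Prod>i\<in>I. x i ^ card {k \<in> K. T k = i})"
    by (intro prod.cong refl) (simp add: prod_constant)
  finally show ?thesis .
qed

text \<open>Grouping the factors by variable, independence gives a product of single moments. A
  variable occurring m times plain and n times conjugated contributes n! if m = n and 0 otherwise,
  and the product of these numbers counts the matchings \<alpha>.\<close>

theorem (in prob_space) gaussian_wick:
  fixes X :: "'i \<Rightarrow> 'a \<Rightarrow> complex" and T T' :: "'k \<Rightarrow> 'i"
  assumes indep: "indep_vars (\<lambda>_. borel) X I" and gauss: "\<And>i. i \<in> I \<Longrightarrow> standard_complex_gaussian M (X i)"
    and fin: "finite I" "finite K" and T: "T ` K \<subseteq> I" "T' ` K \<subseteq> I"
  shows "integrable M (\<lambda>\<omega>. \<Prod>k\<in>K. X (T k) \<omega> * cnj (X (T' k) \<omega>))"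
    and "expectation (\<lambda>\<omega>. \<Prod>k\<in>K. X (T k) \<omega> * cnj (X (T' k) \<omega>)) =
      of_nat (card {\<alpha>. \<alpha> permutes K \<and> (\<forall>k\<in>K. T (\<alpha> k) = T' k)})"
proof -
  define m n where "m i = card {k \<in> K. T k = i}" and "n i = card {k \<in> K. T' k = i}" for i
  define Y where "Y i \<omega> = X i \<omega> ^ m i * cnj (X i \<omega>) ^ n i" for i \<omega>
  have eq: "(\<lambda>\<omega>. \<Prod>k\<in>K. X (T k) \<omega> * cnj (X (T' k) \<omega>)) = (\<lambda>\<omega>. \<Prod>i\<in>I. Y i \<omega>)"
  proof
    fix \<omega>
    show "(\<Prod>k\<in>K. X (T k) \<omega> * cnj (X (T' k) \<omega>)) = (\<Prod>i\<in>I. Y i \<omega>)"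
      unfolding Y_def prod.distrib m_def n_def
      using prod_comp_eq_prod_power[OF fin(2,1) T(1), of "\<lambda>i. X i \<omega>"]
        prod_comp_eq_prod_power[OF fin(2,1) T(2), of "\<lambda>i. cnj (X i \<omega>)"] by simp
  qed
  have iY: "indep_vars (\<lambda>_. borel) Y I"
    unfolding Y_def
    by (rule indep_vars_compose2[OF indep, of "\<lambda>i z. z ^ m i * cnj z ^ n i"])
      (auto intro!: borel_measurable_continuous_onI continuous_intros)
  have intY: "integrable M (Y i)" if "i \<in> I" for i
    unfolding Y_def by (rule standard_complex_gaussian_moment(1)[OF gauss[OF that]])
  show "integrable M (\<lambda>\<omega>. \<Prod>k\<in>K. X (T k) \<omega> * cnj (X (T' k) \<omega>))"
    unfolding eq by (rule indep_vars_integrable[OF fin(1) iY intY])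
  have "expectation (\<lambda>\<omega>. \<Prod>i\<in>I. Y i \<omega>) = (\<Prod>i\<in>I. expectation (Y i))"
    by (rule indep_vars_lebesgue_integral[OF fin(1) iY intY])
  also have "\<dots> = (\<Prod>i\<in>I. if m i = n i then fact (m i) else 0)"
    unfolding Y_def by (intro prod.cong refl) (simp add: standard_complex_gaussian_moment(2)[OF gauss])
  also have "\<dots> = of_nat (\<Prod>i\<in>I. if m i = n i then fact (m i) else 0)"
    unfolding of_nat_prod by (intro prod.cong refl) simp
  also have "\<dots> = of_nat (card {\<alpha>. \<alpha> permutes K \<and> (\<forall>k\<in>K. T (\<alpha> k) = T' k)})"
    unfolding m_def n_def card_labelled_permutations[OF fin(2,1) T] ..
  finally show "expectation (\<lambda>\<omega>. \<Prod>k\<in>K. X (T k) \<omega> * cnj (X (T' k) \<omega>)) =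
      of_nat (card {\<alpha>. \<alpha> permutes K \<and> (\<forall>k\<in>K. T (\<alpha> k) = T' k)})" unfolding eq .
qed

section \<open>Traces of words of marginals\<close>

lemma sum_PiE_insert:
  assumes "finite K" "k0 \<notin> K" "\<And>k. k \<in> insert k0 K \<Longrightarrow> finite (B k)"
  shows "(\<Sum>r\<in>Pi\<^sub>E (insert k0 K) B. h r) = (\<Sum>y\<in>B k0. \<Sum>r\<in>Pi\<^sub>E K B. h (r(k0 := y)))"
proof -
  have "(\<Sum>r\<in>Pi\<^sub>E (insert k0 K) B. h r) = (\<Sum>z\<in>B k0 \<times> Pi\<^sub>E K B. h ((snd z)(k0 := fst z)))"
    unfolding PiE_insert_eq
    by (subst sum.reindex) (use inj_combinator[OF assms(2), of B] in \<open>auto simp: case_prod_unfold\<close>)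
  then show ?thesis by (simp add: sum.cartesian_product case_prod_unfold)
qed

lemma mat_word_carrier:
  assumes "\<And>l. A l \<in> carrier_mat n n" shows "mat_word n A w \<in> carrier_mat n n"
  unfolding mat_word_def by (induction w) (use assms in \<open>auto intro!: mult_carrier_mat\<close>)

lemma mat_word_Cons: "mat_word n A (l # w) = A l * mat_word n A w"
  by (simp add: mat_word_def)

text \<open>The sum over paths r. Since the word lists the positions downwards, the path starts at
  the column \<open>r 0\<close> and ends at the row \<open>r q\<close>. The endpoints are imposed by
  a condition so that the path can be extended by one step in the induction.\<close>

lemma mat_word_entry:
  assumes A: "\<And>l. A l \<in> carrier_mat n n" and ij: "i < n" "j < n"
  shows "mat_word n A (map f (rev [1..<Suc q])) $$ (i, j) =
    (\<Sum>r\<in>{0..q} \<rightarrow>\<^sub>E {..<n}. if r q = i \<and> r 0 = j then \<Prod>k\<in>{1..q}. A (f k) $$ (r k, r (k - 1)) else 0)"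
  using ij
proof (induction q arbitrary: i)
  case 0
  let ?h = "\<lambda>r :: nat \<Rightarrow> nat. if r 0 = i \<and> r 0 = j then 1 else (0::complex)"
  have "(\<Sum>r\<in>{0..0::nat} \<rightarrow>\<^sub>E {..<n}. if r 0 = i \<and> r 0 = j then \<Prod>k\<in>{1..0}. A (f k) $$ (r k, r (k - 1)) else 0) =
    (\<Sum>r\<in>insert (0::nat) {} \<rightarrow>\<^sub>E {..<n}. ?h r)"
    by (simp cong: if_cong)
  also have "\<dots> = (\<Sum>y<n. \<Sum>r\<in>{} \<rightarrow>\<^sub>E {..<n}. ?h (r(0 := y)))" by (rule sum_PiE_insert) auto
  also have "\<dots> = (\<Sum>y<n. if y = i then (if i = j then 1 else 0) else 0)"
    by (intro sum.cong refl) auto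
  also have "\<dots> = (if i = j then 1 else 0)" using 0 by simp
  finally have "(\<Sum>r\<in>{0..0::nat} \<rightarrow>\<^sub>E {..<n}. if r 0 = i \<and> r 0 = j then \<Prod>k\<in>{1..0}. A (f k) $$ (r k, r (k - 1)) else 0) =
    (if i = j then 1 else 0)" .
  then show ?case using 0 by (simp only:) (simp add: mat_word_def)
next
  case (Suc q)
  let ?W = "mat_word n A (map f (rev [1..<Suc q]))"
  let ?P = "\<lambda>q r. \<Prod>k\<in>{1..q}. A (f k) $$ (r k, r (k - 1))"
  have W: "?W \<in> carrier_mat n n" by (rule mat_word_carrier[OF A])
  have word: "map f (rev [1..<Suc (Suc q)]) = f (Suc q) # map f (rev [1..<Suc q])" by simp
  have "mat_word n A (map f (rev [1..<Suc (Suc q)])) $$ (i, j) = (A (f (Suc q)) * ?W) $$ (i, j)"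
    unfolding word mat_word_Cons ..
  also have "\<dots> = (\<Sum>k<n. A (f (Suc q)) $$ (i, k) * ?W $$ (k, j))"
    using A[of "f (Suc q)"] W Suc.prems by (simp add: scalar_prod_def atLeast0LessThan del: upt_Suc)
  also have "\<dots> = (\<Sum>k<n. A (f (Suc q)) $$ (i, k) * (\<Sum>r\<in>{0..q} \<rightarrow>\<^sub>E {..<n}. if r q = k \<and> r 0 = j then ?P q r else 0))"
  proof (rule sum.cong[OF refl])
    fix k assume "k \<in> {..<n}"
    then have "k < n" by simp
    from Suc.IH[OF this Suc.prems(2)] show "A (f (Suc q)) $$ (i, k) * ?W $$ (k, j) =
      A (f (Suc q)) $$ (i, k) * (\<Sum>r\<in>{0..q} \<rightarrow>\<^sub>E {..<n}. if r q = k \<and> r 0 = j then ?P q r else 0)"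
      by (simp only:)
  qed
  also have "\<dots> = (\<Sum>r\<in>{0..q} \<rightarrow>\<^sub>E {..<n}. \<Sum>k<n. if k = r q then (if r 0 = j then A (f (Suc q)) $$ (i, r q) * ?P q r else 0) else 0)"
    unfolding sum_distrib_left by (subst sum.swap) (intro sum.cong refl, auto)
  also have "\<dots> = (\<Sum>r\<in>{0..q} \<rightarrow>\<^sub>E {..<n}. if r 0 = j then A (f (Suc q)) $$ (i, r q) * ?P q r else 0)"
  proof (rule sum.cong[OF refl])
    fix r assume "r \<in> {0..q} \<rightarrow>\<^sub>E {..<n}"
    then have "r q < n" by auto
    then show "(\<Sum>k<n. if k = r q then (if r 0 = j then A (f (Suc q)) $$ (i, r q) * ?P q r else 0) else 0) =
      (if r 0 = j then A (f (Suc q)) $$ (i, r q) * ?P q r else 0)" by (simp only: sum.delta finite_lessThan lessThan_iff if_True)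
  qed
  also have "\<dots> = (\<Sum>r\<in>{0..q} \<rightarrow>\<^sub>E {..<n}. \<Sum>y<n. if y = i then (if r 0 = j then A (f (Suc q)) $$ (i, r q) * ?P q r else 0) else 0)"
    using Suc.prems by (simp only: sum.delta finite_lessThan lessThan_iff if_True)
  also have "\<dots> = (\<Sum>y<n. \<Sum>r\<in>{0..q} \<rightarrow>\<^sub>E {..<n}. if (r(Suc q := y)) (Suc q) = i \<and> (r(Suc q := y)) 0 = j then ?P (Suc q) (r(Suc q := y)) else 0)"
  proof (subst sum.swap, intro sum.cong refl)
    fix y and r :: "nat \<Rightarrow> nat"
    have e: "?P (Suc q) (r(Suc q := y)) = A (f (Suc q)) $$ (y, r q) * ?P q r"
    proof -
      have "?P (Suc q) (r(Suc q := y)) = (\<Prod>k\<in>{1..q}. A (f k) $$ ((r(Suc q := y)) k, (r(Suc q := y)) (k - 1))) * A (f (Suc q)) $$ (y, r q)"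
        by simp
      also have "(\<Prod>k\<in>{1..q}. A (f k) $$ ((r(Suc q := y)) k, (r(Suc q := y)) (k - 1))) = ?P q r"
        by (intro prod.cong refl) auto
      finally show ?thesis by simp
    qed
    show "(if y = i then (if r 0 = j then A (f (Suc q)) $$ (i, r q) * ?P q r else 0) else 0) =
      (if (r(Suc q := y)) (Suc q) = i \<and> (r(Suc q := y)) 0 = j then ?P (Suc q) (r(Suc q := y)) else 0)"
      unfolding e by simp
  qed
  also have "\<dots> = (\<Sum>r\<in>insert (Suc q) {0..q} \<rightarrow>\<^sub>E {..<n}. if r (Suc q) = i \<and> r 0 = j then ?P (Suc q) r else 0)"
    by (rule sum_PiE_insert[symmetric]) auto
  also have "insert (Suc q) {0..q} = {0..Suc q}" by auto
  finally show ?case .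
qed

text \<open>On {1..p} this inverts the long cycle \<gamma>.\<close>

definition cyc_prev :: "nat \<Rightarrow> nat \<Rightarrow> nat" where
  "cyc_prev p k = (if k = 1 then p else k - 1)"

lemma mat_trace_word:
  assumes A: "\<And>l. A l \<in> carrier_mat n n" and p: "1 \<le> p"
  shows "mat_trace (mat_word n A (map f (rev [1..<Suc p]))) =
    (\<Sum>r\<in>{1..p} \<rightarrow>\<^sub>E {..<n}. \<Prod>k\<in>{1..p}. A (f k) $$ (r k, r (cyc_prev p k)))"
proof -
  let ?P = "\<lambda>r. \<Prod>k\<in>{1..p}. A (f k) $$ (r k, r (k - 1))"
  have dim: "dim_row (mat_word n A (map f (rev [1..<Suc p]))) = n"
    by (rule carrier_matD(1)[OF mat_word_carrier[OF A]])
  have "mat_trace (mat_word n A (map f (rev [1..<Suc p]))) =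
      (\<Sum>i<n. \<Sum>r\<in>{0..p} \<rightarrow>\<^sub>E {..<n}. if r p = i \<and> r 0 = i then ?P r else 0)"
    unfolding mat_trace_def dim by (rule sum.cong[OF refl]) (simp only: lessThan_iff mat_word_entry[OF A])
  also have "\<dots> = (\<Sum>r\<in>{0..p} \<rightarrow>\<^sub>E {..<n}. \<Sum>i<n. if i = r p then (if r 0 = r p then ?P r else 0) else 0)"
    by (subst sum.swap) (intro sum.cong refl, auto)
  also have "\<dots> = (\<Sum>r\<in>{0..p} \<rightarrow>\<^sub>E {..<n}. if r 0 = r p then ?P r else 0)"
  proof (rule sum.cong[OF refl])
    fix r assume "r \<in> {0..p} \<rightarrow>\<^sub>E {..<n}"
    then have "r p < n" by auto
    then show "(\<Sum>i<n. if i = r p then (if r 0 = r p then ?P r else 0) else 0) = (if r 0 = r p then ?P r else 0)"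
      by (simp only: sum.delta finite_lessThan lessThan_iff if_True)
  qed
  also have "{0..p} = insert 0 {1..p}" by auto
  also have "(\<Sum>r\<in>insert 0 {1..p} \<rightarrow>\<^sub>E {..<n}. if r 0 = r p then ?P r else 0) =
    (\<Sum>y<n. \<Sum>r\<in>{1..p} \<rightarrow>\<^sub>E {..<n}. if (r(0 := y)) 0 = (r(0 := y)) p then ?P (r(0 := y)) else 0)"
    by (rule sum_PiE_insert) auto
  also have "\<dots> = (\<Sum>r\<in>{1..p} \<rightarrow>\<^sub>E {..<n}. \<Sum>y<n. if y = r p then ?P (r(0 := r p)) else 0)"
    by (subst sum.swap) (use p in \<open>intro sum.cong refl, auto\<close>)
  also have "\<dots> = (\<Sum>r\<in>{1..p} \<rightarrow>\<^sub>E {..<n}. \<Prod>k\<in>{1..p}. A (f k) $$ (r k, r (cyc_prev p k)))"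
  proof (rule sum.cong[OF refl])
    fix r :: "nat \<Rightarrow> nat" assume "r \<in> {1..p} \<rightarrow>\<^sub>E {..<n}"
    then have "r p < n" using p by auto
    then have "(\<Sum>y<n. if y = r p then ?P (r(0 := r p)) else 0) = ?P (r(0 := r p))"
      by (simp only: sum.delta finite_lessThan lessThan_iff if_True)
    also have "\<dots> = (\<Prod>k\<in>{1..p}. A (f k) $$ (r k, r (cyc_prev p k)))"
      by (intro prod.cong refl) (auto simp: cyc_prev_def)
    finally show "(\<Sum>y<n. if y = r p then ?P (r(0 := r p)) else 0) = (\<Prod>k\<in>{1..p}. A (f k) $$ (r k, r (cyc_prev p k)))" .
  qed
  finally show ?thesis .
qed

text \<open>Of the factors B and C, a marginal retains one beside A and traces out the other
  together with D; these are the indices of the two.\<close>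

fun kept :: "marginal \<Rightarrow> nat \<times> nat \<times> nat \<times> nat \<Rightarrow> nat" where
  "kept AB (a, b, c, d) = b" | "kept AC (a, b, c, d) = c"

fun traced :: "marginal \<Rightarrow> nat \<times> nat \<times> nat \<times> nat \<Rightarrow> nat" where
  "traced AB (a, b, c, d) = c" | "traced AC (a, b, c, d) = b"

fun tensor_index :: "marginal \<Rightarrow> nat \<Rightarrow> nat \<Rightarrow> nat \<Rightarrow> nat \<Rightarrow> nat \<times> nat \<times> nat \<times> nat" where
  "tensor_index AB a s t d = (a, s, t, d)" | "tensor_index AC a s t d = (a, t, s, d)"

abbreviation A_index :: "nat \<times> nat \<times> nat \<times> nat \<Rightarrow> nat" where "A_index u \<equiv> fst u"
abbreviation D_index :: "nat \<times> nat \<times> nat \<times> nat \<Rightarrow> nat" where "D_index u \<equiv> snd (snd (snd u))"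

lemma tensor_index_simps [simp]:
  "A_index (tensor_index l a s t d) = a" "D_index (tensor_index l a s t d) = d"
  "kept l (tensor_index l a s t d) = s" "traced l (tensor_index l a s t d) = t"
  "tensor_index l (A_index u) (kept l u) (traced l u) (D_index u) = u"
  by (cases l; cases u; simp)+

definition tensor_indices :: "nat \<Rightarrow> nat \<Rightarrow> nat \<Rightarrow> (nat \<times> nat \<times> nat \<times> nat) set" where
  "tensor_indices nA N nD = {..<nA} \<times> {..<N} \<times> {..<N} \<times> {..<nD}"

lemma tensor_index_mem: "tensor_index l a s t d \<in> tensor_indices nA N nD \<longleftrightarrow> a < nA \<and> s < N \<and> t < N \<and> d < nD"
  by (cases l) (auto simp: tensor_indices_def)

lemma tensor_indices_D:
  assumes "u \<in> tensor_indices nA N nD"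
  shows "A_index u < nA" "kept l u < N" "traced l u < N" "D_index u < nD"
  using assms by (cases l; cases u; auto simp: tensor_indices_def)+

text \<open>The index of the conjugated entry paired with position \<open>k\<close> by the matrix product.\<close>

definition conj_index :: "nat \<Rightarrow> (nat \<Rightarrow> marginal) \<Rightarrow> (nat \<Rightarrow> nat \<times> nat \<times> nat \<times> nat) \<Rightarrow> nat \<Rightarrow> nat \<times> nat \<times> nat \<times> nat" where
  "conj_index p f T k = tensor_index (f k) (A_index (T (cyc_prev p k))) (kept (f (cyc_prev p k)) (T (cyc_prev p k)))
     (traced (f k) (T k)) (D_index (T k))"

lemma marginal_entry_tensor_index:
  "marginal_entry N nD T l (a, s) (a', s') =
   (\<Sum>td\<in>{..<N} \<times> {..<nD}. T (tensor_index l a s (fst td) (snd td)) * cnj (T (tensor_index l a' s' (fst td) (snd td))))"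
  by (cases l) (simp_all add: sum.cartesian_product case_prod_unfold outer_square_def)

lemma cyc_prev_mem: "k \<in> {1..p} \<Longrightarrow> cyc_prev p k \<in> {1..p}"
  by (auto simp: cyc_prev_def)

lemma marginal_mat_carrier: "marginal_mat nA N nD T l \<in> carrier_mat (nA * N) (nA * N)"
  by (simp add: marginal_mat_def)

lemma mult_add_less: "a < nA \<Longrightarrow> s < N \<Longrightarrow> a * N + s < nA * (N::nat)"
proof -
  assume "a < nA" "s < N"
  then have "a * N + s < Suc a * N" by simp
  also have "\<dots> \<le> nA * N" by (rule mult_le_mono1) (use \<open>a < nA\<close> in simp)
  finally show ?thesis .
qed

text \<open>At position k the row index of the matrix and the pair of traced indices make up one
  index T k of the tensor. The column index is the row index of the preceding position, so
  \<open>conj_index\<close> is determined by T.\<close>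

lemma mat_trace_marginal_word:
  assumes p: "1 \<le> p"
  shows "mat_trace (mat_word (nA * N) (marginal_mat nA N nD X) (map f (rev [1..<Suc p]))) =
    (\<Sum>T\<in>{1..p} \<rightarrow>\<^sub>E tensor_indices nA N nD. \<Prod>k\<in>{1..p}. X (T k) * cnj (X (conj_index p f T k)))"
proof -
  let ?K = "{1..p}" and ?n = "nA * N" and ?I = "tensor_indices nA N nD"
  let ?D = "{..<N} \<times> {..<nD}"
  let ?t = "\<lambda>r \<tau> k. X (tensor_index (f k) (r k div N) (r k mod N) (fst (\<tau> k)) (snd (\<tau> k))) *
      cnj (X (tensor_index (f k) (r (cyc_prev p k) div N) (r (cyc_prev p k) mod N) (fst (\<tau> k)) (snd (\<tau> k))))"
  have "mat_trace (mat_word ?n (marginal_mat nA N nD X) (map f (rev [1..<Suc p]))) =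
    (\<Sum>r\<in>?K \<rightarrow>\<^sub>E {..<?n}. \<Prod>k\<in>?K. marginal_mat nA N nD X (f k) $$ (r k, r (cyc_prev p k)))"
    by (rule mat_trace_word[OF marginal_mat_carrier p])
  also have "\<dots> = (\<Sum>r\<in>?K \<rightarrow>\<^sub>E {..<?n}. \<Sum>\<tau>\<in>?K \<rightarrow>\<^sub>E ?D. \<Prod>k\<in>?K. ?t r \<tau> k)"
  proof (rule sum.cong[OF refl])
    fix r assume r: "r \<in> ?K \<rightarrow>\<^sub>E {..<?n}"
    have "(\<Prod>k\<in>?K. marginal_mat nA N nD X (f k) $$ (r k, r (cyc_prev p k))) =
      (\<Prod>k\<in>?K. \<Sum>td\<in>?D. ?t r (\<lambda>_. td) k)"
    proof (rule prod.cong[OF refl])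
      fix k assume k: "k \<in> ?K"
      then have "r k < ?n" "r (cyc_prev p k) < ?n" using r cyc_prev_mem[OF k] by auto
      then show "marginal_mat nA N nD X (f k) $$ (r k, r (cyc_prev p k)) = (\<Sum>td\<in>?D. ?t r (\<lambda>_. td) k)"
        by (simp add: marginal_mat_def marginal_entry_tensor_index)
    qed
    also have "\<dots> = (\<Sum>\<tau>\<in>?K \<rightarrow>\<^sub>E ?D. \<Prod>k\<in>?K. ?t r \<tau> k)" by (rule prod_sum_PiE) auto
    finally show "(\<Prod>k\<in>?K. marginal_mat nA N nD X (f k) $$ (r k, r (cyc_prev p k))) = (\<Sum>\<tau>\<in>?K \<rightarrow>\<^sub>E ?D. \<Prod>k\<in>?K. ?t r \<tau> k)" .
  qed
  also have "\<dots> = (\<Sum>z\<in>(?K \<rightarrow>\<^sub>E {..<?n}) \<times> (?K \<rightarrow>\<^sub>E ?D). \<Prod>k\<in>?K. ?t (fst z) (snd z) k)"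
    by (simp add: sum.cartesian_product case_prod_unfold)
  also have "\<dots> = (\<Sum>T\<in>?K \<rightarrow>\<^sub>E ?I. \<Prod>k\<in>?K. X (T k) * cnj (X (conj_index p f T k)))"
  proof (rule sum.reindex_bij_witness[where
      j = "\<lambda>z. \<lambda>k\<in>?K. tensor_index (f k) (fst z k div N) (fst z k mod N) (fst (snd z k)) (snd (snd z k))" and
      i = "\<lambda>T. (\<lambda>k\<in>?K. A_index (T k) * N + kept (f k) (T k), \<lambda>k\<in>?K. (traced (f k) (T k), D_index (T k)))"])
    fix z assume z: "z \<in> (?K \<rightarrow>\<^sub>E {..<?n}) \<times> (?K \<rightarrow>\<^sub>E ?D)"
    then obtain r \<tau> where z': "z = (r, \<tau>)" "r \<in> ?K \<rightarrow>\<^sub>E {..<?n}" "\<tau> \<in> ?K \<rightarrow>\<^sub>E ?D" by auto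
    let ?T = "\<lambda>k\<in>?K. tensor_index (f k) (fst z k div N) (fst z k mod N) (fst (snd z k)) (snd (snd z k))"
    have mem: "r k < ?n" "fst (\<tau> k) < N" "snd (\<tau> k) < nD" "r k div N < nA" "r k mod N < N" if k: "k \<in> ?K" for k
    proof -
      show "r k < ?n" using z'(2) k by auto
      have "\<tau> k \<in> ?D" by (rule PiE_mem[OF z'(3) k])
      then show "fst (\<tau> k) < N" "snd (\<tau> k) < nD" by auto
      then show "r k mod N < N" by simp
      show "r k div N < nA" using \<open>r k < ?n\<close> by (simp add: less_mult_imp_div_less)
    qed
    show "(\<lambda>k\<in>?K. A_index (?T k) * N + kept (f k) (?T k), \<lambda>k\<in>?K. (traced (f k) (?T k), D_index (?T k))) = z"
    proof (rule prod_eqI)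
      show "fst (\<lambda>k\<in>?K. A_index (?T k) * N + kept (f k) (?T k), \<lambda>k\<in>?K. (traced (f k) (?T k), D_index (?T k))) = fst z"
        unfolding fst_conv
      proof (rule extensionalityI[of _ ?K])
        show "fst z \<in> extensional ?K" using z' by (auto simp: PiE_iff)
      qed simp_all
      show "snd (\<lambda>k\<in>?K. A_index (?T k) * N + kept (f k) (?T k), \<lambda>k\<in>?K. (traced (f k) (?T k), D_index (?T k))) = snd z"
        unfolding snd_conv
      proof (rule extensionalityI[of _ ?K])
        show "snd z \<in> extensional ?K" using z' by (auto simp: PiE_iff)
      qed simp_all
    qed
    show "?T \<in> ?K \<rightarrow>\<^sub>E ?I" using mem z'(1) by (auto simp: tensor_index_mem)
    show "(\<Prod>k\<in>?K. X (?T k) * cnj (X (conj_index p f ?T k))) = (\<Prod>k\<in>?K. ?t (fst z) (snd z) k)"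
    proof (rule prod.cong[OF refl])
      fix k assume k: "k \<in> ?K"
      show "X (?T k) * cnj (X (conj_index p f ?T k)) = ?t (fst z) (snd z) k"
        using k cyc_prev_mem[OF k] by (simp add: conj_index_def)
    qed
  next
    fix T assume T: "T \<in> ?K \<rightarrow>\<^sub>E ?I"
    let ?z = "(\<lambda>k\<in>?K. A_index (T k) * N + kept (f k) (T k), \<lambda>k\<in>?K. (traced (f k) (T k), D_index (T k)))"
    have mem: "T k \<in> ?I" if "k \<in> ?K" for k using T that by auto
    note D = tensor_indices_D[OF mem]
    show "?z \<in> (?K \<rightarrow>\<^sub>E {..<?n}) \<times> (?K \<rightarrow>\<^sub>E ?D)"
      using D mult_add_less by auto
    show "(\<lambda>k\<in>?K. tensor_index (f k) (fst ?z k div N) (fst ?z k mod N) (fst (snd ?z k)) (snd (snd ?z k))) = T"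
    proof (rule extensionalityI[of _ ?K])
      fix k assume k: "k \<in> ?K"
      have "(A_index (T k) * N + kept (f k) (T k)) div N = A_index (T k)" "(A_index (T k) * N + kept (f k) (T k)) mod N = kept (f k) (T k)"
        using D(2)[OF k, of "f k"] by auto
      then show "(\<lambda>k\<in>?K. tensor_index (f k) (fst ?z k div N) (fst ?z k mod N) (fst (snd ?z k)) (snd (snd ?z k))) k = T k"
        using k by simp
    qed (use T in \<open>auto simp: PiE_iff\<close>)
  qed
  finally show ?thesis .
qed

section \<open>Index assignments compatible with a permutation\<close>

lemma cycle_of_list_nth:
  assumes "distinct xs" "i < length xs"
  shows "cycle_of_list xs (xs ! i) = xs ! (Suc i mod length xs)"
proof -
  have "map (cycle_of_list xs) xs = rotate1 xs" using cyclic_rotation[OF assms(1), of 1] by simp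
  then have "map (cycle_of_list xs) xs ! i = rotate1 xs ! i" by simp
  then show ?thesis using assms(2) by (simp add: nth_rotate1)
qed

lemma cycle_of_list_map_prev:
  assumes "inj_on h {1..p}" and k: "k \<in> {1..p}"
  shows "cycle_of_list (map h [1..<Suc p]) (h (cyc_prev p k)) = h k"
proof -
  let ?xs = "map h [1..<Suc p]"
  have len: "length ?xs = p" by simp
  have dist: "distinct ?xs" using assms(1) by (simp add: distinct_map atLeastLessThanSuc_atLeastAtMost del: upt_Suc)
  have nth: "?xs ! i = h (Suc i)" if "i < p" for i using that by (simp del: upt_Suc)
  show ?thesis
  proof (cases "k = 1")
    case True
    then have "cycle_of_list ?xs (?xs ! (p - 1)) = ?xs ! 0"
      using cycle_of_list_nth[OF dist, of "p - 1"] k unfolding len by simp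
    then show ?thesis using True k nth[of "p - 1"] nth[of 0] by (simp add: cyc_prev_def del: upt_Suc)
  next
    case False
    then obtain i where i: "k = Suc (Suc i)" using k by (cases k; cases "k - 1") auto
    then have "Suc i < p" using k by simp
    then have "cycle_of_list ?xs (?xs ! i) = ?xs ! Suc i"
      using cycle_of_list_nth[OF dist, of i] unfolding len by simp
    then show ?thesis using i \<open>Suc i < p\<close> nth[of i] nth[of "Suc i"] by (simp add: cyc_prev_def del: upt_Suc)
  qed
qed

text \<open>As \<iota> inverts \<sigma> on S, substituting \<sigma> y for x turns a relation between
  two shifts into invariance under a single permutation.\<close>

lemma invariant_shift:
  assumes "\<sigma> permutes S" "\<And>x. x \<in> S \<Longrightarrow> \<iota> x \<in> S \<and> \<sigma> (\<iota> x) = x"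
  shows "(\<forall>x\<in>S. g (\<pi> x) = g (\<iota> x)) \<longleftrightarrow> (\<forall>y\<in>S. g (\<pi> (\<sigma> y)) = g y)"
proof
  assume *: "\<forall>x\<in>S. g (\<pi> x) = g (\<iota> x)"
  show "\<forall>y\<in>S. g (\<pi> (\<sigma> y)) = g y"
  proof
    fix y assume y: "y \<in> S"
    then have s: "\<sigma> y \<in> S" using permutes_in_image[OF assms(1)] by simp
    then have "\<sigma> (\<iota> (\<sigma> y)) = \<sigma> y" using assms(2) by simp
    then have "\<iota> (\<sigma> y) = y" using permutes_inj[OF assms(1)] by (simp add: inj_eq)
    then show "g (\<pi> (\<sigma> y)) = g y" using * s by simp
  qed
next
  assume *: "\<forall>y\<in>S. g (\<pi> (\<sigma> y)) = g y"
  show "\<forall>x\<in>S. g (\<pi> x) = g (\<iota> x)"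
  proof
    fix x assume "x \<in> S"
    then show "g (\<pi> x) = g (\<iota> x)" using *[rule_format, of "\<iota> x"] assms(2)[of x] by simp
  qed
qed

lemma UNIV_marginal: "(UNIV :: marginal set) = {AB, AC}"
  using marginal.exhaust by auto

text \<open>The point (k, AB) stands for the index of B at position k and (k, AC) for that of C.
  Only the kept index is passed on to the neighbouring position; the traced one, with the colour
  other than f k, is fixed.\<close>

definition black_cycle :: "nat \<Rightarrow> (nat \<Rightarrow> marginal) \<Rightarrow> nat \<times> marginal \<Rightarrow> nat \<times> marginal" where
  "black_cycle p f = cycle_of_list (map (\<lambda>k. (k, f k)) [1..<Suc p])"

definition both :: "(nat \<Rightarrow> nat) \<Rightarrow> nat \<times> marginal \<Rightarrow> nat \<times> marginal" where
  "both \<alpha> x = (\<alpha> (fst x), snd x)"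

text \<open>The exponent of \<open>N\<close>: the number of cycles of the indices of the factors \<open>B\<close> and \<open>C\<close>.\<close>

definition num_faces :: "nat \<Rightarrow> (nat \<Rightarrow> marginal) \<Rightarrow> (nat \<Rightarrow> nat) \<Rightarrow> nat" where
  "num_faces p f \<alpha> = num_cycles ({1..p} \<times> UNIV) (black_cycle p f \<circ> both \<alpha>)"

lemma both_permutes:
  assumes "\<alpha> permutes K" shows "both \<alpha> permutes (K \<times> UNIV)"
  unfolding permutes_def
proof (intro conjI allI impI)
  show "both \<alpha> x = x" if "x \<notin> K \<times> UNIV" for x
    using that permutes_not_in[OF assms, of "fst x"] by (cases x) (auto simp: both_def)
  show "\<exists>!x. both \<alpha> x = y" for y
  proof (rule ex1I[of _ "(inv_into UNIV \<alpha> (fst y), snd y)"])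
    show "both \<alpha> (inv_into UNIV \<alpha> (fst y), snd y) = y" by (simp add: both_def permutes_inverses[OF assms])
    show "x = (inv_into UNIV \<alpha> (fst y), snd y)" if "both \<alpha> x = y" for x
      using that by (auto simp: both_def permutes_inverses[OF assms])
  qed
qed

text \<open>The equation splits into three independent invariances: of the A indices under
  \<alpha>\<gamma>, of the D indices under \<alpha>, and of the B and C indices, seen as one
  function on {1..p} x UNIV, under \<open>both \<alpha>\<close> after \<Gamma>. Each contributes its
  dimension to the number of cycles.\<close>

lemma card_index_solutions:
  assumes \<alpha>: "\<alpha> permutes {1..p}"
  shows "card {T \<in> {1..p} \<rightarrow>\<^sub>E tensor_indices nA N nD. \<forall>k\<in>{1..p}. T (\<alpha> k) = conj_index p f T k} =
    nA ^ num_cycles {1..p} (cycle_of_list [1..<Suc p] \<circ> \<alpha>) * nD ^ num_cycles {1..p} \<alpha> * N ^ num_faces p f \<alpha>"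
proof -
  let ?K = "{1..p}" and ?P = "{1..p} \<times> (UNIV :: marginal set)" and ?I = "tensor_indices nA N nD"
  let ?\<gamma> = "cycle_of_list [1..<Suc p]" and ?\<Gamma> = "black_cycle p f" and ?\<pi> = "both \<alpha>"
  have finP: "finite ?P" by (simp add: UNIV_marginal)
  have \<gamma>: "?\<gamma> permutes ?K"
    using cycle_permutes[of "[1..<Suc p]"] by (simp add: atLeastLessThanSuc_atLeastAtMost del: upt_Suc)
  have \<Gamma>: "?\<Gamma> permutes ?P"
    unfolding black_cycle_def by (rule permutes_subset[OF cycle_permutes]) auto
  have \<pi>: "?\<pi> permutes ?P" by (rule both_permutes[OF \<alpha>])
  have \<gamma>prev: "cyc_prev p k \<in> ?K \<and> ?\<gamma> (cyc_prev p k) = k" if "k \<in> ?K" for k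
    using cycle_of_list_map_prev[of "\<lambda>x. x" p k] cyc_prev_mem[OF that] that by simp
  define \<iota> where "\<iota> x = (if snd x = f (fst x) then (cyc_prev p (fst x), f (cyc_prev p (fst x))) else x)" for x
  have \<iota>: "\<iota> x \<in> ?P \<and> ?\<Gamma> (\<iota> x) = x" if "x \<in> ?P" for x
  proof (cases "snd x = f (fst x)")
    case True
    have k: "fst x \<in> ?K" using that by auto
    have "?\<Gamma> (\<iota> x) = (fst x, f (fst x))"
      using cycle_of_list_map_prev[of "\<lambda>k. (k, f k)" p "fst x"] k True
      unfolding black_cycle_def \<iota>_def by (simp add: inj_on_def del: upt_Suc)
    then show ?thesis using True cyc_prev_mem[OF k] by (simp add: \<iota>_def prod_eq_iff)
  next
    case False
    then have "x \<notin> set (map (\<lambda>k. (k, f k)) [1..<Suc p])" by auto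
    then have "?\<Gamma> x = x" unfolding black_cycle_def by (rule id_outside_supp)
    then show ?thesis using False that by (simp add: \<iota>_def)
  qed
  let ?S = "{T \<in> ?K \<rightarrow>\<^sub>E ?I. \<forall>k\<in>?K. T (\<alpha> k) = conj_index p f T k}"
  let ?SA = "{a \<in> ?K \<rightarrow>\<^sub>E {..<nA}. \<forall>k\<in>?K. a ((\<alpha> \<circ> ?\<gamma>) k) = a k}"
  let ?SD = "{d \<in> ?K \<rightarrow>\<^sub>E {..<nD}. \<forall>k\<in>?K. d (\<alpha> k) = d k}"
  let ?SG = "{g \<in> ?P \<rightarrow>\<^sub>E {..<N}. \<forall>x\<in>?P. g ((?\<pi> \<circ> ?\<Gamma>) x) = g x}"
  let ?to = "\<lambda>T. (\<lambda>k\<in>?K. A_index (T k), \<lambda>k\<in>?K. D_index (T k), \<lambda>x\<in>?P. kept (snd x) (T (fst x)))"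
  let ?from = "\<lambda>(a, d, g). \<lambda>k\<in>?K. (a k, g (k, AB), g (k, AC), d k)"
  have idx: "u = v \<longleftrightarrow> A_index u = A_index v \<and> D_index u = D_index v \<and> (\<forall>l. kept l u = kept l v)" for u v
  proof (cases u; cases v)
    fix a b c d a' b' c' d' assume e: "u = (a, b, c, d)" "v = (a', b', c', d')"
    have "(\<forall>l. kept l u = kept l v) \<longleftrightarrow> kept AB u = kept AB v \<and> kept AC u = kept AC v"
      using marginal.exhaust by metis
    then show ?thesis unfolding e by auto
  qed
  \<comment> \<open>In its own colour the conjugated entry at k takes the kept index of the
    preceding position, which may belong to the other factor; in the opposite colour the index is
    traced and stays at k.\<close>
  have keptc: "kept l (conj_index p f T k) = (if l = f k then kept (f (cyc_prev p k)) (T (cyc_prev p k)) else kept l (T k))" for l T k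
  proof -
    have 1: "l \<noteq> l' \<Longrightarrow> kept l (tensor_index l' a s t d) = t" for l l' a s t d by (cases l; cases l'; simp)
    have 2: "l \<noteq> l' \<Longrightarrow> traced l' u = kept l u" for l l' u by (cases l; cases l'; cases u; simp)
    show ?thesis unfolding conj_index_def using 1[of l "f k"] 2[of l "f k"] by simp
  qed
  have main: "(\<forall>k\<in>?K. T (\<alpha> k) = conj_index p f T k) \<longleftrightarrow>
      (\<forall>k\<in>?K. A_index (T ((\<alpha> \<circ> ?\<gamma>) k)) = A_index (T k)) \<and> (\<forall>k\<in>?K. D_index (T (\<alpha> k)) = D_index (T k)) \<and>
      (\<forall>x\<in>?P. kept (snd ((?\<pi> \<circ> ?\<Gamma>) x)) (T (fst ((?\<pi> \<circ> ?\<Gamma>) x))) = kept (snd x) (T (fst x)))" for T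
  proof -
    let ?g = "\<lambda>x. kept (snd x) (T (fst x))"
    have "(\<forall>k\<in>?K. T (\<alpha> k) = conj_index p f T k) \<longleftrightarrow> (\<forall>k\<in>?K. A_index (T (\<alpha> k)) = A_index (T (cyc_prev p k))) \<and>
      (\<forall>k\<in>?K. D_index (T (\<alpha> k)) = D_index (T k)) \<and> (\<forall>k\<in>?K. \<forall>l. kept l (T (\<alpha> k)) = kept l (conj_index p f T k))"
      unfolding idx by (auto simp: conj_index_def)
    also have "(\<forall>k\<in>?K. A_index (T (\<alpha> k)) = A_index (T (cyc_prev p k))) \<longleftrightarrow> (\<forall>k\<in>?K. A_index (T (\<alpha> (?\<gamma> k))) = A_index (T k))"
      by (rule invariant_shift[OF \<gamma> \<gamma>prev, where g="\<lambda>k. A_index (T k)"])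
    also have "(\<forall>k\<in>?K. \<forall>l. kept l (T (\<alpha> k)) = kept l (conj_index p f T k)) \<longleftrightarrow> (\<forall>x\<in>?P. ?g (?\<pi> x) = ?g (\<iota> x))"
      unfolding keptc by (auto simp: both_def \<iota>_def split: if_splits)
    also have "\<dots> \<longleftrightarrow> (\<forall>x\<in>?P. ?g (?\<pi> (?\<Gamma> x)) = ?g x)" by (rule invariant_shift[OF \<Gamma> \<iota>])
    finally show ?thesis by (simp only: comp_apply)
  qed
  have \<alpha>\<gamma>: "(\<alpha> \<circ> ?\<gamma>) permutes ?K" by (rule permutes_compose[OF \<gamma> \<alpha>])
  have \<pi>\<Gamma>: "(?\<pi> \<circ> ?\<Gamma>) permutes ?P" by (rule permutes_compose[OF \<Gamma> \<pi>])
  have memK: "\<alpha> k \<in> ?K" "(\<alpha> \<circ> ?\<gamma>) k \<in> ?K" if "k \<in> ?K" for k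
    using permutes_in_image[OF \<alpha>, of k] permutes_in_image[OF \<alpha>\<gamma>, of k] that by blast+
  have memP: "(?\<pi> \<circ> ?\<Gamma>) x \<in> ?P" if "x \<in> ?P" for x
    using permutes_in_image[OF \<pi>\<Gamma>, of x] that by blast
  have "bij_betw ?to ?S (?SA \<times> ?SD \<times> ?SG)"
  proof (rule bij_betw_byWitness[where f' = ?from])
    show "\<forall>T\<in>?S. ?from (?to T) = T"
    proof
      fix T assume T: "T \<in> ?S"
      show "?from (?to T) = T"
        unfolding prod.case
      proof (rule extensionalityI[of _ ?K])
        show "T \<in> extensional ?K" using T by (auto simp: PiE_iff)
        fix k assume "k \<in> ?K"
        then show "(\<lambda>k\<in>?K. ((\<lambda>k\<in>?K. A_index (T k)) k, (\<lambda>x\<in>?P. kept (snd x) (T (fst x))) (k, AB),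
          (\<lambda>x\<in>?P. kept (snd x) (T (fst x))) (k, AC), (\<lambda>k\<in>?K. D_index (T k)) k)) k = T k"
          by (cases "T k") simp
      qed simp
    qed
    show "\<forall>z\<in>?SA \<times> ?SD \<times> ?SG. ?to (?from z) = z"
    proof
      fix z assume "z \<in> ?SA \<times> ?SD \<times> ?SG"
      then obtain a d g where z: "z = (a, d, g)" "a \<in> extensional ?K" "d \<in> extensional ?K" "g \<in> extensional ?P"
        by (auto simp: PiE_iff)
      have "(\<lambda>k\<in>?K. A_index (?from z k)) = a"
        by (rule extensionalityI[of _ ?K]) (use z in simp_all)
      moreover have "(\<lambda>k\<in>?K. D_index (?from z k)) = d"
        by (rule extensionalityI[of _ ?K]) (use z in simp_all)
      moreover have "(\<lambda>x\<in>?P. kept (snd x) (?from z (fst x))) = g"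
      proof (rule extensionalityI[of _ ?P])
        fix x assume x: "x \<in> ?P"
        then show "(\<lambda>x\<in>?P. kept (snd x) (?from z (fst x))) x = g x"
          unfolding z(1) by (cases "snd x"; cases x) auto
      qed (use z in simp_all)
      ultimately show "?to (?from z) = z" using z(1) by (simp only:)
    qed
    show "?to ` ?S \<subseteq> ?SA \<times> ?SD \<times> ?SG"
    proof (rule image_subsetI)
      fix T assume T: "T \<in> ?S"
      then have TI: "T k \<in> ?I" if "k \<in> ?K" for k using that by auto
      note D = tensor_indices_D[OF TI]
      have inv: "\<forall>k\<in>?K. A_index (T ((\<alpha> \<circ> ?\<gamma>) k)) = A_index (T k)" "\<forall>k\<in>?K. D_index (T (\<alpha> k)) = D_index (T k)"
        "\<forall>x\<in>?P. kept (snd ((?\<pi> \<circ> ?\<Gamma>) x)) (T (fst ((?\<pi> \<circ> ?\<Gamma>) x))) = kept (snd x) (T (fst x))"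
        using T main[of T] by blast+
      have "(\<lambda>k\<in>?K. A_index (T k)) \<in> ?SA"
        using D(1) inv(1) memK(2) by (auto simp del: comp_apply)
      moreover have "(\<lambda>k\<in>?K. D_index (T k)) \<in> ?SD" using D(4) inv(2) memK(1) by auto
      moreover have "(\<lambda>x\<in>?P. kept (snd x) (T (fst x))) \<in> ?SG"
      proof (rule CollectI, rule conjI)
        show "(\<lambda>x\<in>?P. kept (snd x) (T (fst x))) \<in> ?P \<rightarrow>\<^sub>E {..<N}" using D(2) by auto
        show "\<forall>x\<in>?P. (\<lambda>x\<in>?P. kept (snd x) (T (fst x))) ((?\<pi> \<circ> ?\<Gamma>) x) = (\<lambda>x\<in>?P. kept (snd x) (T (fst x))) x"
        proof
          fix x assume x: "x \<in> ?P"
          show "(\<lambda>x\<in>?P. kept (snd x) (T (fst x))) ((?\<pi> \<circ> ?\<Gamma>) x) = (\<lambda>x\<in>?P. kept (snd x) (T (fst x))) x"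
            unfolding restrict_apply'[OF x] restrict_apply'[OF memP[OF x]] using inv(3) x by blast
        qed
      qed
      ultimately show "?to T \<in> ?SA \<times> ?SD \<times> ?SG" by blast
    qed
    show "?from ` (?SA \<times> ?SD \<times> ?SG) \<subseteq> ?S"
    proof (rule image_subsetI)
      fix z assume "z \<in> ?SA \<times> ?SD \<times> ?SG"
      then obtain a d g where z: "z = (a, d, g)" and a: "a \<in> ?SA" and d: "d \<in> ?SD" and g: "g \<in> ?SG" by auto
      let ?T = "?from z"
      have TA: "A_index (?T k) = a k" and TD: "D_index (?T k) = d k" if "k \<in> ?K" for k using that unfolding z by simp_all
      have TG: "kept (snd x) (?T (fst x)) = g x" if "x \<in> ?P" for x
        using that unfolding z by (cases "snd x"; cases x) auto
      have "?T \<in> ?K \<rightarrow>\<^sub>E ?I" using a d g unfolding z by (auto simp: tensor_indices_def PiE_iff)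
      moreover have "\<forall>k\<in>?K. ?T (\<alpha> k) = conj_index p f ?T k"
      proof (rule main[THEN iffD2], intro conjI ballI)
        show "A_index (?T ((\<alpha> \<circ> ?\<gamma>) k)) = A_index (?T k)" if "k \<in> ?K" for k
          unfolding TA[OF that] TA[OF memK(2)[OF that]] using a that by blast
        show "D_index (?T (\<alpha> k)) = D_index (?T k)" if "k \<in> ?K" for k
          unfolding TD[OF that] TD[OF memK(1)[OF that]] using d that by blast
        show "kept (snd ((?\<pi> \<circ> ?\<Gamma>) x)) (?T (fst ((?\<pi> \<circ> ?\<Gamma>) x))) = kept (snd x) (?T (fst x))" if "x \<in> ?P" for x
          unfolding TG[OF that] TG[OF memP[OF that]] using g that by blast
      qed
      ultimately show "?T \<in> ?S" by blast
    qed
  qed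
  then have "card ?S = card (?SA \<times> ?SD \<times> ?SG)" by (rule bij_betw_same_card)
  also have "\<dots> = card ?SA * (card ?SD * card ?SG)" by (simp only: card_cartesian_product)
  also have "card ?SA = nA ^ num_cycles ?K (\<alpha> \<circ> ?\<gamma>)"
    using card_invariant_functions[OF \<alpha>\<gamma> finite_atLeastAtMost, of "{..<nA}"] by (simp only: card_lessThan finite_lessThan)
  also have "card ?SD = nD ^ num_cycles ?K \<alpha>"
    using card_invariant_functions[OF \<alpha> finite_atLeastAtMost, of "{..<nD}"] by (simp only: card_lessThan finite_lessThan)
  also have "card ?SG = N ^ num_cycles ?P (?\<pi> \<circ> ?\<Gamma>)"
    using card_invariant_functions[OF \<pi>\<Gamma> finP, of "{..<N}"] by (simp only: card_lessThan finite_lessThan)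
  finally show ?thesis
    unfolding num_faces_def num_cycles_comm[OF \<pi> \<Gamma> finP, symmetric] num_cycles_comm[OF \<alpha> \<gamma> finite_atLeastAtMost, symmetric]
    by (simp only: mult.assoc)
qed

section \<open>Bounds on the number of faces\<close>

lemma orbit_both:
  assumes "\<alpha> permutes {1..p}" shows "orbit (both \<alpha>) (k, l) = (\<lambda>k. (k, l)) ` orbit \<alpha> k"
  by (rule orbit_inverse[symmetric, OF self_in_orbit_permutes[OF assms finite_atLeastAtMost]]) (simp add: both_def)

lemma num_cycles_both:
  assumes \<alpha>: "\<alpha> permutes {1..p}" and g: "\<And>k. k \<in> {1..p} \<Longrightarrow> g (\<alpha> k) = g k"
  shows "num_cycles ((\<lambda>k. (k, g k)) ` {1..p}) (both \<alpha>) = num_cycles {1..p} \<alpha>"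
proof (rule num_cycles_image[OF both_permutes[OF \<alpha>] _ finite_atLeastAtMost _ refl _ \<alpha>])
  show "finite ({1..p} \<times> (UNIV :: marginal set))" by (simp add: UNIV_marginal)
qed (auto simp: inj_on_def both_def g)

lemma num_cycles_both_UNIV:
  assumes \<alpha>: "\<alpha> permutes {1..p}"
  shows "num_cycles ({1..p} \<times> UNIV) (both \<alpha>) = 2 * num_cycles {1..p} \<alpha>"
proof -
  have "num_cycles ({1..p} \<times> UNIV) (both \<alpha>) =
    num_cycles ((\<lambda>k. (k, AB)) ` {1..p}) (both \<alpha>) + num_cycles ((\<lambda>k. (k, AC)) ` {1..p}) (both \<alpha>)"
  proof (rule num_cycles_Un[OF both_permutes[OF \<alpha>]])
    have sub: "both \<alpha> ` (\<lambda>k. (k, l)) ` {1..p} \<subseteq> (\<lambda>k. (k, l)) ` {1..p}" for l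
      unfolding image_image
    proof (rule image_subsetI)
      fix k assume "k \<in> {1..p}"
      then have "\<alpha> k \<in> {1..p}" using permutes_in_image[OF \<alpha>] by blast
      then show "both \<alpha> (k, l) \<in> (\<lambda>k. (k, l)) ` {1..p}" by (auto simp: both_def)
    qed
    show "both \<alpha> ` (\<lambda>k. (k, AB)) ` {1..p} \<subseteq> (\<lambda>k. (k, AB)) ` {1..p}"
      "both \<alpha> ` (\<lambda>k. (k, AC)) ` {1..p} \<subseteq> (\<lambda>k. (k, AC)) ` {1..p}" by (rule sub)+
  qed (auto simp: UNIV_marginal)
  then show ?thesis using num_cycles_both[OF \<alpha>, of "\<lambda>_. AB"] num_cycles_both[OF \<alpha>, of "\<lambda>_. AC"] by simp
qed

text \<open>A white vertex with edges of both colours meets the black cycle in two cycles of \<open>both \<alpha>\<close>,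
  which costs two faces.\<close>

lemma num_faces_mixed:
  assumes \<alpha>: "\<alpha> permutes {1..p}" and k0: "k0 \<in> {1..p}" "f (\<alpha> k0) \<noteq> f k0"
  shows "num_faces p f \<alpha> \<le> p"
proof -
  let ?xs = "map (\<lambda>k. (k, f k)) [1..<Suc p]" and ?\<pi> = "both \<alpha>"
  let ?Q = "orbit ?\<pi> ` set ?xs"
  have sx: "set ?xs = (\<lambda>k. (k, f k)) ` {1..p}" by auto
  have img: "(`) fst ` ?Q = orbit \<alpha> ` {1..p}"
    unfolding sx image_image orbit_both[OF \<alpha>] by simp
  have "\<alpha> k0 \<in> {1..p}" using permutes_in_image[OF \<alpha>] k0 by blast
  \<comment> \<open>The first projection maps the cycles met by the black cycle onto those of
    \<alpha>, but the cycle of k0 is met once in each of the colours f k0 and f (\<alpha>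
    k0).\<close>
  have "card (orbit \<alpha> ` {1..p}) \<noteq> card ?Q"
  proof
    assume "card (orbit \<alpha> ` {1..p}) = card ?Q"
    then have inj: "inj_on ((`) fst) ?Q" unfolding img[symmetric] by (intro eq_card_imp_inj_on) auto
    have "orbit ?\<pi> (k0, f k0) = orbit ?\<pi> (\<alpha> k0, f (\<alpha> k0))"
    proof (rule inj_onD[OF inj])
      have "orbit \<alpha> (\<alpha> k0) = orbit \<alpha> k0"
        by (rule orbit_eq_permutes[OF \<alpha> finite_atLeastAtMost orbit.base])
      then show "fst ` orbit ?\<pi> (k0, f k0) = fst ` orbit ?\<pi> (\<alpha> k0, f (\<alpha> k0))"
        unfolding orbit_both[OF \<alpha>] by (simp add: image_image)
    qed (use k0 \<open>\<alpha> k0 \<in> {1..p}\<close> in \<open>unfold sx, blast+\<close>)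
    then show False unfolding orbit_both[OF \<alpha>] using k0 orbit_nonempty[of \<alpha> k0] by blast
  qed
  moreover have "card (orbit \<alpha> ` {1..p}) \<le> card ?Q" unfolding img[symmetric] by (rule card_image_le) simp
  ultimately have h: "num_cycles {1..p} \<alpha> < card ?Q" unfolding num_cycles_def by simp
  have len: "length ?xs = p" by simp
  have "num_cycles ({1..p} \<times> UNIV) (cycle_of_list ?xs \<circ> ?\<pi>) + 2 * card ?Q \<le> num_cycles ({1..p} \<times> UNIV) ?\<pi> + length ?xs + 1"
  proof (rule num_cycles_cycle_comp_le[OF both_permutes[OF \<alpha>]])
    show "distinct ?xs" by (auto simp: distinct_map inj_on_def)
    show "?xs \<noteq> []" using k0 by auto
    show "finite ({1..p} \<times> (UNIV :: marginal set))" by (simp add: UNIV_marginal)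
  qed auto
  then show ?thesis
    unfolding num_faces_def black_cycle_def num_cycles_both_UNIV[OF \<alpha>] len using h by linarith
qed

text \<open>The index points fall into two invariant copies of {1..p}. On the copy that takes the
  colour f k at position k the permutation acts like \<gamma>\<alpha>; on the opposite copy \<Gamma>
  is the identity and only \<alpha> acts.\<close>

lemma num_faces_monochrome:
  assumes \<alpha>: "\<alpha> permutes {1..p}" and f: "\<And>k. k \<in> {1..p} \<Longrightarrow> f (\<alpha> k) = f k"
  shows "num_faces p f \<alpha> = num_cycles {1..p} (cycle_of_list [1..<Suc p] \<circ> \<alpha>) + num_cycles {1..p} \<alpha>"
proof -
  let ?K = "{1..p}" and ?P = "{1..p} \<times> (UNIV :: marginal set)" and ?\<gamma> = "cycle_of_list [1..<Suc p]"
  let ?\<Gamma> = "black_cycle p f" and ?\<pi> = "both \<alpha>"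
  define other where "other k = (if f k = AB then AC else AB)" for k
  have other: "other k \<noteq> f k" "l \<noteq> f k \<longleftrightarrow> l = other k" for k l
    unfolding other_def by (cases "f k"; cases l; simp)+
  let ?h1 = "\<lambda>k. (k, f k)" and ?h2 = "\<lambda>k. (k, other k)"
  have finP: "finite ?P" by (simp add: UNIV_marginal)
  have \<gamma>: "?\<gamma> permutes ?K"
    using cycle_permutes[of "[1..<Suc p]"] by (simp add: atLeastLessThanSuc_atLeastAtMost del: upt_Suc)
  have \<Gamma>: "?\<Gamma> permutes ?P"
    unfolding black_cycle_def by (rule permutes_subset[OF cycle_permutes]) auto
  have \<pi>: "?\<pi> permutes ?P" by (rule both_permutes[OF \<alpha>])
  have \<Gamma>\<pi>: "(?\<Gamma> \<circ> ?\<pi>) permutes ?P" by (rule permutes_compose[OF \<pi> \<Gamma>])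
  have \<gamma>\<alpha>: "(?\<gamma> \<circ> \<alpha>) permutes ?K" by (rule permutes_compose[OF \<alpha> \<gamma>])
  have \<Gamma>1: "?\<Gamma> (?h1 k) = ?h1 (?\<gamma> k)" if "k \<in> ?K" for k
  proof -
    have "?\<gamma> k \<in> ?K" using permutes_in_image[OF \<gamma>] that by blast
    note q = cycle_of_list_map_prev[of _ p "?\<gamma> k", OF _ this]
    have "?\<gamma> (cyc_prev p (?\<gamma> k)) = ?\<gamma> k" using q[of "\<lambda>x. x"] by simp
    then have prev: "cyc_prev p (?\<gamma> k) = k" using permutes_inj[OF \<gamma>] by (simp only: inj_eq)
    have "?\<Gamma> (?h1 (cyc_prev p (?\<gamma> k))) = ?h1 (?\<gamma> k)" unfolding black_cycle_def by (rule q) (simp add: inj_on_def)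
    then show ?thesis unfolding prev .
  qed
  have \<Gamma>2: "?\<Gamma> (?h2 k) = ?h2 k" for k
    unfolding black_cycle_def by (rule id_outside_supp) (use other(1)[of k] in auto)
  have c1: "(?\<Gamma> \<circ> ?\<pi>) (?h1 k) = ?h1 ((?\<gamma> \<circ> \<alpha>) k)" if k: "k \<in> ?K" for k
  proof -
    have "\<alpha> k \<in> ?K" using permutes_in_image[OF \<alpha>] k by blast
    moreover have "?\<pi> (?h1 k) = ?h1 (\<alpha> k)" using f[OF k] by (simp add: both_def)
    ultimately show ?thesis using \<Gamma>1 by (simp only: comp_apply)
  qed
  have c2: "(?\<Gamma> \<circ> ?\<pi>) (?h2 k) = ?h2 (\<alpha> k)" if k: "k \<in> ?K" for k
  proof -
    have "other (\<alpha> k) = other k" using f[OF k] by (simp add: other_def)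
    then have "?\<pi> (?h2 k) = ?h2 (\<alpha> k)" by (simp add: both_def)
    then show ?thesis using \<Gamma>2 by (simp only: comp_apply)
  qed
  have inK: "\<alpha> k \<in> ?K" "(?\<gamma> \<circ> \<alpha>) k \<in> ?K" if "k \<in> ?K" for k
    using permutes_in_image[OF \<alpha>, of k] permutes_in_image[OF \<gamma>\<alpha>, of k] that by blast+
  have "num_faces p f \<alpha> = num_cycles (?h1 ` ?K) (?\<Gamma> \<circ> ?\<pi>) + num_cycles (?h2 ` ?K) (?\<Gamma> \<circ> ?\<pi>)"
    unfolding num_faces_def
  proof (rule num_cycles_Un[OF \<Gamma>\<pi> finP])
    show "?P = ?h1 ` ?K \<union> ?h2 ` ?K"
    proof (intro equalityI subsetI)
      fix x assume "x \<in> ?P"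
      then obtain k l where x: "x = (k, l)" "k \<in> ?K" by auto
      then show "x \<in> ?h1 ` ?K \<union> ?h2 ` ?K" using other(2)[of l k] by (cases "l = f k") auto
    qed auto
    show "?h1 ` ?K \<inter> ?h2 ` ?K = {}" using other(1) by auto metis
    show "(?\<Gamma> \<circ> ?\<pi>) ` ?h1 ` ?K \<subseteq> ?h1 ` ?K"
      unfolding image_image by (rule image_subsetI) (simp only: c1, use inK(2) in blast)
    show "(?\<Gamma> \<circ> ?\<pi>) ` ?h2 ` ?K \<subseteq> ?h2 ` ?K"
      unfolding image_image by (rule image_subsetI) (simp only: c2, use inK(1) in blast)
  qed
  also have "num_cycles (?h1 ` ?K) (?\<Gamma> \<circ> ?\<pi>) = num_cycles ?K (?\<gamma> \<circ> \<alpha>)"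
    by (rule num_cycles_image[where h="?h1", OF \<Gamma>\<pi> finP finite_atLeastAtMost _ refl _ \<gamma>\<alpha>]) (auto simp: inj_on_def c1 simp del: comp_apply)
  also have "num_cycles (?h2 ` ?K) (?\<Gamma> \<circ> ?\<pi>) = num_cycles ?K \<alpha>"
    by (rule num_cycles_image[where h="?h2", OF \<Gamma>\<pi> finP finite_atLeastAtMost _ refl _ \<alpha>]) (auto simp: inj_on_def c2 simp del: comp_apply)
  finally show ?thesis .
qed

section \<open>The large \<open>N\<close> limit\<close>

text \<open>Wick's formula counts, for each index assignment T, the permutations compatible with it.
  Exchanging the order of counting leaves, for each \<alpha>, the number of compatible T.\<close>

lemma gaussian_tensor_word:
  assumes "prob_space M" and X: "gaussian_tensor M nA N N nD X" and p: "1 \<le> p"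
  shows "integrable M (\<lambda>\<omega>. mat_trace (mat_word (nA * N) (marginal_mat nA N nD (X \<omega>)) (map f (rev [1..<Suc p]))))"
    and "(\<integral>\<omega>. mat_trace (mat_word (nA * N) (marginal_mat nA N nD (X \<omega>)) (map f (rev [1..<Suc p]))) \<partial>M) =
      (\<Sum>\<alpha> | \<alpha> permutes {1..p}. of_nat (nA ^ num_cycles {1..p} (cycle_of_list [1..<Suc p] \<circ> \<alpha>) *
         nD ^ num_cycles {1..p} \<alpha> * N ^ num_faces p f \<alpha>))"
proof -
  interpret prob_space M by fact
  let ?K = "{1..p}" and ?I = "tensor_indices nA N nD"
  let ?Y = "\<lambda>i \<omega>. X \<omega> i"
  have I: "?I = {..<nA} \<times> {..<N} \<times> {..<N} \<times> {..<nD}" by (simp add: tensor_indices_def)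
  have XI: "indep_vars (\<lambda>_. borel) ?Y ?I \<and> (\<forall>i\<in>?I. standard_complex_gaussian M (?Y i))"
    using X unfolding gaussian_tensor_def Let_def I .
  have indep: "indep_vars (\<lambda>_. borel) ?Y ?I" by (rule conjunct1[OF XI])
  have gauss: "standard_complex_gaussian M (?Y i)" if "i \<in> ?I" for i by (rule bspec[OF conjunct2[OF XI] that])
  have finI: "finite ?I" by (simp add: I)
  have conj_mem: "conj_index p f T k \<in> ?I" if "T \<in> ?K \<rightarrow>\<^sub>E ?I" "k \<in> ?K" for T k
  proof -
    have 1: "T k \<in> ?I" "T (cyc_prev p k) \<in> ?I"
      by (rule PiE_mem[OF that(1,2)] PiE_mem[OF that(1) cyc_prev_mem[OF that(2)]])+
    show ?thesis unfolding conj_index_def tensor_index_mem using tensor_indices_D[OF 1(1)] tensor_indices_D[OF 1(2)] by blast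
  qed
  have T: "T ` ?K \<subseteq> ?I" "conj_index p f T ` ?K \<subseteq> ?I" if "T \<in> ?K \<rightarrow>\<^sub>E ?I" for T
    by (rule image_subsetI, erule PiE_mem[OF that] conj_mem[OF that])+
  note W = gaussian_wick[OF indep gauss finI finite_atLeastAtMost[of 1 p] T]
  show "integrable M (\<lambda>\<omega>. mat_trace (mat_word (nA * N) (marginal_mat nA N nD (X \<omega>)) (map f (rev [1..<Suc p]))))"
    unfolding mat_trace_marginal_word[OF p] by (rule Bochner_Integration.integrable_sum) (rule W(1))
  have finP: "finite {\<alpha>. \<alpha> permutes ?K}" by (rule finite_permutations) simp
  have finE: "finite (?K \<rightarrow>\<^sub>E ?I)" by (rule finite_PiE) (auto simp: finI)
  have "(\<integral>\<omega>. mat_trace (mat_word (nA * N) (marginal_mat nA N nD (X \<omega>)) (map f (rev [1..<Suc p]))) \<partial>M) =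
    (\<Sum>T\<in>?K \<rightarrow>\<^sub>E ?I. \<integral>\<omega>. (\<Prod>k\<in>?K. X \<omega> (T k) * cnj (X \<omega> (conj_index p f T k))) \<partial>M)"
    unfolding mat_trace_marginal_word[OF p] by (rule Bochner_Integration.integral_sum) (rule W(1))
  also have "\<dots> = (\<Sum>T\<in>?K \<rightarrow>\<^sub>E ?I. of_nat (card {\<alpha>. \<alpha> permutes ?K \<and> (\<forall>k\<in>?K. T (\<alpha> k) = conj_index p f T k)}))"
    by (intro sum.cong refl) (rule W(2))
  also have "\<dots> = of_nat (\<Sum>T\<in>?K \<rightarrow>\<^sub>E ?I. card {\<alpha> \<in> {\<alpha>. \<alpha> permutes ?K}. \<forall>k\<in>?K. T (\<alpha> k) = conj_index p f T k})" by simp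
  also have "(\<Sum>T\<in>?K \<rightarrow>\<^sub>E ?I. card {\<alpha> \<in> {\<alpha>. \<alpha> permutes ?K}. \<forall>k\<in>?K. T (\<alpha> k) = conj_index p f T k}) =
    (\<Sum>\<alpha> | \<alpha> permutes ?K. card {T \<in> ?K \<rightarrow>\<^sub>E ?I. \<forall>k\<in>?K. T (\<alpha> k) = conj_index p f T k})"
    unfolding card_eq_sum sum.inter_filter[OF finP] sum.inter_filter[OF finE] by (rule sum.swap)
  also have "\<dots> = (\<Sum>\<alpha> | \<alpha> permutes ?K. nA ^ num_cycles ?K (cycle_of_list [1..<Suc p] \<circ> \<alpha>) *
         nD ^ num_cycles ?K \<alpha> * N ^ num_faces p f \<alpha>)"
    by (rule sum.cong[OF refl]) (rule card_index_solutions, simp)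
  finally show "(\<integral>\<omega>. mat_trace (mat_word (nA * N) (marginal_mat nA N nD (X \<omega>)) (map f (rev [1..<Suc p]))) \<partial>M) =
      (\<Sum>\<alpha> | \<alpha> permutes {1..p}. of_nat (nA ^ num_cycles {1..p} (cycle_of_list [1..<Suc p] \<circ> \<alpha>) *
         nD ^ num_cycles {1..p} \<alpha> * N ^ num_faces p f \<alpha>))" by simp
qed

text \<open>With \<rho> the ratio of N_D to N_A, which tends to c, the term is \<rho>^D times N_A^(A
  + D - q) times N^(F - q). The middle factor is merely bounded, so decay must come from F < q; the
  last assumption ensures this outside the case of a non-zero limit.\<close>

lemma genus_term_limit:
  fixes c :: real and NA ND :: "nat \<Rightarrow> nat"
  assumes c: "0 < c" and NA: "\<And>N. 0 < NA N" and lim: "(\<lambda>N. real (ND N)) \<sim>[sequentially] (\<lambda>N. c * real (NA N))"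
    and le: "A + D \<le> q" "F \<le> q" "F = q \<Longrightarrow> A + D = q"
  shows "(\<lambda>N. real (NA N ^ A * ND N ^ D * N ^ F) / real (NA N * N) ^ q) \<longlonglongrightarrow> (if A + D = q \<and> F = q then c ^ D else 0)"
proof -
  define \<rho> where "\<rho> N = real (ND N) / real (NA N)" for N
  have "((\<lambda>N. real (ND N) / (c * real (NA N))) \<longlongrightarrow> 1) sequentially"
    by (rule asymp_equivD_strong[OF lim]) (use c NA in \<open>auto simp: eventually_sequentially\<close>)
  from tendsto_mult[OF this tendsto_const[of c]] have \<rho>: "\<rho> \<longlonglongrightarrow> c"
    unfolding \<rho>_def using c by simp
  have \<rho>0: "0 \<le> \<rho> N" for N by (simp add: \<rho>_def)
  have factor: "real (NA N ^ A * ND N ^ D * N ^ F) / real (NA N * N) ^ q =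
      \<rho> N ^ D * (real (NA N) ^ (A + D) / real (NA N) ^ q) * (real N ^ F / real N ^ q)" if "1 \<le> N" for N
    using NA[of N] that by (simp add: \<rho>_def power_divide power_mult_distrib power_add)
  have ev: "\<forall>\<^sub>F N in sequentially. 1 \<le> N" by (rule eventually_ge_at_top)
  show ?thesis
  proof (cases "A + D = q \<and> F = q")
    case True
    have "\<forall>\<^sub>F N in sequentially. real (NA N ^ A * ND N ^ D * N ^ F) / real (NA N * N) ^ q = \<rho> N ^ D"
      using ev
    proof eventually_elim
      case (elim N)
      show ?case unfolding factor[OF elim] using True NA[of N] elim by simp
    qed
    moreover have "(\<lambda>N. \<rho> N ^ D) \<longlonglongrightarrow> c ^ D" by (rule tendsto_power[OF \<rho>])
    ultimately have "(\<lambda>N. real (NA N ^ A * ND N ^ D * N ^ F) / real (NA N * N) ^ q) \<longlonglongrightarrow> c ^ D"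
      by (simp only: tendsto_cong)
    then show ?thesis unfolding if_P[OF True] .
  next
    case False
    then have F: "F < q" using le by linarith
    have key: "((\<lambda>N. real (NA N ^ A * ND N ^ D * N ^ F) / real (NA N * N) ^ q) \<longlongrightarrow> 0) sequentially"
    proof (rule tendsto_sandwich[where f="\<lambda>_. 0" and h="\<lambda>N. \<rho> N ^ D * (1 / real N)"])
      show "\<forall>\<^sub>F N in sequentially. 0 \<le> real (NA N ^ A * ND N ^ D * N ^ F) / real (NA N * N) ^ q" by simp
      show "\<forall>\<^sub>F N in sequentially. real (NA N ^ A * ND N ^ D * N ^ F) / real (NA N * N) ^ q \<le> \<rho> N ^ D * (1 / real N)"
        using ev
      proof eventually_elim
        case (elim N)
        have a: "real (NA N) ^ (A + D) / real (NA N) ^ q \<le> 1"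
          using NA[of N] le(1) by (simp add: power_increasing)
        have "real N ^ Suc F \<le> real N ^ q" using F elim by (intro power_increasing) auto
        then have b: "real N ^ F / real N ^ q \<le> 1 / real N" using elim by (simp add: field_simps)
        have "\<rho> N ^ D * (real (NA N) ^ (A + D) / real (NA N) ^ q) * (real N ^ F / real N ^ q) \<le> (\<rho> N ^ D * 1) * (1 / real N)"
          by (intro mult_mono a b) (use \<rho>0 in auto)
        then show ?case unfolding factor[OF elim] by simp
      qed
      have "(\<lambda>N. \<rho> N ^ D * (1 / real N)) \<longlonglongrightarrow> c ^ D * 0"
        by (intro tendsto_mult tendsto_power \<rho> lim_1_over_n)
      then show "(\<lambda>N. \<rho> N ^ D * (1 / real N)) \<longlonglongrightarrow> 0" by simp
    qed simp
    show ?thesis using key unfolding if_not_P[OF False] .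
  qed
qed

theorem marginal_word_limit:
  fixes c :: real and NA ND :: "nat \<Rightarrow> nat"
  assumes c: "0 < c" and NA: "\<And>N. 0 < NA N" and lim: "(\<lambda>N. real (ND N)) \<sim>[sequentially] (\<lambda>N. c * real (NA N))"
    and M: "\<And>N. prob_space (M N)" and X: "\<And>N. gaussian_tensor (M N) (NA N) N N (ND N) (X N)"
    and p: "1 \<le> p"
  shows "(\<lambda>N. (\<integral>\<omega>. mat_trace (mat_word (NA N * N) (marginal_mat (NA N) N (ND N) (X N \<omega>)) (map f (rev [1..<Suc p]))) \<partial>M N) /
      of_nat (NA N * N) ^ (p + 1)) \<longlonglongrightarrow> complex_of_real (word_moment c (map f (rev [1..<Suc p])))"
proof -
  let ?K = "{1..p}" and ?\<gamma> = "cycle_of_list [1..<Suc p]"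
  let ?P = "{\<alpha>. \<alpha> permutes ?K}"
  let ?t = "\<lambda>\<alpha> N. real (NA N ^ num_cycles ?K (?\<gamma> \<circ> \<alpha>) * ND N ^ num_cycles ?K \<alpha> * N ^ num_faces p f \<alpha>) / real (NA N * N) ^ (p + 1)"
  have finP: "finite ?P" by (rule finite_permutations) simp
  have \<gamma>: "?\<gamma> permutes ?K"
    using cycle_permutes[of "[1..<Suc p]"] by (simp add: atLeastLessThanSuc_atLeastAtMost del: upt_Suc)
  have eq: "(\<integral>\<omega>. mat_trace (mat_word (NA N * N) (marginal_mat (NA N) N (ND N) (X N \<omega>)) (map f (rev [1..<Suc p]))) \<partial>M N) /
      of_nat (NA N * N) ^ (p + 1) = complex_of_real (\<Sum>\<alpha>\<in>?P. ?t \<alpha> N)" for N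
    unfolding gaussian_tensor_word(2)[OF M X p] sum_divide_distrib of_real_sum
    by (intro sum.cong refl) (simp only: of_real_divide of_real_power of_real_of_nat_eq)
  have term_lim: "?t \<alpha> \<longlonglongrightarrow> (if (\<forall>x. f (\<alpha> x) = f x) \<and> nc_perm \<alpha> then c ^ num_cycles {1..<Suc p} \<alpha> else 0)" if "\<alpha> \<in> ?P" for \<alpha>
  proof -
    have \<alpha>: "\<alpha> permutes ?K" using that by simp
    let ?A = "num_cycles ?K (?\<gamma> \<circ> \<alpha>)" and ?D = "num_cycles ?K \<alpha>"
    have le: "?A + ?D \<le> p + 1" using num_cycles_planar_le[OF p \<alpha>] by linarith
    have mono: "(\<forall>x. f (\<alpha> x) = f x) \<longleftrightarrow> (\<forall>k\<in>?K. f (\<alpha> k) = f k)" using permutes_not_in[OF \<alpha>] by metis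
    have planar: "?A + ?D = p + 1 \<longleftrightarrow> nc_perm \<alpha>"
      using planar_iff_nc_perm[OF p \<alpha> order.refl] num_cycles_comm[OF \<alpha> \<gamma> finite_atLeastAtMost]
      by (simp only: add.commute)
    have F: "num_faces p f \<alpha> \<le> p + 1" "num_faces p f \<alpha> = p + 1 \<Longrightarrow> ?A + ?D = p + 1"
      "(?A + ?D = p + 1 \<and> num_faces p f \<alpha> = p + 1) \<longleftrightarrow> (\<forall>k\<in>?K. f (\<alpha> k) = f k) \<and> ?A + ?D = p + 1"
    proof -
      \<comment> \<open>For monochrome \<alpha> the exponent of N is the planarity count itself;
        otherwise it falls short of p + 1 whether or not \<alpha> is planar.\<close>
      consider "\<forall>k\<in>?K. f (\<alpha> k) = f k" "num_faces p f \<alpha> = ?A + ?D"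
        | "\<not> (\<forall>k\<in>?K. f (\<alpha> k) = f k)" "num_faces p f \<alpha> \<le> p"
        using num_faces_monochrome[OF \<alpha>] num_faces_mixed[OF \<alpha>] by blast
      then show "num_faces p f \<alpha> \<le> p + 1" "num_faces p f \<alpha> = p + 1 \<Longrightarrow> ?A + ?D = p + 1"
        "(?A + ?D = p + 1 \<and> num_faces p f \<alpha> = p + 1) \<longleftrightarrow> (\<forall>k\<in>?K. f (\<alpha> k) = f k) \<and> ?A + ?D = p + 1"
        using le by (cases; linarith)+
    qed
    have "?t \<alpha> \<longlonglongrightarrow> (if ?A + ?D = p + 1 \<and> num_faces p f \<alpha> = p + 1 then c ^ ?D else 0)"
      by (rule genus_term_limit[OF c NA lim le F(1,2)])
    also have "(?A + ?D = p + 1 \<and> num_faces p f \<alpha> = p + 1) \<longleftrightarrow> (\<forall>x. f (\<alpha> x) = f x) \<and> nc_perm \<alpha>"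
      using F(3) unfolding mono planar .
    finally show ?thesis by (simp only: atLeastLessThanSuc_atLeastAtMost)
  qed
  have "(\<lambda>N. \<Sum>\<alpha>\<in>?P. ?t \<alpha> N) \<longlonglongrightarrow>
      (\<Sum>\<alpha>\<in>?P. if (\<forall>x. f (\<alpha> x) = f x) \<and> nc_perm \<alpha> then c ^ num_cycles {1..<Suc p} \<alpha> else 0)"
    by (rule tendsto_sum[OF term_lim])
  also have "(\<Sum>\<alpha>\<in>?P. if (\<forall>x. f (\<alpha> x) = f x) \<and> nc_perm \<alpha> then c ^ num_cycles {1..<Suc p} \<alpha> else 0) = nc_sum c f 1 (Suc p)"
    unfolding nc_sum_def nc_perms_def sum.inter_filter[OF finP, symmetric]
    by (rule sum.cong) (auto simp: atLeastLessThanSuc_atLeastAtMost)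
  also have "\<dots> = word_moment c (map f (rev [1..<Suc p]))" by (rule nc_sum_eq_word_moment) simp
  finally show ?thesis unfolding eq by (rule tendsto_of_real)
qed

section \<open>The limit as a sum over partitions and over maps\<close>

lemma orbit_invariant_function:
  assumes "\<And>x. f (\<alpha> x) = f x" "y \<in> orbit \<alpha> x" shows "f y = f x"
  using orbit_subset_invariant[of x "{y. f y = f x}" \<alpha>] assms by auto

lemma partition_on_ker_partition: "partition_on {1..p} (ker_partition p f)"
proof (rule partition_onI)
  have "f i = AB \<or> f i = AC" for i by (cases "f i") simp_all
  then show "\<Union> (ker_partition p f) = {1..p}" unfolding ker_partition_def by blast
  show "{} \<notin> ker_partition p f" by (simp add: ker_partition_def)
qed (auto simp: ker_partition_def disjnt_def)

lemma refines_ker_partition_iff: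
  assumes \<alpha>: "\<alpha> permutes {1..p}"
  shows "refines {1..p} (cycles p \<alpha>) (ker_partition p f) \<longleftrightarrow> (\<forall>x. f (\<alpha> x) = f x)"
proof
  assume r: "refines {1..p} (cycles p \<alpha>) (ker_partition p f)"
  show "\<forall>x. f (\<alpha> x) = f x"
  proof
    fix x
    show "f (\<alpha> x) = f x"
    proof (cases "x \<in> {1..p}")
      case True
      then have "orbit \<alpha> x \<in> cycles p \<alpha>" by (simp add: cycles_conv)
      then obtain Y where Y: "Y \<in> ker_partition p f" "orbit \<alpha> x \<subseteq> Y" using r unfolding refines_def by blast
      have "x \<in> Y" "\<alpha> x \<in> Y" using Y(2) self_in_orbit_permutes[OF \<alpha> finite_atLeastAtMost] orbit.base[of \<alpha> x] by blast+
      then show ?thesis using Y(1) unfolding ker_partition_def by auto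
    next
      case False
      then show ?thesis using permutes_not_in[OF \<alpha> False] by simp
    qed
  qed
next
  assume f: "\<forall>x. f (\<alpha> x) = f x"
  show "refines {1..p} (cycles p \<alpha>) (ker_partition p f)"
    unfolding refines_def
  proof (intro conjI ballI partition_on_cycles[OF \<alpha>] partition_on_ker_partition)
    fix C assume "C \<in> cycles p \<alpha>"
    then obtain x where x: "x \<in> {1..p}" "C = orbit \<alpha> x" unfolding cycles_conv by auto
    let ?Y = "{i \<in> {1..p}. f i = f x}"
    have "C \<subseteq> ?Y"
      using orbit_invariant_function[of f \<alpha>] f permutes_orbit_subset[OF \<alpha> x(1)] unfolding x(2) by blast
    moreover have "?Y \<in> ker_partition p f"
    proof -
      have "?Y \<noteq> {}" using x by blast
      then show ?thesis unfolding ker_partition_def by (cases "f x") auto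
    qed
    ultimately show "\<exists>Y\<in>ker_partition p f. C \<subseteq> Y" by blast
  qed
qed

lemma NC_sum_eq_nc_sum:
  "(\<Sum>\<alpha> | \<alpha> \<in> NC p \<and> refines {1..p} \<alpha> (ker_partition p f). c ^ card \<alpha>) = nc_sum c f 1 (Suc p)"
proof -
  have K: "{1..<Suc p} = {1..p}" by auto
  have "bij_betw (cycles p) (nc_perms f 1 (Suc p)) {P. P \<in> NC p \<and> refines {1..p} P (ker_partition p f)}"
  proof (rule bij_betw_imageI)
    show "inj_on (cycles p) (nc_perms f 1 (Suc p))"
      by (rule inj_on_subset[OF bij_betw_imp_inj_on[OF bij_betw_cycles_NC]]) (unfold nc_perms_def K, blast)
    show "cycles p ` nc_perms f 1 (Suc p) = {P. P \<in> NC p \<and> refines {1..p} P (ker_partition p f)}"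
    proof (intro equalityI subsetI)
      fix P assume "P \<in> cycles p ` nc_perms f 1 (Suc p)"
      then obtain \<alpha> where "\<alpha> permutes {1..p}" "nc_perm \<alpha>" "\<forall>x. f (\<alpha> x) = f x" "P = cycles p \<alpha>"
        unfolding nc_perms_def K by auto
      then show "P \<in> {P. P \<in> NC p \<and> refines {1..p} P (ker_partition p f)}"
        using cycles_nc_perm_in_NC refines_ker_partition_iff by blast
    next
      fix P assume P: "P \<in> {P. P \<in> NC p \<and> refines {1..p} P (ker_partition p f)}"
      then obtain \<alpha> where \<alpha>: "\<alpha> permutes {1..p}" "nc_perm \<alpha>" "cycles p \<alpha> = P" using NC_ex_nc_perm by blast
      then have "\<alpha> \<in> nc_perms f 1 (Suc p)"
        using P refines_ker_partition_iff[OF \<alpha>(1), of f] unfolding nc_perms_def K by auto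
      then show "P \<in> cycles p ` nc_perms f 1 (Suc p)" using \<alpha>(3) by blast
    qed
  qed
  from sum.reindex_bij_betw[OF this, of "\<lambda>P. c ^ card P", symmetric] show ?thesis
    unfolding nc_sum_def K card_cycles .
qed

lemma planar_sum_eq_nc_sum:
  assumes p: "1 \<le> p"
  shows "(\<Sum>m | m \<in> planar_maps p \<and> bicolored_vertices p f m = 0. c ^ (num_vertices p m - 1)) = nc_sum c f 1 (Suc p)"
proof -
  let ?\<gamma> = "cycle_of_list [1..<Suc p]"
  have K: "{1..<Suc p} = {1..p}" by auto
  have \<gamma>: "?\<gamma> permutes {1..p}"
    using cycle_permutes[of "[1..<Suc p]"] by (simp add: atLeastLessThanSuc_atLeastAtMost del: upt_Suc)
  have planar: "card (cycles p \<alpha>) + card (cycles p (?\<gamma> \<circ> \<alpha>)) = p + 1 \<longleftrightarrow> nc_perm \<alpha>" if "\<alpha> permutes {1..p}" for \<alpha>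
    unfolding card_cycles num_cycles_comm[OF \<gamma> that finite_atLeastAtMost] by (rule planar_iff_nc_perm[OF p that order.refl])
  have mono: "bicolored_vertices p f (?\<gamma>, \<alpha>) = 0 \<longleftrightarrow> (\<forall>x. f (\<alpha> x) = f x)" if \<alpha>: "\<alpha> permutes {1..p}" for \<alpha>
  proof -
    let ?V = "{v \<in> cycles p \<alpha>. (\<exists>a\<in>v. f a = AB) \<and> (\<exists>a\<in>v. f a = AC)}"
    have "finite ?V" by (simp add: cycles_conv)
    then have "bicolored_vertices p f (?\<gamma>, \<alpha>) = 0 \<longleftrightarrow> ?V = {}"
      unfolding bicolored_vertices_def white_vertices_def snd_conv by (rule card_0_eq)
    also have "\<dots> \<longleftrightarrow> (\<forall>x. f (\<alpha> x) = f x)"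
    proof
      assume V: "?V = {}"
      show "\<forall>x. f (\<alpha> x) = f x"
      proof
        fix x
        show "f (\<alpha> x) = f x"
        proof (cases "x \<in> {1..p}")
          case True
          have "orbit \<alpha> x \<notin> ?V" using V by blast
          moreover have "orbit \<alpha> x \<in> cycles p \<alpha>" using True by (simp add: cycles_conv)
          ultimately have "\<not> ((\<exists>a\<in>orbit \<alpha> x. f a = AB) \<and> (\<exists>a\<in>orbit \<alpha> x. f a = AC))" by blast
          moreover have "x \<in> orbit \<alpha> x" "\<alpha> x \<in> orbit \<alpha> x"
            by (rule self_in_orbit_permutes[OF \<alpha> finite_atLeastAtMost] orbit.base)+
          moreover have "f (\<alpha> x) = f x \<or> f x = AB \<and> f (\<alpha> x) = AC \<or> f x = AC \<and> f (\<alpha> x) = AB"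
            by (cases "f x"; cases "f (\<alpha> x)"; simp)
          ultimately show ?thesis by blast
        next
          case False
          then show ?thesis using permutes_not_in[OF \<alpha> False] by simp
        qed
      qed
    next
      assume f: "\<forall>x. f (\<alpha> x) = f x"
      show "?V = {}"
      proof (rule ccontr)
        assume "?V \<noteq> {}"
        then obtain x a b where ab: "a \<in> orbit \<alpha> x" "b \<in> orbit \<alpha> x" "f a = AB" "f b = AC" unfolding cycles_conv by blast
        have "f y = f x" if "y \<in> orbit \<alpha> x" for y
          by (rule orbit_invariant_function[of f \<alpha>, OF _ that]) (use f in simp)
        from this[OF ab(1)] this[OF ab(2)] show False using ab(3,4) by simp
      qed
    qed
    finally show ?thesis .
  qed
  have set: "{m. m \<in> planar_maps p \<and> bicolored_vertices p f m = 0} = Pair ?\<gamma> ` nc_perms f 1 (Suc p)"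
  proof (intro equalityI subsetI)
    fix m assume m: "m \<in> {m. m \<in> planar_maps p \<and> bicolored_vertices p f m = 0}"
    then obtain \<alpha> where \<alpha>: "m = (?\<gamma>, \<alpha>)" "\<alpha> permutes {1..p}" "card (cycles p \<alpha>) + card (cycles p (?\<gamma> \<circ> \<alpha>)) = p + 1"
      unfolding planar_maps_def maps_def by auto
    then have "\<alpha> \<in> nc_perms f 1 (Suc p)"
      using planar[OF \<alpha>(2)] mono[OF \<alpha>(2)] m unfolding nc_perms_def K by auto
    then show "m \<in> Pair ?\<gamma> ` nc_perms f 1 (Suc p)" using \<alpha>(1) by blast
  next
    fix m assume "m \<in> Pair ?\<gamma> ` nc_perms f 1 (Suc p)"
    then obtain \<alpha> where \<alpha>: "m = (?\<gamma>, \<alpha>)" "\<alpha> permutes {1..p}" "nc_perm \<alpha>" "\<forall>x. f (\<alpha> x) = f x"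
      unfolding nc_perms_def K by auto
    then show "m \<in> {m. m \<in> planar_maps p \<and> bicolored_vertices p f m = 0}"
      using planar[OF \<alpha>(2)] mono[OF \<alpha>(2)] unfolding planar_maps_def maps_def by simp
  qed
  have "(\<Sum>m\<in>Pair ?\<gamma> ` nc_perms f 1 (Suc p). c ^ (num_vertices p m - 1)) =
    (\<Sum>\<alpha>\<in>nc_perms f 1 (Suc p). c ^ (num_vertices p (?\<gamma>, \<alpha>) - 1))"
    by (subst sum.reindex) (simp_all add: inj_on_def comp_def)
  then show ?thesis
    unfolding set nc_sum_def num_vertices_def white_vertices_def snd_conv card_cycles K by simp
qed

section \<open>Traces of polynomials in Hermitian matrices, for the positivity of the limit\<close>

lemma mult_entry:
  assumes "A \<in> carrier_mat n n" "B \<in> carrier_mat n n" "i < n" "j < n"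
  shows "(A * B) $$ (i, j) = (\<Sum>k<n. A $$ (i, k) * B $$ (k, j))"
  using assms by (simp add: scalar_prod_def atLeast0LessThan)

lemma mat_word_append:
  assumes A: "\<And>l. A l \<in> carrier_mat n n"
  shows "mat_word n A (u @ v) = mat_word n A u * mat_word n A v"
proof (induction u)
  case Nil
  have "mat_word n A [] = 1\<^sub>m n" by (simp add: mat_word_def)
  then show ?case using left_mult_one_mat[OF mat_word_carrier[of A, OF A], of v] by simp
next
  case (Cons l u)
  then show ?case
    using assoc_mult_mat[OF A[of l] mat_word_carrier[of A, OF A, of u] mat_word_carrier[of A, OF A, of v]] by (simp add: mat_word_Cons)
qed

text \<open>Adjoints reverse products and the letters are Hermitian; so the matrices realise the
  involution \<open>nc_star\<close>.\<close>

lemma mat_word_rev: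
  assumes A: "\<And>l. A l \<in> carrier_mat n n"
    and herm: "\<And>l i j. i < n \<Longrightarrow> j < n \<Longrightarrow> A l $$ (i, j) = cnj (A l $$ (j, i))"
    and ij: "i < n" "j < n"
  shows "mat_word n A (rev w) $$ (i, j) = cnj (mat_word n A w $$ (j, i))"
  using ij
proof (induction w arbitrary: i j)
  case Nil then show ?case by (simp add: mat_word_def)
next
  case (Cons l w)
  note C = mat_word_carrier[of A, OF A]
  have one: "mat_word n A [l] = A l" using A[of l] by (simp add: mat_word_def right_mult_one_mat)
  have "mat_word n A (rev (l # w)) $$ (i, j) = (mat_word n A (rev w) * A l) $$ (i, j)"
    by (simp add: mat_word_append[OF A] one)
  also have "\<dots> = (\<Sum>k<n. mat_word n A (rev w) $$ (i, k) * A l $$ (k, j))" by (rule mult_entry[OF C A Cons.prems])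
  also have "\<dots> = (\<Sum>k<n. cnj (A l $$ (j, k) * mat_word n A w $$ (k, i)))"
  proof (rule sum.cong[OF refl])
    fix k assume "k \<in> {..<n}"
    then have k: "k < n" by simp
    show "mat_word n A (rev w) $$ (i, k) * A l $$ (k, j) = cnj (A l $$ (j, k) * mat_word n A w $$ (k, i))"
      unfolding Cons.IH[OF Cons.prems(1) k] herm[OF k Cons.prems(2), of l] by simp
  qed
  also have "\<dots> = cnj ((A l * mat_word n A w) $$ (j, i))"
    unfolding mult_entry[OF A C Cons.prems(2,1)] by simp
  finally show ?case unfolding mat_word_Cons .
qed

lemma sum_sum_swap:
  "(\<Sum>u\<in>K. \<Sum>v\<in>L. \<Sum>i\<in>I. \<Sum>k\<in>J. h u v i k) = (\<Sum>i\<in>I. \<Sum>k\<in>J. \<Sum>u\<in>K. \<Sum>v\<in>L. h u v i k)"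
proof -
  have "(\<Sum>u\<in>K. \<Sum>v\<in>L. \<Sum>i\<in>I. \<Sum>k\<in>J. h u v i k) = (\<Sum>u\<in>K. \<Sum>i\<in>I. \<Sum>v\<in>L. \<Sum>k\<in>J. h u v i k)"
    by (rule sum.cong[OF refl]) (rule sum.swap)
  also have "\<dots> = (\<Sum>i\<in>I. \<Sum>u\<in>K. \<Sum>v\<in>L. \<Sum>k\<in>J. h u v i k)" by (rule sum.swap)
  also have "\<dots> = (\<Sum>i\<in>I. \<Sum>u\<in>K. \<Sum>k\<in>J. \<Sum>v\<in>L. h u v i k)"
    by (rule sum.cong[OF refl], rule sum.cong[OF refl]) (rule sum.swap)
  also have "\<dots> = (\<Sum>i\<in>I. \<Sum>k\<in>J. \<Sum>u\<in>K. \<Sum>v\<in>L. h u v i k)"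
    by (rule sum.cong[OF refl]) (rule sum.swap)
  finally show ?thesis .
qed

text \<open>For the linear combination Q of the words g v with coefficients a v, the left side is
  the trace of the adjoint of Q times Q, hence the sum of the squared moduli of the entries of
  Q.\<close>

lemma gram_trace:
  assumes A: "\<And>l. A l \<in> carrier_mat n n"
    and herm: "\<And>l i j. i < n \<Longrightarrow> j < n \<Longrightarrow> A l $$ (i, j) = cnj (A l $$ (j, i))"
  shows "(\<Sum>u\<in>K. \<Sum>v\<in>K. cnj (a u) * a v * mat_trace (mat_word n A (rev (g u) @ g v))) =
    complex_of_real (\<Sum>i<n. \<Sum>k<n. (cmod (\<Sum>v\<in>K. a v * mat_word n A (g v) $$ (k, i)))\<^sup>2)"
proof -
  let ?W = "\<lambda>u. mat_word n A (g u)"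
  note C = mat_word_carrier[of A, OF A]
  have tr: "mat_trace (mat_word n A (rev (g u) @ g v)) = (\<Sum>i<n. \<Sum>k<n. cnj (?W u $$ (k, i)) * ?W v $$ (k, i))" for u v
  proof -
    have dim: "dim_row (mat_word n A (rev (g u) @ g v)) = n" by (rule carrier_matD(1)[OF C])
    show ?thesis
      unfolding mat_trace_def dim unfolding mat_word_append[OF A]
    proof (rule sum.cong[OF refl])
      fix i assume "i \<in> {..<n}"
      then have i: "i < n" by simp
      show "(mat_word n A (rev (g u)) * ?W v) $$ (i, i) = (\<Sum>k<n. cnj (?W u $$ (k, i)) * ?W v $$ (k, i))"
        unfolding mult_entry[OF C C i i] by (rule sum.cong[OF refl]) (simp add: mat_word_rev[OF A herm i])
    qed
  qed
  have "(\<Sum>u\<in>K. \<Sum>v\<in>K. cnj (a u) * a v * mat_trace (mat_word n A (rev (g u) @ g v))) =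
    (\<Sum>u\<in>K. \<Sum>v\<in>K. \<Sum>i<n. \<Sum>k<n. cnj (a u * ?W u $$ (k, i)) * (a v * ?W v $$ (k, i)))"
    unfolding tr sum_distrib_left by (intro sum.cong refl) (simp add: mult_ac)
  also have "\<dots> = (\<Sum>i<n. \<Sum>k<n. \<Sum>u\<in>K. \<Sum>v\<in>K. cnj (a u * ?W u $$ (k, i)) * (a v * ?W v $$ (k, i)))"
    by (rule sum_sum_swap)
  also have "\<dots> = (\<Sum>i<n. \<Sum>k<n. complex_of_real ((cmod (\<Sum>v\<in>K. a v * ?W v $$ (k, i)))\<^sup>2))"
  proof (intro sum.cong refl)
    fix i k
    let ?z = "\<Sum>v\<in>K. a v * ?W v $$ (k, i)"
    have "(\<Sum>u\<in>K. \<Sum>v\<in>K. cnj (a u * ?W u $$ (k, i)) * (a v * ?W v $$ (k, i))) = cnj ?z * ?z"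
      unfolding sum_product[symmetric] cnj_sum ..
    also have "\<dots> = complex_of_real ((cmod ?z)\<^sup>2)" using complex_norm_square[of ?z] by (simp add: mult.commute)
    finally show "(\<Sum>u\<in>K. \<Sum>v\<in>K. cnj (a u * ?W u $$ (k, i)) * (a v * ?W v $$ (k, i))) = complex_of_real ((cmod ?z)\<^sup>2)" .
  qed
  finally show ?thesis by simp
qed

lemma mat_word_smult:
  assumes A: "\<And>l. A l \<in> carrier_mat n n"
  shows "mat_word n (\<lambda>l. r \<cdot>\<^sub>m A l) w = r ^ length w \<cdot>\<^sub>m mat_word n A w"
proof (induction w)
  case (Cons l w)
  have "(r \<cdot>\<^sub>m A l) * (r ^ length w \<cdot>\<^sub>m mat_word n A w) = r \<cdot>\<^sub>m (A l * (r ^ length w \<cdot>\<^sub>m mat_word n A w))"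
    by (rule mult_smult_assoc_mat[OF A smult_carrier_mat[OF mat_word_carrier[of A, OF A]]])
  also have "A l * (r ^ length w \<cdot>\<^sub>m mat_word n A w) = r ^ length w \<cdot>\<^sub>m (A l * mat_word n A w)"
    by (rule mult_smult_distrib[OF A mat_word_carrier[of A, OF A]])
  finally show ?case
    unfolding mat_word_Cons Cons by (intro eq_matI) (simp_all add: mult.assoc)
next
  case Nil
  have "1\<^sub>m n = 1 \<cdot>\<^sub>m (1\<^sub>m n :: complex mat)" by (rule eq_matI) simp_all
  then show ?case by (simp add: mat_word_def)
qed

lemma mat_trace_smult: "mat_trace (r \<cdot>\<^sub>m B) = r * mat_trace B" if "B \<in> carrier_mat n n"
  using that unfolding mat_trace_def by (simp add: sum_distrib_left)

lemma marginal_mat_hermitian: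
  assumes "i < nA * N" "j < nA * N"
  shows "marginal_mat nA N nD X l $$ (i, j) = cnj (marginal_mat nA N nD X l $$ (j, i))"
  using assms unfolding marginal_mat_def by (simp add: marginal_entry_tensor_index mult.commute)

lemma moment_functional_star_mult:
  "moment_functional c (nc_star P * P) =
   (\<Sum>u\<in>Poly_Mapping.keys P. \<Sum>v\<in>Poly_Mapping.keys P.
     cnj (Poly_Mapping.lookup P u) * Poly_Mapping.lookup P v * word_moment c (rev (letters u) @ letters v))"
proof -
  let ?K = "Poly_Mapping.keys P" and ?a = "Poly_Mapping.lookup P"
  have P: "P = (\<Sum>k\<in>?K. Poly_Mapping.single k (?a k))"
    by (rule poly_mapping_eqI) (auto simp: lookup_sum lookup_single when_def in_keys_iff)
  have "nc_star P = (\<Sum>k\<in>?K. Poly_Mapping.single (rev_word k) (cnj (?a k)))"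
  proof -
    have "nc_star (sum h K) = (\<Sum>k\<in>K. nc_star (h k))" for h :: "'a free_monoid \<Rightarrow> 'a nc_poly" and K
    proof (induction K rule: infinite_finite_induct)
      case (insert x F) then show ?case by (simp add: nc_star_add)
    qed (rule poly_mapping_eqI, simp add: lookup_nc_star)+
    then show ?thesis by (subst P) (simp add: nc_star_single)
  qed
  then have "nc_star P * P = (\<Sum>k\<in>?K. Poly_Mapping.single (rev_word k) (cnj (?a k))) * (\<Sum>k\<in>?K. Poly_Mapping.single k (?a k))"
    using P by simp
  also have "\<dots> = (\<Sum>u\<in>?K. \<Sum>v\<in>?K. Poly_Mapping.single (rev_word u + v) (cnj (?a u) * ?a v))"
    by (simp add: sum_product mult_single)
  finally show ?thesis
    by (simp add: moment_functional_sum rev_word_def plus_free_monoid_def)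
qed

text \<open>Puts an arbitrary word into the form for which the limit was computed; positions count
  from the right end, starting at 1.\<close>

lemma word_as_positions: "w = map (\<lambda>k. w ! (length w - k)) (rev [1..<Suc (length w)])"
  by (rule nth_equalityI) (simp_all add: rev_nth del: upt_Suc)

theorem theorem3p6:
  fixes c :: real
    and NA ND :: "nat \<Rightarrow> nat"
    and M :: "nat \<Rightarrow> 'w measure"
    and X :: "nat \<Rightarrow> 'w \<Rightarrow> tensor"
  assumes "0 < c"
    and "\<And>N. 0 < NA N"
    and "\<And>N. 0 < ND N"
    and "(\<lambda>N. real (ND N)) \<sim>[sequentially] (\<lambda>N. c * real (NA N))"
    and "\<And>N. prob_space (M N)"
    and "\<And>N. gaussian_tensor (M N) (NA N) N N (ND N) (X N)"
  shows
    "(\<exists>sc star \<phi> (x :: marginal \<Rightarrow> marginal nc_poly).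
        star_prob_space sc star \<phi> \<and>
        (\<forall>l. star (x l) = x l) \<and>
        free_elements sc \<phi> x \<and>
        has_distribution \<phi> (x AB) (MP c) \<and>
        has_distribution \<phi> (x AC) (MP c) \<and>
        converges_in_distribution M (\<lambda>N. NA N * N)
          (\<lambda>N \<omega> l. (1 / of_nat (NA N * N)) \<cdot>\<^sub>m marginal_mat (NA N) N (ND N) (X N \<omega>) l) \<phi> x) \<and>
     (\<forall>p\<ge>1. \<forall>f :: nat \<Rightarrow> marginal.
        (\<lambda>N. \<integral>\<omega>. mat_trace (mat_word (NA N * N) (marginal_mat (NA N) N (ND N) (X N \<omega>))
                    (map f (rev [1..<Suc p]))) / of_nat (NA N * N) ^ (p + 1) \<partial>M N)
          \<longlonglongrightarrow> complex_of_real
                (\<Sum>\<alpha> | \<alpha> \<in> NC p \<and> refines {1..p} \<alpha> (ker_partition p f). c ^ card \<alpha>)) \<and>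
     (\<forall>p\<ge>1. \<forall>f :: nat \<Rightarrow> marginal.
        (\<Sum>\<alpha> | \<alpha> \<in> NC p \<and> refines {1..p} \<alpha> (ker_partition p f). c ^ card \<alpha>) =
        (\<Sum>m | m \<in> planar_maps p \<and> bicolored_vertices p f m = 0. c ^ (num_vertices p m - 1)))"
proof (intro conjI allI impI)
  fix p :: nat and f :: "nat \<Rightarrow> marginal" assume p: "1 \<le> p"
  show "(\<Sum>\<alpha> | \<alpha> \<in> NC p \<and> refines {1..p} \<alpha> (ker_partition p f). c ^ card \<alpha>) =
        (\<Sum>m | m \<in> planar_maps p \<and> bicolored_vertices p f m = 0. c ^ (num_vertices p m - 1))"
    unfolding NC_sum_eq_nc_sum planar_sum_eq_nc_sum[OF p] ..
next
  fix p :: nat and f :: "nat \<Rightarrow> marginal" assume p: "1 \<le> p"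
  have "nc_sum c f 1 (Suc p) = word_moment c (map f (rev [1..<Suc p]))" by (rule nc_sum_eq_word_moment) simp
  then show "(\<lambda>N. \<integral>\<omega>. mat_trace (mat_word (NA N * N) (marginal_mat (NA N) N (ND N) (X N \<omega>))
                    (map f (rev [1..<Suc p]))) / of_nat (NA N * N) ^ (p + 1) \<partial>M N)
          \<longlonglongrightarrow> complex_of_real
                (\<Sum>\<alpha> | \<alpha> \<in> NC p \<and> refines {1..p} \<alpha> (ker_partition p f). c ^ card \<alpha>)"
    unfolding NC_sum_eq_nc_sum integral_divide_zero
    using marginal_word_limit[OF assms(1,2,4,5,6) p, where f=f] by (simp only:)
next
  let ?n = "\<lambda>N. NA N * N"
  define W where "W N \<omega> l = marginal_mat (NA N) N (ND N) (X N \<omega>) l" for N \<omega> l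
  define A where "A N \<omega> l = (1 / of_nat (?n N)) \<cdot>\<^sub>m W N \<omega> l" for N \<omega> l
  have W: "W N \<omega> l \<in> carrier_mat (?n N) (?n N)" for N \<omega> l unfolding W_def by (rule marginal_mat_carrier)
  then have A: "A N \<omega> l \<in> carrier_mat (?n N) (?n N)" for N \<omega> l unfolding A_def by simp
  have herm: "A N \<omega> l $$ (i, j) = cnj (A N \<omega> l $$ (j, i))" if "i < ?n N" "j < ?n N" for N \<omega> l i j
    using marginal_mat_hermitian[OF that, of "ND N" "X N \<omega>" l] that W[of N \<omega> l] unfolding A_def W_def by simp
  have trA: "mat_trace (mat_word (?n N) (A N \<omega>) w) = mat_trace (mat_word (?n N) (W N \<omega>) w) / of_nat (?n N) ^ length w" for N \<omega> w
  proof -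
    have "mat_word (?n N) (A N \<omega>) w = (1 / of_nat (?n N)) ^ length w \<cdot>\<^sub>m mat_word (?n N) (W N \<omega>) w"
      unfolding A_def[abs_def] by (rule mat_word_smult[OF W])
    then show ?thesis using mat_trace_smult[OF mat_word_carrier[of "W N \<omega>", OF W], of "(1 / of_nat (?n N)) ^ length w" w]
      by (simp add: power_divide)
  qed
  have int: "integrable (M N) (\<lambda>\<omega>. mat_trace (mat_word (?n N) (A N \<omega>) w))" for N and w :: "marginal list"
  proof (cases "w = []")
    case True
    interpret prob_space "M N" by (rule assms(5))
    show ?thesis unfolding True mat_word_def by simp
  next
    case False
    then have "1 \<le> length w" by (cases w) auto
    from gaussian_tensor_word(1)[OF assms(5,6) this, where f="\<lambda>k. w ! (length w - k)"]
    have "integrable (M N) (\<lambda>\<omega>. mat_trace (mat_word (?n N) (W N \<omega>) w))"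
      unfolding W_def[abs_def] word_as_positions[symmetric] .
    then show ?thesis unfolding trA by (rule integrable_divide_zero)
  qed
  have lim: "(\<lambda>N. \<integral>\<omega>. mat_trace (mat_word (?n N) (A N \<omega>) w) / of_nat (?n N) \<partial>M N) \<longlonglongrightarrow> complex_of_real (word_moment c w)"
    for w :: "marginal list"
  proof (cases "w = []")
    case True
    \<comment> \<open>For N = 0 the matrices are empty and the quotient is 0, so the value 1 holds
      only eventually.\<close>
    have "\<forall>\<^sub>F N in sequentially. (\<integral>\<omega>. mat_trace (mat_word (?n N) (A N \<omega>) w) / of_nat (?n N) \<partial>M N) = 1"
      using eventually_ge_at_top[of 1]
    proof eventually_elim
      case (elim N)
      interpret prob_space "M N" by (rule assms(5))
      have "?n N \<noteq> 0" using assms(2)[of N] elim by simp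
      then have "mat_trace (mat_word (?n N) (A N \<omega>) w) / of_nat (?n N) = 1" for \<omega>
        unfolding True mat_word_def mat_trace_def by simp
      then show ?case by (simp only: lebesgue_integral_const prob_space) simp
    qed
    then show ?thesis unfolding True by (simp add: tendsto_eventually)
  next
    case False
    then have p: "1 \<le> length w" by (cases w) auto
    have "(\<integral>\<omega>. mat_trace (mat_word (?n N) (A N \<omega>) w) / of_nat (?n N) \<partial>M N) =
      (\<integral>\<omega>. mat_trace (mat_word (?n N) (W N \<omega>) w) \<partial>M N) / of_nat (?n N) ^ (length w + 1)" for N
      unfolding trA by (simp add: divide_divide_eq_left)
    moreover have "(\<lambda>N. (\<integral>\<omega>. mat_trace (mat_word (?n N) (W N \<omega>) w) \<partial>M N) / of_nat (?n N) ^ (length w + 1)) \<longlonglongrightarrow> complex_of_real (word_moment c w)"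
      using marginal_word_limit[OF assms(1,2,4,5,6) p, where f="\<lambda>k. w ! (length w - k)"]
      unfolding W_def[abs_def] word_as_positions[symmetric] .
    ultimately show ?thesis by (simp only:)
  qed
  \<comment> \<open>The value is the limit of expected normalised traces of the adjoint of Q times
    Q, where Q is the polynomial a evaluated at the matrices; these are non-negative, and the
    non-negative reals are closed.\<close>
  have pos: "moment_functional c (nc_star a * a) \<in> \<real>\<^sub>\<ge>\<^sub>0" for a :: "marginal nc_poly"
  proof -
    let ?K = "Poly_Mapping.keys a" and ?a = "Poly_Mapping.lookup a"
    let ?t = "\<lambda>N \<omega> u v. mat_trace (mat_word (?n N) (A N \<omega>) (rev (letters u) @ letters v))"
    let ?L = "\<lambda>N. \<Sum>u\<in>?K. \<Sum>v\<in>?K. cnj (?a u) * ?a v * (\<integral>\<omega>. ?t N \<omega> u v / of_nat (?n N) \<partial>M N)"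
    have L: "?L \<longlonglongrightarrow> moment_functional c (nc_star a * a)"
      unfolding moment_functional_star_mult by (intro tendsto_sum tendsto_mult tendsto_const lim)
    have L0: "?L N \<in> \<real>\<^sub>\<ge>\<^sub>0" for N
    proof -
      define h where "h \<omega> = (\<Sum>i<?n N. \<Sum>k<?n N. (cmod (\<Sum>v\<in>?K. ?a v * mat_word (?n N) (A N \<omega>) (letters v) $$ (k, i)))\<^sup>2)" for \<omega>
      have "?L N = (\<integral>\<omega>. (\<Sum>u\<in>?K. \<Sum>v\<in>?K. cnj (?a u) * ?a v * ?t N \<omega> u v) \<partial>M N) / of_nat (?n N)"
        unfolding integral_divide_zero by (simp add: int sum_divide_distrib mult.assoc)
      also have "(\<integral>\<omega>. (\<Sum>u\<in>?K. \<Sum>v\<in>?K. cnj (?a u) * ?a v * ?t N \<omega> u v) \<partial>M N) = (\<integral>\<omega>. complex_of_real (h \<omega>) \<partial>M N)"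
        by (simp only: h_def gram_trace[where a="?a" and g=letters and K="?K", OF A herm])
      also have "\<dots> / of_nat (?n N) = complex_of_real ((\<integral>\<omega>. h \<omega> \<partial>M N) / real (?n N))" by simp
      finally have e: "?L N = complex_of_real ((\<integral>\<omega>. h \<omega> \<partial>M N) / real (?n N))" .
      have "0 \<le> h \<omega>" for \<omega> unfolding h_def by (intro sum_nonneg) simp
      then have "0 \<le> (\<integral>\<omega>. h \<omega> \<partial>M N) / real (?n N)" by (intro divide_nonneg_nonneg integral_nonneg) auto
      then show ?thesis unfolding e by (simp only: nonneg_Reals_of_real_iff)
    qed
    show ?thesis
      by (rule Lim_in_closed_set[OF closed_nonneg_Reals_complex always_eventually[OF allI[OF L0]] sequentially_bot L])
  qed
  have space: "star_prob_space nc_scale nc_star (moment_functional c :: marginal nc_poly \<Rightarrow> complex)"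
  proof (intro star_prob_space.intro nc_vector_space star_prob_space_axioms.intro pos)
  qed (rule nc_scale_mult(1) nc_scale_mult(2) nc_star_star nc_star_add nc_star_scale nc_star_mult
      moment_functional_add moment_functional_scale moment_functional_one)+
  have dist: "has_distribution (moment_functional c) (nc_var l) (MP c)" for l :: marginal
    unfolding has_distribution_def
  proof (intro allI conjI)
    fix k
    have "has_bochner_integral (MP c) (\<lambda>t. t ^ k) (mono_moment c k)" by (rule has_bochner_integral_MP_power[OF assms(1)])
    then show "integrable (MP c) (\<lambda>t. t ^ k)" "moment_functional c (nc_var l ^ k) = complex_of_real (\<integral>t. t ^ k \<partial>MP c)"
      by (auto simp: has_bochner_integral_iff nc_var_power word_moment_replicate)
  qed
  have conv: "converges_in_distribution M ?n A (moment_functional c) nc_var"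
    unfolding converges_in_distribution_def prod_list_nc_var using int lim by simp
  show "\<exists>sc star \<phi> (x :: marginal \<Rightarrow> marginal nc_poly).
        star_prob_space sc star \<phi> \<and>
        (\<forall>l. star (x l) = x l) \<and>
        free_elements sc \<phi> x \<and>
        has_distribution \<phi> (x AB) (MP c) \<and>
        has_distribution \<phi> (x AC) (MP c) \<and>
        converges_in_distribution M (\<lambda>N. NA N * N)
          (\<lambda>N \<omega> l. (1 / of_nat (NA N * N)) \<cdot>\<^sub>m marginal_mat (NA N) N (ND N) (X N \<omega>) l) \<phi> x"
    using space nc_star_var free_elements_nc_var dist conv unfolding A_def[abs_def] W_def
    by (intro exI[of _ nc_scale] exI[of _ nc_star] exI[of _ "moment_functional c"] exI[of _ nc_var]) blast
qed

end
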